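(* Let $\mathcal{V}^+_p$ be the countable partition model. Then: (1) if $|A|=\aleph_1$, every element of the model $\mathcal{N}_{12}(\aleph_1)$ (built from the same $M$, $A$, $\mathcal{G}$) belongs to $\mathcal{V}^+_p$; (2) each of Form 3, $\mathsf{ISAE}$, $\mathsf{EPWFP}$ fails in $\mathcal{V}^+_p$; (3) $\mathsf{AC_n}$ fails in $\mathcal{V}^+_p$ for every integer $n\ge2$; (4) in $\mathcal{V}^+_p$, the set $A$ cannot be linearly ordered; (5) each of $\mathsf{W_{\aleph_1}}$ and $\mathsf{DC_{\aleph_1}}$ fails in $\mathcal{V}^+_p$.
   Context: Permutation (Fraenkel–Mostowski) models: from a model $M$ of $\mathsf{ZFA}+\mathsf{AC}$ with a set $A$ of atoms, a group $\mathcal{G}$ of permutations of $A$ and a normal filter $\mathcal{F}$ of subgroups of $\mathcal{G}$, the permutation model is the class of hereditarily symmetric sets (a set $x$ is symmetric if $\{g\in\mathcal{G}:g(x)=x\}\in\mathcal{F}$); it is a model of $\mathsf{ZFA}$. $\mathrm{fix}_{\mathcal{G}}(x)=\{\phi\in\mathcal{G}:\forall y\in x\ \phi(y)=y\}$. The countable partition model $\mathcal{V}^+_p$: $A$ is an uncountable set of atoms, $\mathcal{G}$ is the group of all permutations of $A$, and $\mathcal{F}$ consists of the subgroups $H\supseteq\mathrm{fix}_{\mathcal{G}}(P)$ for some countable partition $P$ of $A$. $\mathcal{N}_{12}(\aleph_1)$: $A$ of size $\aleph_1$, $\mathcal{G}$ all permutations of $A$, filter generated by $\mathrm{fix}_{\mathcal{G}}(E)$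 for countable $E\subseteq A$. Form 3: for every infinite $X$, $X$ and $X\times\{0,1\}$ are equipotent. $\mathsf{ISAE}$: every infinite $X$ has a fixed-point-free permutation $f$ with $f^2=\mathrm{id}_X$. $\mathsf{EPWFP}$: every infinite set has a fixed-point-free permutation. $\mathsf{AC_n}$: every family of $n$-element sets has a choice function. $\mathsf{W_{\aleph_1}}$: for every set $X$, $|X|\le\aleph_1$ or $|X|\ge\aleph_1$. $\mathsf{DC_{\aleph_1}}$: if $S$ is non-empty and $R$ is a relation such that for every $\beta<\omega_1$ and every sequence $s=(s_\epsilon)_{\epsilon<\beta}$ of elements of $S$ there is $y\in S$ with $sRy$, then there is $f:\omega_1\to S$ with $(f\restriction\beta)Rf(\beta)$ for all $\beta<\omega_1$. *)

theory Defs
  imports Main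
begin

text \<open>
  Models of ZFA are arbitrary first-order structures: a universe, a binary relation, and an
  element interpreting the constant \<open>A\<close> (the set of all atoms). Every set-theoretic notion below
  is relativised to such a structure, so that it can be read in the ground model as well as in
  a permutation model. Nothing is assumed about the relation outside the universe.
\<close>

record 'm zfa_struct =
  univ :: "'m set"
  mem :: "'m \<Rightarrow> 'm \<Rightarrow> bool" (infix "\<epsilon>\<index>" 50)
  atoms :: 'm

text \<open>
  First-order formulas with de Bruijn indices, for the axiom schemata. The constant \<open>A\<close> needs no
  symbol of its own, since the schemata admit parameters.
\<close>

datatype fm = FMem nat nat | FEq nat nat | FNeg fm | FAnd fm fm | FAll fm

primrec sat :: "'m zfa_struct \<Rightarrow> (nat \<Rightarrow> 'm) \<Rightarrow> fm \<Rightarrow> bool" where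
  "sat M e (FMem i j) \<longleftrightarrow> e i \<epsilon>\<^bsub>M\<^esub> e j"
| "sat M e (FEq i j) \<longleftrightarrow> e i = e j"
| "sat M e (FNeg p) \<longleftrightarrow> \<not> sat M e p"
| "sat M e (FAnd p q) \<longleftrightarrow> sat M e p \<and> sat M e q"
| "sat M e (FAll p) \<longleftrightarrow> (\<forall>x\<in>univ M. sat M (case_nat x e) p)"

context
  fixes M :: "'m zfa_struct" (structure)
begin

abbreviation (input) "U \<equiv> univ M"

definition is_atom :: "'m \<Rightarrow> bool" where
  "is_atom x \<longleftrightarrow> x \<epsilon> atoms M"

definition is_set :: "'m \<Rightarrow> bool" where
  "is_set x \<longleftrightarrow> x \<in> U \<and> \<not> is_atom x"

text \<open>Only used for sets; an atom has no elements, hence is vacuously a subset of everything.\<close>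

definition sub :: "'m \<Rightarrow> 'm \<Rightarrow> bool" where
  "sub x y \<longleftrightarrow> (\<forall>z\<in>U. z \<epsilon> x \<longrightarrow> z \<epsilon> y)"

definition nonempty :: "'m \<Rightarrow> bool" where
  "nonempty x \<longleftrightarrow> (\<exists>z\<in>U. z \<epsilon> x)"

definition is_zero :: "'m \<Rightarrow> bool" where
  "is_zero x \<longleftrightarrow> is_set x \<and> \<not> nonempty x"

definition is_succ :: "'m \<Rightarrow> 'm \<Rightarrow> bool" where
  "is_succ x y \<longleftrightarrow> (\<forall>z\<in>U. z \<epsilon> y \<longleftrightarrow> z \<epsilon> x \<or> z = x)"

definition is_two :: "'m \<Rightarrow> bool" where
  "is_two t \<longleftrightarrow> (\<exists>z\<in>U. \<exists>u\<in>U. is_zero z \<and> is_succ z u \<and> is_succ u t)"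


subsection \<open>Pairs, relations, functions, cardinality\<close>

definition is_upair :: "'m \<Rightarrow> 'm \<Rightarrow> 'm \<Rightarrow> bool" where
  "is_upair x y p \<longleftrightarrow> (\<forall>z\<in>U. z \<epsilon> p \<longleftrightarrow> z = x \<or> z = y)"

definition is_pair :: "'m \<Rightarrow> 'm \<Rightarrow> 'm \<Rightarrow> bool" where
  "is_pair x y p \<longleftrightarrow> (\<exists>u\<in>U. \<exists>v\<in>U. is_upair x x u \<and> is_upair x y v \<and> is_upair u v p)"

definition rel :: "'m \<Rightarrow> 'm \<Rightarrow> 'm \<Rightarrow> bool" where
  "rel r x y \<longleftrightarrow> (\<exists>p\<in>U. is_pair x y p \<and> p \<epsilon> r)"

definition is_relation :: "'m \<Rightarrow> bool" where
  "is_relation r \<longleftrightarrow> is_set r \<and> (\<forall>p\<in>U. p \<epsilon> r \<longrightarrow> (\<exists>x\<in>U. \<exists>y\<in>U. is_pair x y p))"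

definition is_product :: "'m \<Rightarrow> 'm \<Rightarrow> 'm \<Rightarrow> bool" where
  "is_product X Y Z \<longleftrightarrow> is_set Z \<and>
     (\<forall>p\<in>U. p \<epsilon> Z \<longleftrightarrow> (\<exists>x\<in>U. \<exists>y\<in>U. x \<epsilon> X \<and> y \<epsilon> Y \<and> is_pair x y p))"

definition is_fun :: "'m \<Rightarrow> 'm \<Rightarrow> 'm \<Rightarrow> bool" where
  "is_fun f X Y \<longleftrightarrow> is_set f \<and>
     (\<forall>p\<in>U. p \<epsilon> f \<longrightarrow> (\<exists>x\<in>U. \<exists>y\<in>U. x \<epsilon> X \<and> y \<epsilon> Y \<and> is_pair x y p)) \<and>
     (\<forall>x\<in>U. x \<epsilon> X \<longrightarrow> (\<exists>!y. y \<in> U \<and> rel f x y))"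

definition is_inj :: "'m \<Rightarrow> 'm \<Rightarrow> 'm \<Rightarrow> bool" where
  "is_inj f X Y \<longleftrightarrow> is_fun f X Y \<and>
     (\<forall>x\<in>U. \<forall>x'\<in>U. \<forall>y\<in>U. rel f x y \<and> rel f x' y \<longrightarrow> x = x')"

definition is_bij :: "'m \<Rightarrow> 'm \<Rightarrow> 'm \<Rightarrow> bool" where
  "is_bij f X Y \<longleftrightarrow> is_inj f X Y \<and> (\<forall>y\<in>U. y \<epsilon> Y \<longrightarrow> (\<exists>x\<in>U. rel f x y))"

definition is_restr :: "'m \<Rightarrow> 'm \<Rightarrow> 'm \<Rightarrow> bool" where
  "is_restr f X s \<longleftrightarrow> is_set s \<and>
     (\<forall>p\<in>U. p \<epsilon> s \<longleftrightarrow> p \<epsilon> f \<and> (\<exists>x\<in>U. \<exists>y\<in>U. x \<epsilon> X \<and> is_pair x y p))"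

definition is_choice :: "'m \<Rightarrow> 'm \<Rightarrow> bool" where
  "is_choice f X \<longleftrightarrow> (\<exists>Y\<in>U. is_fun f X Y) \<and> (\<forall>x\<in>U. \<forall>y\<in>U. rel f x y \<longrightarrow> y \<epsilon> x)"

definition equipotent :: "'m \<Rightarrow> 'm \<Rightarrow> bool" where
  "equipotent X Y \<longleftrightarrow> (\<exists>f\<in>U. is_bij f X Y)"

definition card_le :: "'m \<Rightarrow> 'm \<Rightarrow> bool" where
  "card_le X Y \<longleftrightarrow> (\<exists>f\<in>U. is_inj f X Y)"

definition transitive :: "'m \<Rightarrow> bool" where
  "transitive t \<longleftrightarrow> (\<forall>x\<in>U. \<forall>y\<in>U. y \<epsilon> x \<and> x \<epsilon> t \<longrightarrow> y \<epsilon> t)"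

text \<open>
  An ordinal is a pure transitive set that is linearly ordered by membership; that this is a
  wellorder is the axiom of regularity. The clause on elements is needed because of atoms:
  without it \<open>{a}\<close> would be an ordinal for every atom \<open>a\<close>.
\<close>

definition is_ordinal :: "'m \<Rightarrow> bool" where
  "is_ordinal a \<longleftrightarrow> is_set a \<and> transitive a \<and> (\<forall>x\<in>U. x \<epsilon> a \<longrightarrow> is_set x) \<and>
     (\<forall>x\<in>U. \<forall>y\<in>U. x \<epsilon> a \<and> y \<epsilon> a \<longrightarrow> x \<epsilon> y \<or> x = y \<or> y \<epsilon> x)"

definition is_nat :: "'m \<Rightarrow> bool" where
  "is_nat n \<longleftrightarrow> is_ordinal n \<and>
     (\<forall>m\<in>U. m \<epsilon> n \<or> m = n \<longrightarrow> is_zero m \<or> (\<exists>k\<in>U. is_succ k m))"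

definition is_omega :: "'m \<Rightarrow> bool" where
  "is_omega w \<longleftrightarrow> is_set w \<and> (\<forall>x\<in>U. x \<epsilon> w \<longleftrightarrow> is_nat x)"

definition finite_set :: "'m \<Rightarrow> bool" where
  "finite_set X \<longleftrightarrow> (\<exists>n\<in>U. is_nat n \<and> equipotent X n)"

definition infinite_set :: "'m \<Rightarrow> bool" where
  "infinite_set X \<longleftrightarrow> is_set X \<and> \<not> finite_set X"

definition countable_set :: "'m \<Rightarrow> bool" where
  "countable_set X \<longleftrightarrow> (\<exists>w\<in>U. is_omega w \<and> card_le X w)"

text \<open>The least uncountable ordinal, which is also the cardinal \<open>\<aleph>\<^sub>1\<close>.\<close>

definition is_omega1 :: "'m \<Rightarrow> bool" where
  "is_omega1 w \<longleftrightarrow> is_ordinal w \<and> \<not> countable_set w \<and> (\<forall>x\<in>U. x \<epsilon> w \<longrightarrow> countable_set x)"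


subsection \<open>The axioms of ZFA and the axiom of choice\<close>

definition ax_empty_atoms :: bool where
  "ax_empty_atoms \<longleftrightarrow> (\<exists>z\<in>U. \<not> nonempty z \<and>
     (\<forall>a\<in>U. is_atom a \<longleftrightarrow> a \<noteq> z \<and> \<not> nonempty a))"

definition ax_extensionality :: bool where
  "ax_extensionality \<longleftrightarrow>
     (\<forall>x y. is_set x \<and> is_set y \<and> (\<forall>z\<in>U. z \<epsilon> x \<longleftrightarrow> z \<epsilon> y) \<longrightarrow> x = y)"

definition ax_pairing :: bool where
  "ax_pairing \<longleftrightarrow> (\<forall>x\<in>U. \<forall>y\<in>U. \<exists>p\<in>U. is_upair x y p)"

definition ax_union :: bool where
  "ax_union \<longleftrightarrow> (\<forall>x\<in>U. \<exists>u\<in>U. \<forall>z\<in>U. z \<epsilon> u \<longleftrightarrow> (\<exists>y\<in>U. y \<epsilon> x \<and> z \<epsilon> y))"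

definition ax_power :: bool where
  "ax_power \<longleftrightarrow> (\<forall>x\<in>U. \<exists>p\<in>U. \<forall>y\<in>U. y \<epsilon> p \<longleftrightarrow> is_set y \<and> sub y x)"

definition ax_infinity :: bool where
  "ax_infinity \<longleftrightarrow> (\<exists>x\<in>U. (\<exists>z\<in>U. is_zero z \<and> z \<epsilon> x) \<and>
     (\<forall>y\<in>U. y \<epsilon> x \<longrightarrow> (\<exists>s\<in>U. is_succ y s \<and> s \<epsilon> x)))"

definition ax_regularity :: bool where
  "ax_regularity \<longleftrightarrow> (\<forall>x\<in>U. nonempty x \<longrightarrow>
     (\<exists>y\<in>U. y \<epsilon> x \<and> \<not> (\<exists>z\<in>U. z \<epsilon> x \<and> z \<epsilon> y)))"

definition ax_separation :: bool where
  "ax_separation \<longleftrightarrow> (\<forall>p e. range e \<subseteq> U \<longrightarrow>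
     (\<forall>x\<in>U. \<exists>y\<in>U. \<forall>z\<in>U. z \<epsilon> y \<longleftrightarrow> z \<epsilon> x \<and> sat M (case_nat z e) p))"

definition ax_replacement :: bool where
  "ax_replacement \<longleftrightarrow> (\<forall>p e. range e \<subseteq> U \<longrightarrow>
     (\<forall>u\<in>U. \<forall>v\<in>U. \<forall>w\<in>U. sat M (case_nat u (case_nat v e)) p \<and>
        sat M (case_nat u (case_nat w e)) p \<longrightarrow> v = w) \<longrightarrow>
     (\<forall>x\<in>U. \<exists>y\<in>U. \<forall>v\<in>U. v \<epsilon> y \<longleftrightarrow>
        (\<exists>u\<in>U. u \<epsilon> x \<and> sat M (case_nat u (case_nat v e)) p)))"

definition zfa_model :: bool where
  "zfa_model \<longleftrightarrow> atoms M \<in> U \<and> ax_empty_atoms \<and> ax_extensionality \<and> ax_pairing \<and> ax_union \<and>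
     ax_power \<and> ax_infinity \<and> ax_regularity \<and> ax_separation \<and> ax_replacement"

definition axiom_of_choice :: bool where
  "axiom_of_choice \<longleftrightarrow> (\<forall>X\<in>U. (\<forall>x\<in>U. x \<epsilon> X \<longrightarrow> nonempty x) \<longrightarrow> (\<exists>f\<in>U. is_choice f X))"


subsection \<open>Groups of permutations of the atoms, and their filters of subgroups\<close>

definition is_identity :: "'m \<Rightarrow> 'm \<Rightarrow> bool" where
  "is_identity X i \<longleftrightarrow> is_relation i \<and> (\<forall>x\<in>U. \<forall>y\<in>U. rel i x y \<longleftrightarrow> x \<epsilon> X \<and> x = y)"

definition is_comp :: "'m \<Rightarrow> 'm \<Rightarrow> 'm \<Rightarrow> bool" where
  "is_comp g h k \<longleftrightarrow> is_relation k \<and>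
     (\<forall>x\<in>U. \<forall>z\<in>U. rel k x z \<longleftrightarrow> (\<exists>y\<in>U. rel h x y \<and> rel g y z))"

definition is_inverse :: "'m \<Rightarrow> 'm \<Rightarrow> bool" where
  "is_inverse g k \<longleftrightarrow> is_relation k \<and> (\<forall>x\<in>U. \<forall>y\<in>U. rel k x y \<longleftrightarrow> rel g y x)"

definition is_full_sym_group :: "'m \<Rightarrow> bool" where
  "is_full_sym_group G \<longleftrightarrow> is_set G \<and> (\<forall>g\<in>U. g \<epsilon> G \<longleftrightarrow> is_bij g (atoms M) (atoms M))"

definition is_subgroup :: "'m \<Rightarrow> 'm \<Rightarrow> bool" where
  "is_subgroup G H \<longleftrightarrow> is_set H \<and> sub H G \<and>
     (\<exists>i\<in>U. is_identity (atoms M) i \<and> i \<epsilon> H) \<and>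
     (\<forall>g\<in>U. \<forall>h\<in>U. \<forall>k\<in>U. g \<epsilon> H \<and> h \<epsilon> H \<and> is_comp g h k \<longrightarrow> k \<epsilon> H) \<and>
     (\<forall>g\<in>U. \<forall>k\<in>U. g \<epsilon> H \<and> is_inverse g k \<longrightarrow> k \<epsilon> H)"

definition is_filter :: "'m \<Rightarrow> 'm \<Rightarrow> bool" where
  "is_filter G F \<longleftrightarrow> is_set F \<and> G \<epsilon> F \<and> (\<forall>H\<in>U. H \<epsilon> F \<longrightarrow> is_subgroup G H) \<and>
     (\<forall>H\<in>U. \<forall>K\<in>U. H \<epsilon> F \<and> is_subgroup G K \<and> sub H K \<longrightarrow> K \<epsilon> F) \<and>
     (\<forall>H\<in>U. \<forall>K\<in>U. \<forall>L\<in>U. H \<epsilon> F \<and> K \<epsilon> F \<and> is_set L \<and>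
        (\<forall>g\<in>U. g \<epsilon> L \<longleftrightarrow> g \<epsilon> H \<and> g \<epsilon> K) \<longrightarrow> L \<epsilon> F)"

definition is_generated_filter :: "'m \<Rightarrow> ('m \<Rightarrow> bool) \<Rightarrow> 'm \<Rightarrow> bool" where
  "is_generated_filter G B F \<longleftrightarrow> is_filter G F \<and> (\<forall>H\<in>U. B H \<longrightarrow> H \<epsilon> F) \<and>
     (\<forall>F'\<in>U. is_filter G F' \<and> (\<forall>H\<in>U. B H \<longrightarrow> H \<epsilon> F') \<longrightarrow> sub F F')"

text \<open>
  The action of a permutation \<open>g\<close> of the atoms on the universe, given by the recursion
  \<open>g(x) = {g(z). z \<in> x}\<close> on sets: \<open>is_action_fun g t f\<close> says that \<open>f\<close> solves this recursion on
  the transitive domain \<open>t\<close>, and \<open>acts g x y\<close> that \<open>g(x) = y\<close>.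
\<close>

definition is_action_fun :: "'m \<Rightarrow> 'm \<Rightarrow> 'm \<Rightarrow> bool" where
  "is_action_fun g t f \<longleftrightarrow> transitive t \<and> (\<exists>Y\<in>U. is_fun f t Y) \<and>
     (\<forall>u\<in>U. \<forall>v\<in>U. rel f u v \<longrightarrow>
        (if is_atom u then rel g u v
         else is_set v \<and> (\<forall>z\<in>U. z \<epsilon> v \<longleftrightarrow> (\<exists>w\<in>U. w \<epsilon> u \<and> rel f w z))))"

definition acts :: "'m \<Rightarrow> 'm \<Rightarrow> 'm \<Rightarrow> bool" where
  "acts g x y \<longleftrightarrow> (\<exists>t\<in>U. \<exists>f\<in>U. is_action_fun g t f \<and> rel f x y)"

definition is_stab :: "'m \<Rightarrow> 'm \<Rightarrow> 'm \<Rightarrow> bool" where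
  "is_stab G x H \<longleftrightarrow> is_set H \<and> (\<forall>g\<in>U. g \<epsilon> H \<longleftrightarrow> g \<epsilon> G \<and> acts g x x)"

definition is_fix :: "'m \<Rightarrow> 'm \<Rightarrow> 'm \<Rightarrow> bool" where
  "is_fix G x H \<longleftrightarrow> is_set H \<and>
     (\<forall>g\<in>U. g \<epsilon> H \<longleftrightarrow> g \<epsilon> G \<and> (\<forall>y\<in>U. y \<epsilon> x \<longrightarrow> acts g y y))"


subsection \<open>Permutation models\<close>

definition symmetric :: "'m \<Rightarrow> 'm \<Rightarrow> 'm \<Rightarrow> bool" where
  "symmetric G F x \<longleftrightarrow> (\<exists>H\<in>U. is_stab G x H \<and> H \<epsilon> F)"

text \<open>\<open>t\<close> is the transitive closure of \<open>{x}\<close>.\<close>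

definition is_tclosure :: "'m \<Rightarrow> 'm \<Rightarrow> bool" where
  "is_tclosure x t \<longleftrightarrow> transitive t \<and> x \<epsilon> t \<and>
     (\<forall>s\<in>U. transitive s \<and> x \<epsilon> s \<longrightarrow> sub t s)"

definition hereditarily_symmetric :: "'m \<Rightarrow> 'm \<Rightarrow> 'm \<Rightarrow> bool" where
  "hereditarily_symmetric G F x \<longleftrightarrow>
     (\<exists>t\<in>U. is_tclosure x t \<and> (\<forall>y\<in>U. y \<epsilon> t \<longrightarrow> symmetric G F y))"

definition perm_model :: "'m \<Rightarrow> 'm \<Rightarrow> 'm zfa_struct" where
  "perm_model G F = M\<lparr>univ := {x \<in> U. hereditarily_symmetric G F x}\<rparr>"

definition is_partition :: "'m \<Rightarrow> 'm \<Rightarrow> bool" where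
  "is_partition X P \<longleftrightarrow> is_set P \<and>
     (\<forall>p\<in>U. p \<epsilon> P \<longrightarrow> nonempty p \<and> sub p X) \<and>
     (\<forall>p\<in>U. \<forall>q\<in>U. p \<epsilon> P \<and> q \<epsilon> P \<and> p \<noteq> q \<longrightarrow> \<not> (\<exists>z\<in>U. z \<epsilon> p \<and> z \<epsilon> q)) \<and>
     (\<forall>x\<in>U. x \<epsilon> X \<longrightarrow> (\<exists>p\<in>U. p \<epsilon> P \<and> x \<epsilon> p))"

definition is_countable_partition_filter :: "'m \<Rightarrow> 'm \<Rightarrow> bool" where
  "is_countable_partition_filter G F \<longleftrightarrow> is_set F \<and>
     (\<forall>H\<in>U. H \<epsilon> F \<longleftrightarrow> is_subgroup G H \<and>
        (\<exists>P\<in>U. \<exists>K\<in>U. is_partition (atoms M) P \<and> countable_set P \<and> is_fix G P K \<and> sub K H))"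

definition is_countable_support_filter :: "'m \<Rightarrow> 'm \<Rightarrow> bool" where
  "is_countable_support_filter G F \<longleftrightarrow> is_generated_filter G
     (\<lambda>H. \<exists>E\<in>U. is_set E \<and> sub E (atoms M) \<and> countable_set E \<and> is_fix G E H) F"


subsection \<open>Consequences of choice\<close>

definition form3 :: bool where
  "form3 \<longleftrightarrow> (\<forall>X\<in>U. \<forall>t\<in>U. \<forall>Y\<in>U. infinite_set X \<and> is_two t \<and> is_product X t Y \<longrightarrow>
     equipotent X Y)"

definition fixpoint_free_perm :: "'m \<Rightarrow> 'm \<Rightarrow> bool" where
  "fixpoint_free_perm f X \<longleftrightarrow> is_bij f X X \<and> (\<forall>x\<in>U. \<not> rel f x x)"

definition ISAE :: bool where
  "ISAE \<longleftrightarrow> (\<forall>X\<in>U. infinite_set X \<longrightarrow>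
     (\<exists>f\<in>U. fixpoint_free_perm f X \<and> (\<exists>i\<in>U. is_identity X i \<and> is_comp f f i)))"

definition EPWFP :: bool where
  "EPWFP \<longleftrightarrow> (\<forall>X\<in>U. infinite_set X \<longrightarrow> (\<exists>f\<in>U. fixpoint_free_perm f X))"

definition AC_n :: "'m \<Rightarrow> bool" where
  "AC_n n \<longleftrightarrow> (\<forall>X\<in>U. is_set X \<and> (\<forall>x\<in>U. x \<epsilon> X \<longrightarrow> is_set x \<and> equipotent x n) \<longrightarrow>
     (\<exists>f\<in>U. is_choice f X))"

definition is_linear_order :: "'m \<Rightarrow> 'm \<Rightarrow> bool" where
  "is_linear_order X r \<longleftrightarrow> is_relation r \<and>
     (\<forall>x\<in>U. \<forall>y\<in>U. rel r x y \<longrightarrow> x \<epsilon> X \<and> y \<epsilon> X) \<and>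
     (\<forall>x\<in>U. \<forall>y\<in>U. rel r x y \<and> rel r y x \<longrightarrow> x = y) \<and>
     (\<forall>x\<in>U. \<forall>y\<in>U. \<forall>z\<in>U. rel r x y \<and> rel r y z \<longrightarrow> rel r x z) \<and>
     (\<forall>x\<in>U. \<forall>y\<in>U. x \<epsilon> X \<and> y \<epsilon> X \<longrightarrow> rel r x y \<or> rel r y x)"

definition W_aleph1 :: bool where
  "W_aleph1 \<longleftrightarrow> (\<forall>w\<in>U. is_omega1 w \<longrightarrow> (\<forall>X\<in>U. is_set X \<longrightarrow> card_le X w \<or> card_le w X))"

definition DC_aleph1 :: bool where
  "DC_aleph1 \<longleftrightarrow> (\<forall>w\<in>U. is_omega1 w \<longrightarrow> (\<forall>S\<in>U. \<forall>R\<in>U. nonempty S \<and> is_relation R \<and>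
     (\<forall>b\<in>U. \<forall>s\<in>U. b \<epsilon> w \<and> is_fun s b S \<longrightarrow> (\<exists>y\<in>U. y \<epsilon> S \<and> rel R s y)) \<longrightarrow>
     (\<exists>f\<in>U. is_fun f w S \<and>
        (\<forall>b\<in>U. \<forall>s\<in>U. \<forall>y\<in>U. b \<epsilon> w \<and> is_restr f b s \<and> rel f b y \<longrightarrow> rel R s y))))"

end

end

theory Submission
  imports Defs
begin

text \<open>
  An object of the model is supported by a countable partition \<open>P\<close> of the atoms. Since countable
  unions of countable sets are countable in \<open>M\<close>, some block of \<open>P\<close> is uncountable, and every
  transposition of two atoms of one block fixes \<open>P\<close>, hence the object. Applied to a bijection
  between \<open>A\<close> and \<open>A \<times> 2\<close>, a fixed-point-free permutation of \<open>A\<close>, a choice function on the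
  \<open>n\<close>-element sets of atoms, a linear order of \<open>A\<close>, or an injection of \<open>A\<close> into \<open>\<omega>\<^sub>1\<close>, such a
  transposition gives a contradiction. An injection of \<open>\<omega>\<^sub>1\<close> into \<open>A\<close> would hit every block at most
  once and thus inject \<open>\<omega>\<^sub>1\<close> into \<open>P\<close>; but \<open>DC\<close> for the relation ``\<open>y\<close> is not a value of the
  countable sequence \<open>s\<close>'' would produce one, because the model contains all countable sequences
  of atoms.

  All of this happens inside an arbitrary, possibly ill-founded structure, where separation and
  replacement are available for first-order formulas only. Definability is therefore tracked
  by a syntax-free calculus, and sets of the structure are identified with their extensions.
\<close>

section \<open>Definability with parameters\<close>

text \<open>Natural numbers of the structure may be nonstandard, so HOL induction and HOL finiteness
  say nothing about them: every induction runs inside, over \<open>Om\<close> or along membership,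
  and demands a definable predicate. Hence even basic facts on ordinals, countability and
  permutations are derived internally. Ordinals are pure sets, so every permutation fixes them. The
  permutation model therefore has all ordinals of \<open>M\<close>, with the same \<omega> and the
  same \<open>omega1\<close>, and a transposition applied to a function between atoms and ordinals
  moves its atoms only. Choice is used at one place, in \<open>M\<close>: it picks an injection into
  \<omega> for each block of a countable partition. For permutations of \<open>A\<close> and
  bijections onto \<open>A \<times> 2\<close>, an image or preimage of an atom of the uncountable
  block may lie inside or outside this block; that decides which atom is swapped with a fresh one.
  For the inclusion of the countable support model, a countable set of atoms becomes the partition
  into its singletons and the rest. As the support filter is the least filter over its base, the
  partition filter must be shown to be a filter, which rests on common refinements.\<close>

primrec ren :: "(nat \<Rightarrow> nat) \<Rightarrow> fm \<Rightarrow> fm" where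
  "ren f (FMem i j) = FMem (f i) (f j)"
| "ren f (FEq i j) = FEq (f i) (f j)"
| "ren f (FNeg p) = FNeg (ren f p)"
| "ren f (FAnd p q) = FAnd (ren f p) (ren f q)"
| "ren f (FAll p) = FAll (ren (case_nat 0 (\<lambda>i. Suc (f i))) p)"

text \<open>No capture occurs: under \<open>FAll\<close> index 0 is kept and the renaming acts on
  the successors. It reroutes variable and parameter slots when formulas with different parameters
  are combined.\<close>

lemma sat_ren: "sat M e (ren f p) \<longleftrightarrow> sat M (\<lambda>i. e (f i)) p"
proof (induction p arbitrary: e f)
  case (FAll p)
  have "(\<lambda>i. case_nat x e (case_nat 0 (\<lambda>i. Suc (f i)) i)) = case_nat x (\<lambda>i. e (f i))" for x
    by (auto split: nat.split)
  then show ?case by (simp add: FAll)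
qed auto

text \<open>Interleaving leaves infinitely many slots for variables and infinitely many for
  parameters, so neither arities nor finite parameter lists have to be tracked.\<close>

definition mix :: "(nat \<Rightarrow> 'a) \<Rightarrow> (nat \<Rightarrow> 'a) \<Rightarrow> nat \<Rightarrow> 'a" where
  "mix e c i = (if even i then e (i div 2) else c (i div 2))"

lemma mix_simps [simp]: "mix e c (2 * i) = e i" "mix e c (Suc (2 * i)) = c i" "mix e c 0 = e 0"
  by (auto simp: mix_def)

lemma mix_eqI: "(\<And>k. h (2 * k) = e k) \<Longrightarrow> (\<And>k. h (Suc (2 * k)) = c k) \<Longrightarrow> h = mix e c"
  by (rule ext) (auto simp: mix_def elim!: evenE oddE)

locale zfa =
  fixes M :: "'m zfa_struct"
  assumes zfa: "zfa_model M"
begin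

abbreviation "UM \<equiv> univ M"
abbreviation "iset \<equiv> is_set M"
abbreviation "Atm \<equiv> atoms M"

text \<open>
  \<open>D P\<close>: the predicate \<open>P\<close> on assignments is given by a formula with parameters, the latter being
  read off the odd positions of the assignment. \<open>T t\<close>: the function \<open>t\<close> on assignments has a
  definable graph. Variables are de Bruijn indices, so \<open>\<lambda>i. e (Suc i)\<close> is \<open>e\<close> without the last bound one.
\<close>

definition D :: "((nat \<Rightarrow> 'm) \<Rightarrow> bool) \<Rightarrow> bool" where
  "D P \<longleftrightarrow> (\<exists>p c. range c \<subseteq> UM \<and> (\<forall>e. range e \<subseteq> UM \<longrightarrow> P e = sat M (mix e c) p))"

definition T :: "((nat \<Rightarrow> 'm) \<Rightarrow> 'm) \<Rightarrow> bool" where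
  "T t \<longleftrightarrow> (\<forall>e. range e \<subseteq> UM \<longrightarrow> t e \<in> UM) \<and> D (\<lambda>e. e 0 = t (\<lambda>i. e (Suc i)))"

lemma Atm_U [simp]: "Atm \<in> UM" using zfa by (simp add: zfa_model_def)

lemma D_cong: "(\<And>e. range e \<subseteq> UM \<Longrightarrow> P e = Q e) \<Longrightarrow> D Q \<Longrightarrow> D P"
  unfolding D_def by metis

lemma D_mem_var: "D (\<lambda>e. mem M (e i) (e j))"
  unfolding D_def by (rule exI[of _ "FMem (2*i) (2*j)"], rule exI[of _ "\<lambda>_. Atm"]) auto

lemma D_eq_var: "D (\<lambda>e. e i = e j)"
  unfolding D_def by (rule exI[of _ "FEq (2*i) (2*j)"], rule exI[of _ "\<lambda>_. Atm"]) auto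

lemma D_eq_const: "c \<in> UM \<Longrightarrow> D (\<lambda>e. e i = c)"
  unfolding D_def
  by (rule exI[of _ "FEq (2*i) 1"], rule exI[of _ "\<lambda>_. c"]) (auto simp: mix_def)

lemma D_not: "D P \<Longrightarrow> D (\<lambda>e. \<not> P e)"
  unfolding D_def by (metis sat.simps(3))

lemma D_conj: assumes "D P" "D Q" shows "D (\<lambda>e. P e \<and> Q e)"
proof -
  obtain p c where c: "range c \<subseteq> UM" "\<And>e. range e \<subseteq> UM \<Longrightarrow> P e = sat M (mix e c) p"
    using assms(1) unfolding D_def by auto
  obtain q d where d: "range d \<subseteq> UM" "\<And>e. range e \<subseteq> UM \<Longrightarrow> Q e = sat M (mix e d) q"
    using assms(2) unfolding D_def by auto
  \<comment> \<open>The two parameter sequences are merged into \<open>mix c d\<close>;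
    \<open>f\<close> sends the parameter slots to its even entries, \<open>g\<close> to its odd
    ones.\<close>
  define f :: "nat \<Rightarrow> nat" where "f = mix (\<lambda>k. 2 * k) (\<lambda>k. Suc (2 * (2 * k)))"
  define g :: "nat \<Rightarrow> nat" where "g = mix (\<lambda>k. 2 * k) (\<lambda>k. Suc (2 * Suc (2 * k)))"
  have f: "(\<lambda>i. mix e (mix c d) (f i)) = mix e c" for e
    by (rule mix_eqI) (simp_all only: f_def mix_simps)
  have g: "(\<lambda>i. mix e (mix c d) (g i)) = mix e d" for e
    by (rule mix_eqI) (simp_all only: g_def mix_simps)
  have "range (mix c d) \<subseteq> UM" using c d by (auto simp: mix_def)
  moreover have "(P e \<and> Q e) = sat M (mix e (mix c d)) (FAnd (ren f p) (ren g q))"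
    if "range e \<subseteq> UM" for e
    using that c d by (simp add: sat_ren f g)
  ultimately show ?thesis unfolding D_def by blast
qed

lemma D_sub: assumes "D P" shows "D (\<lambda>e. P (\<lambda>i. e (h i)))"
proof -
  obtain p c where c: "range c \<subseteq> UM" "\<And>e. range e \<subseteq> UM \<Longrightarrow> P e = sat M (mix e c) p"
    using assms(1) unfolding D_def by auto
  define f :: "nat \<Rightarrow> nat" where "f = mix (\<lambda>k. 2 * h k) (\<lambda>k. Suc (2 * k))"
  have f: "(\<lambda>i. mix e c (f i)) = mix (\<lambda>i. e (h i)) c" for e
    by (rule mix_eqI) (simp_all only: f_def mix_simps)
  have "P (\<lambda>i. e (h i)) = sat M (mix e c) (ren f p)" if "range e \<subseteq> UM" for e
    using that c(2)[of "\<lambda>i. e (h i)"] by (auto simp add: sat_ren f)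
  then show ?thesis using c(1) unfolding D_def by blast
qed

lemma D_all: assumes "D (\<lambda>e. P (e 0) (\<lambda>i. e (Suc i)))" shows "D (\<lambda>e. \<forall>x\<in>UM. P x e)"
proof -
  obtain p c where c: "range c \<subseteq> UM"
    "\<And>e. range e \<subseteq> UM \<Longrightarrow> P (e 0) (\<lambda>i. e (Suc i)) = sat M (mix e c) p"
    using assms(1) unfolding D_def by auto
  \<comment> \<open>The quantifier puts \<open>x\<close> in front of \<open>mix e c\<close>,
    shifting it by one. In the shifted environment variable \<open>j + 1\<close> is found at
    \<open>2 * j + 1\<close> and parameter \<open>k\<close> at \<open>2 * k + 2\<close>.\<close>
  define f :: "nat \<Rightarrow> nat" where
    "f = mix (case_nat 0 (\<lambda>j. Suc (2 * j))) (\<lambda>k. Suc (Suc (2 * k)))"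
  have f: "(\<lambda>i. case_nat x (mix e c) (f i)) = mix (case_nat x e) c" for e x
    by (rule mix_eqI) (simp_all only: f_def mix_simps, simp_all split: nat.split)
  have "(\<forall>x\<in>UM. P x e) = sat M (mix e c) (FAll (ren f p))" if "range e \<subseteq> UM" for e
  proof -
    have "P x e = sat M (mix (case_nat x e) c) p" if "x \<in> UM" for x
      using c(2)[of "case_nat x e"] that \<open>range e \<subseteq> UM\<close> by (auto simp: image_subset_iff split: nat.splits)
    then show ?thesis by (simp add: sat_ren f)
  qed
  then show ?thesis using c(1) unfolding D_def by blast
qed

lemma D_const: "D (\<lambda>e. Q)"
proof -
  have "D (\<lambda>e. True)" by (rule D_cong[OF _ D_eq_var[of 0 0]]) auto
  moreover have "D (\<lambda>e. False)" by (rule D_cong[OF _ D_not[OF D_eq_var[of 0 0]]]) auto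
  ultimately show ?thesis by (cases Q) auto
qed

lemma D_disj: "D P \<Longrightarrow> D Q \<Longrightarrow> D (\<lambda>e. P e \<or> Q e)"
  by (rule D_cong[of _ "\<lambda>e. \<not> (\<not> P e \<and> \<not> Q e)"], (auto)[1], intro D_not D_conj; assumption?)
lemma D_imp: "D P \<Longrightarrow> D Q \<Longrightarrow> D (\<lambda>e. P e \<longrightarrow> Q e)"
  by (rule D_cong[of _ "\<lambda>e. \<not> P e \<or> Q e"], (auto)[1], intro D_not D_disj; assumption?)
lemma D_iff: "D P \<Longrightarrow> D Q \<Longrightarrow> D (\<lambda>e. P e = Q e)"
  by (rule D_cong[of _ "\<lambda>e. (P e \<longrightarrow> Q e) \<and> (Q e \<longrightarrow> P e)"], (auto)[1], intro D_imp D_conj; assumption?)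
lemma D_if: "D P \<Longrightarrow> D Q \<Longrightarrow> D R \<Longrightarrow> D (\<lambda>e. if P e then Q e else R e)"
  by (rule D_cong[of _ "\<lambda>e. (P e \<longrightarrow> Q e) \<and> (\<not> P e \<longrightarrow> R e)"], (auto)[1], intro D_imp D_conj D_not; assumption?)
lemma D_ex: "D (\<lambda>e. P (e 0) (\<lambda>i. e (Suc i))) \<Longrightarrow> D (\<lambda>e. \<exists>x\<in>UM. P x e)"
  by (rule D_cong[of _ "\<lambda>e. \<not> (\<forall>x\<in>UM. \<not> P x e)"], (auto)[1], intro D_not D_all; assumption?)

text \<open>The language has no terms, so a term with definable graph is eliminated by quantifying
  over its only value.\<close>

lemma D_inst:
  assumes "T t" "D (\<lambda>e. P (e 0) (\<lambda>i. e (Suc i)))" shows "D (\<lambda>e. P (t e) e)"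
proof -
  have "D (\<lambda>e. \<forall>x\<in>UM. x = t e \<longrightarrow> P x e)"
    using assms by (intro D_all D_imp) (auto simp: T_def)
  then show ?thesis by (rule D_cong[rotated]) (use assms in \<open>auto simp: T_def\<close>)
qed

lemma T_U: "T t \<Longrightarrow> range e \<subseteq> UM \<Longrightarrow> t e \<in> UM" by (auto simp: T_def)

lemma T_var: "T (\<lambda>e. e i)" by (auto simp: T_def D_eq_var)
lemma T_const: "c \<in> UM \<Longrightarrow> T (\<lambda>e. c)" by (auto simp: T_def D_eq_const)
lemma T_sub: assumes "T t" shows "T (\<lambda>e. t (\<lambda>i. e (h i)))"
  unfolding T_def
proof (intro conjI allI impI)
  fix e :: "nat \<Rightarrow> 'm" assume "range e \<subseteq> UM" then show "t (\<lambda>i. e (h i)) \<in> UM"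
    using assms unfolding T_def by (auto simp: image_subset_iff)
next
  have "D (\<lambda>e. e 0 = t (\<lambda>i. e (Suc i)))" using assms by (simp add: T_def)
  from D_sub[OF this, of "case_nat 0 (\<lambda>i. Suc (h i))"]
  show "D (\<lambda>e. e 0 = t (\<lambda>i. e (Suc (h i))))" by simp
qed
lemma T_shift: "T t \<Longrightarrow> T (\<lambda>e. t (\<lambda>i. e (Suc i)))" by (rule T_sub)

lemma D_mem: assumes "T t" "T s" shows "D (\<lambda>e. mem M (t e) (s e))"
  by (rule D_inst[OF assms(1), where P="\<lambda>x e. mem M x (s e)"],
      rule D_inst[OF T_shift[OF assms(2)], where P="\<lambda>x e. mem M (e 0) x"]) (rule D_mem_var)
lemma D_eq: assumes "T t" "T s" shows "D (\<lambda>e. t e = s e)"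
  by (rule D_inst[OF assms(1), where P="\<lambda>x e. x = s e"],
      rule D_inst[OF T_shift[OF assms(2)], where P="\<lambda>x e. e 0 = x"]) (rule D_eq_var)
lemma D_inU: "T t \<Longrightarrow> D (\<lambda>e. t e \<in> UM)"
  by (rule D_cong[OF _ D_const[of True]]) (auto simp: T_U)

definition E :: "'m \<Rightarrow> 'm set" where "E x = {z\<in>UM. mem M z x}"

lemma E_U: "z \<in> E x \<Longrightarrow> z \<in> UM" by (simp add: E_def)

lemma D_inE: "T t \<Longrightarrow> T s \<Longrightarrow> D (\<lambda>e. t e \<in> E (s e))"
  by (rule D_cong[of _ "\<lambda>e. mem M (t e) (s e)"]) (auto simp: E_def T_U D_mem)
lemma D_ballE: "T s \<Longrightarrow> D (\<lambda>e. P (e 0) (\<lambda>i. e (Suc i))) \<Longrightarrow> D (\<lambda>e. \<forall>x\<in>E (s e). P x e)"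
  by (rule D_cong[of _ "\<lambda>e. \<forall>x\<in>UM. mem M x (s e) \<longrightarrow> P x e"], (auto simp: E_def)[1], intro D_all D_imp D_mem T_var T_shift; assumption?)
lemma D_bexE: "T s \<Longrightarrow> D (\<lambda>e. P (e 0) (\<lambda>i. e (Suc i))) \<Longrightarrow> D (\<lambda>e. \<exists>x\<in>E (s e). P x e)"
  by (rule D_cong[of _ "\<lambda>e. \<exists>x\<in>UM. mem M x (s e) \<and> P x e"], (auto simp: E_def)[1], intro D_ex D_conj D_mem T_var T_shift; assumption?)
lemma D_sub2: "D (\<lambda>e. P (e 0) (\<lambda>i. e (Suc i))) \<Longrightarrow> D (\<lambda>e. P (e 0) (\<lambda>i. e (Suc (Suc i))))"
  by (drule D_sub[where h="case_nat 0 (\<lambda>i. Suc (Suc i))"]) simp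
lemma D_ex1: assumes "D (\<lambda>e. P (e 0) (\<lambda>i. e (Suc i)))" shows "D (\<lambda>e. \<exists>!y. y \<in> UM \<and> P y e)"
proof (rule D_cong)
  show "(\<exists>!y. y \<in> UM \<and> P y e) = (\<exists>y\<in>UM. P y e \<and> (\<forall>z\<in>UM. P z e \<longrightarrow> z = y))" for e
    by metis
  show "D (\<lambda>e. \<exists>y\<in>UM. P y e \<and> (\<forall>z\<in>UM. P z e \<longrightarrow> z = y))"
    using assms D_sub2[OF assms] by (intro D_ex D_all D_conj D_imp D_eq_var)
qed

text \<open>These rules follow the shape of a predicate or term, so that definability conditions are
  discharged by repeated introduction; notions defined later contribute rules of their own.\<close>

named_theorems def_intros
declare D_not[def_intros] D_conj[def_intros] D_disj[def_intros] D_imp[def_intros] D_iff[def_intros]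
  D_if[def_intros] D_all[def_intros] D_ex[def_intros] D_ex1[def_intros] D_eq[def_intros]
  D_inE[def_intros] D_inU[def_intros] D_ballE[def_intros] D_bexE[def_intros]
  T_var[def_intros] T_const[def_intros]

section \<open>Sets inside the model\<close>

lemma E_subset_U: "E x \<subseteq> UM" by (auto simp: E_def)

lemma iset_U: "iset x \<Longrightarrow> x \<in> UM" by (simp add: is_set_def)
lemma iset_iff: "iset x \<longleftrightarrow> x \<in> UM \<and> x \<notin> E Atm" by (auto simp: is_set_def is_atom_def E_def)

lemma set_eqI: "iset x \<Longrightarrow> iset y \<Longrightarrow> E x = E y \<Longrightarrow> x = y"
  using zfa unfolding zfa_model_def ax_extensionality_def E_def by blast

lemma empty_atoms: "\<exists>z\<in>UM. E z = {} \<and> (\<forall>a\<in>UM. a \<in> E Atm \<longleftrightarrow> a \<noteq> z \<and> E a = {})"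
  using zfa unfolding zfa_model_def ax_empty_atoms_def E_def is_atom_def nonempty_def by auto

lemma atom_E: "a \<in> E Atm \<Longrightarrow> E a = {}" using empty_atoms E_U by blast
lemma isetI: "x \<in> UM \<Longrightarrow> E x \<noteq> {} \<Longrightarrow> iset x" using atom_E by (auto simp: iset_iff)
lemma isetI2: "x \<in> UM \<Longrightarrow> z \<in> E x \<Longrightarrow> iset x" using isetI by auto
lemma atom_or_set: "x \<in> UM \<Longrightarrow> x \<notin> E Atm \<Longrightarrow> iset x" by (auto simp: iset_iff)

definition zero :: 'm where "zero = (THE z. iset z \<and> E z = {})"
lemma zero: "iset zero" "E zero = {}"
proof -
  have "\<exists>z. iset z \<and> E z = {}" using empty_atoms by (auto simp: iset_iff)
  then have "iset zero \<and> E zero = {}" unfolding zero_def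
    by (rule theI'[OF ex_ex1I]) (auto intro: set_eqI)
  then show "iset zero" "E zero = {}" by auto
qed
lemma zero_U [simp]: "zero \<in> UM" using zero iset_U by auto

definition small :: "'m set \<Rightarrow> bool" where "small S \<longleftrightarrow> (\<exists>x. iset x \<and> E x = S)"
text \<open>\<open>mk S\<close> is the set with extension \<open>S\<close>; it is the empty set if there is none.\<close>

definition mk :: "'m set \<Rightarrow> 'm" where "mk S = (THE x. iset x \<and> E x = (if small S then S else {}))"

lemma mk: "iset (mk S)" "E (mk S) = (if small S then S else {})"
proof -
  have "\<exists>x. iset x \<and> E x = (if small S then S else {})" using zero by (auto simp: small_def)
  then have "iset (mk S) \<and> E (mk S) = (if small S then S else {})" unfolding mk_def
    by (rule theI'[OF ex_ex1I]) (auto intro: set_eqI)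
  then show "iset (mk S)" "E (mk S) = (if small S then S else {})" by auto
qed
lemma mk_U [simp]: "mk S \<in> UM" using mk iset_U by auto
lemma E_mk: "small S \<Longrightarrow> E (mk S) = S" by (simp add: mk)
lemma mk_E: "iset x \<Longrightarrow> mk (E x) = x" by (rule set_eqI) (auto simp: mk small_def)
lemma mk_eqI: "iset x \<Longrightarrow> E x = S \<Longrightarrow> mk S = x" using mk_E by auto
lemma small_U: "small S \<Longrightarrow> S \<subseteq> UM" using E_subset_U by (auto simp: small_def)

lemma small_E [simp]: assumes "x \<in> UM" shows "small (E x)"
proof (cases "E x = {}")
  case True then show ?thesis using zero by (metis small_def)
next
  case False then show ?thesis using isetI[OF assms] by (auto simp: small_def)
qed
lemma smallI: "x \<in> UM \<Longrightarrow> E x = S \<Longrightarrow> small S" by auto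
lemma smallE: assumes "small S" obtains x where "iset x" "E x = S" "x \<in> UM"
  using assms iset_U unfolding small_def by auto

lemma env_case: "range e \<subseteq> UM \<Longrightarrow> x \<in> UM \<Longrightarrow> range (case_nat x e) \<subseteq> UM"
  by (auto simp: image_subset_iff split: nat.splits)

lemma T_I:
  assumes "\<And>e. range e \<subseteq> UM \<Longrightarrow> t e \<in> UM" "D (\<lambda>e. Q (e 0) (\<lambda>i. e (Suc i)))"
    "\<And>y e. range e \<subseteq> UM \<Longrightarrow> y \<in> UM \<Longrightarrow> y = t e \<longleftrightarrow> Q y e"
  shows "T t"
  unfolding T_def using assms by (intro conjI allI impI D_cong[OF _ assms(2)]) (auto simp: image_subset_iff)

lemma small_sep:
  assumes "small S" "D (\<lambda>e. P (e 0))" shows "small {z\<in>S. P z}"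
proof -
  obtain x where x: "x \<in> UM" "E x = S" using assms smallE by metis
  obtain p c where c: "range c \<subseteq> UM" "\<And>e. range e \<subseteq> UM \<Longrightarrow> P (e 0) = sat M (mix e c) p"
    using assms(2) unfolding D_def by auto
  \<comment> \<open>\<open>P\<close> looks at index 0 only. The other variable slots receive the
    dummy value \<open>Atm\<close>, and the parameters \<open>c\<close> pass into the environment of
    the axiom.\<close>
  define d where "d = mix (\<lambda>_. Atm) c"
  have d: "range d \<subseteq> UM" using c by (auto simp: d_def mix_def)
  define f :: "nat \<Rightarrow> nat" where
    "f = mix (case_nat 0 (\<lambda>j. Suc (2 * j))) (\<lambda>k. Suc (Suc (2 * k)))"
  have eq: "(\<lambda>i. case_nat z d (f i)) = mix (case_nat z (\<lambda>_. Atm)) c" for z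
    by (rule mix_eqI) (simp_all only: f_def mix_simps, simp_all add: d_def split: nat.split)
  have "ax_separation M" using zfa by (simp add: zfa_model_def)
  from bspec[OF mp[OF spec[OF spec[OF this[unfolded ax_separation_def], where x="ren f p"], where x=d] d] x(1)]
  obtain y where y: "y \<in> UM"
    "\<forall>z\<in>UM. mem M z y \<longleftrightarrow> mem M z x \<and> sat M (case_nat z d) (ren f p)"
    by (rule bexE)
  have "E y = {z\<in>S. P z}"
  proof -
    have "sat M (case_nat z d) (ren f p) = P z" if "z \<in> UM" for z
      using c(2)[OF env_case[of "\<lambda>_. Atm" z]] that by (simp add: sat_ren eq)
    then show ?thesis using y x by (auto simp: E_def)
  qed
  then show ?thesis using y smallI by metis
qed

lemma small_empty [simp]: "small {}" using zero small_def by auto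
lemma small_subset:
  assumes "small S" "D (\<lambda>e. P (e 0))" "\<And>x. x \<in> R \<longleftrightarrow> x \<in> S \<and> P x" shows "small R"
proof -
  have "R = {x\<in>S. P x}" using assms(3) by blast
  then show ?thesis using small_sep[OF assms(1), of P] assms(2) by simp
qed

lemma small_rel:
  assumes "small S" "D (\<lambda>e. P (e 0) (e (Suc 0)))"
    "\<And>u v w. u \<in> UM \<Longrightarrow> v \<in> UM \<Longrightarrow> w \<in> UM \<Longrightarrow> P u v \<Longrightarrow> P u w \<Longrightarrow> v = w"
  shows "small {v\<in>UM. \<exists>u\<in>S. P u v}"
proof -
  obtain x where x: "x \<in> UM" "E x = S" using assms smallE by metis
  obtain p c where c: "range c \<subseteq> UM" "\<And>e. range e \<subseteq> UM \<Longrightarrow> P (e 0) (e (Suc 0)) = sat M (mix e c) p"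
    using assms(2) unfolding D_def by auto
  define d where "d = mix (\<lambda>_. Atm) c"
  have d: "range d \<subseteq> UM" using c by (auto simp: d_def mix_def)
  \<comment> \<open>Two leading slots hold argument and value, so all slots of \<open>d\<close> move
    up by two.\<close>
  define f :: "nat \<Rightarrow> nat" where
    "f = mix (case_nat 0 (case_nat (Suc 0) (\<lambda>j. Suc (Suc (2 * j))))) (\<lambda>k. Suc (Suc (Suc (2 * k))))"
  have eq: "(\<lambda>i. case_nat u (case_nat v d) (f i)) = mix (case_nat u (case_nat v (\<lambda>_. Atm))) c" for u v
    by (rule mix_eqI) (simp_all only: f_def mix_simps, simp_all add: d_def split: nat.split)
  have sat: "sat M (case_nat u (case_nat v d)) (ren f p) = P u v" if "u \<in> UM" "v \<in> UM" for u v
    using c(2)[OF env_case[OF env_case[of "\<lambda>_. Atm"]], of v u] that by (simp add: sat_ren eq)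
  have "ax_replacement M" using zfa by (simp add: zfa_model_def)
  note mp[OF spec[OF spec[OF this[unfolded ax_replacement_def], where x="ren f p"], where x=d] d]
  moreover have "\<forall>u\<in>UM. \<forall>v\<in>UM. \<forall>w\<in>UM. sat M (case_nat u (case_nat v d)) (ren f p) \<and>
        sat M (case_nat u (case_nat w d)) (ren f p) \<longrightarrow> v = w"
    using sat assms(3) by simp
  ultimately have "\<forall>x\<in>UM. \<exists>y\<in>UM. \<forall>v\<in>UM. mem M v y \<longleftrightarrow>
        (\<exists>u\<in>UM. mem M u x \<and> sat M (case_nat u (case_nat v d)) (ren f p))" by (rule mp)
  from bspec[OF this x(1)] obtain y where y: "y \<in> UM" "\<forall>v\<in>UM. mem M v y \<longleftrightarrow>
        (\<exists>u\<in>UM. mem M u x \<and> sat M (case_nat u (case_nat v d)) (ren f p))"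
    by (rule bexE)
  have "E y = {v\<in>UM. \<exists>u\<in>S. P u v}"
    using y x sat by (auto simp: E_def)
  then show ?thesis using y smallI by metis
qed

lemma T_at: "T (\<lambda>e. t (e 0)) \<Longrightarrow> x \<in> UM \<Longrightarrow> t x \<in> UM"
  using T_U[of "\<lambda>e. t (e 0)" "\<lambda>_. x"] by auto

lemma small_image: assumes "small S" "T (\<lambda>e. t (e 0))" shows "small (t ` S)"
proof -
  have "small {v\<in>UM. \<exists>u\<in>S. v = t u}"
    using assms T_sub[OF assms(2), of "\<lambda>_. 0"] by (intro small_rel D_eq T_var) auto
  moreover have "{v\<in>UM. \<exists>u\<in>S. v = t u} = t ` S"
    using T_at[OF assms(2)] small_U[OF assms(1)] by auto
  ultimately show ?thesis by simp
qed

lemma small_upair: assumes "x \<in> UM" "y \<in> UM" shows "small {x, y}"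
proof -
  obtain p where "p \<in> UM" "is_upair M x y p"
    using zfa assms by (auto simp: zfa_model_def ax_pairing_def)
  then have "E p = {x, y}" using assms by (auto simp: E_def is_upair_def)
  then show ?thesis using \<open>p \<in> UM\<close> smallI by auto
qed
lemma small_sing: "x \<in> UM \<Longrightarrow> small {x}" using small_upair[of x x] by simp

lemma small_Union: assumes "small S" shows "small (\<Union>z\<in>S. E z)"
proof -
  obtain x where x: "x \<in> UM" "E x = S" using assms smallE by metis
  obtain u where u: "u \<in> UM" "\<forall>z\<in>UM. mem M z u \<longleftrightarrow> (\<exists>y\<in>UM. mem M y x \<and> mem M z y)"
    using zfa x by (auto simp: zfa_model_def ax_union_def)
  then have "E u = (\<Union>z\<in>S. E z)" using x by (auto simp: E_def)
  then show ?thesis using u smallI by auto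
qed

lemma small_UN: assumes "small S" "T (\<lambda>e. t (e 0))" shows "small (\<Union>z\<in>S. E (t z))"
  using small_Union[OF small_image[OF assms]] by simp

lemma small_Un: assumes "small S" "small R" shows "small (S \<union> R)"
proof -
  have "small (\<Union>z\<in>{mk S, mk R}. E z)" by (intro small_Union small_upair) auto
  then show ?thesis using assms by (simp add: E_mk)
qed
lemma small_insert: "x \<in> UM \<Longrightarrow> small S \<Longrightarrow> small (insert x S)"
  using small_Un[OF small_sing] by auto

lemma small_Pow: assumes "small S" shows "small {y. iset y \<and> E y \<subseteq> S}"
proof -
  obtain x where x: "x \<in> UM" "E x = S" using assms smallE by metis
  obtain u where u: "u \<in> UM" "\<forall>y\<in>UM. mem M y u \<longleftrightarrow> iset y \<and> sub M y x"
    using zfa x by (auto simp: zfa_model_def ax_power_def)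
  then have "E u = {y. iset y \<and> E y \<subseteq> S}" using x iset_U by (auto simp: E_def sub_def)
  then show ?thesis using u smallI by auto
qed

lemma D_iset [def_intros]: "T t \<Longrightarrow> D (\<lambda>e. iset (t e))"
  by (rule D_cong[of _ "\<lambda>e. t e \<in> UM \<and> t e \<notin> E Atm"]) ((auto simp: iset_iff)[1], (intro def_intros; simp))

lemma D_subE [def_intros]: "T t \<Longrightarrow> T s \<Longrightarrow> D (\<lambda>e. E (t e) \<subseteq> E (s e))"
  by (rule D_cong[of _ "\<lambda>e. \<forall>x\<in>E (t e). x \<in> E (s e)"]) ((auto)[1], (intro def_intros; simp add: T_shift))
lemma D_eqE [def_intros]: "T t \<Longrightarrow> T s \<Longrightarrow> D (\<lambda>e. E (t e) = E (s e))"
  by (rule D_cong[of _ "\<lambda>e. E (t e) \<subseteq> E (s e) \<and> E (s e) \<subseteq> E (t e)"]) ((auto)[1], intro D_subE D_conj)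

lemma D_shift: "D P \<Longrightarrow> D (\<lambda>e. P (\<lambda>i. e (Suc i)))" by (rule D_sub)

text \<open>By extensionality a set-valued term is definable once membership in its value is;
  smallness ensures that the value is the intended set and not the default.\<close>

lemma T_mk:
  assumes "\<And>e. range e \<subseteq> UM \<Longrightarrow> small (S e)" "D (\<lambda>e. e 0 \<in> S (\<lambda>i. e (Suc i)))"
  shows "T (\<lambda>e. mk (S e))"
proof (rule T_I[where Q="\<lambda>y e. iset y \<and> (\<forall>z\<in>UM. z \<in> E y \<longleftrightarrow> z \<in> S e)"])
  show "D (\<lambda>e. iset (e 0) \<and> (\<forall>z\<in>UM. z \<in> E (e 0) \<longleftrightarrow> z \<in> S (\<lambda>i. e (Suc i))))"
    using D_sub[OF assms(2), of "case_nat 0 (\<lambda>i. Suc (Suc i))"]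
    by (intro def_intros) simp_all
next
  fix y and e :: "nat \<Rightarrow> 'm" assume e: "range e \<subseteq> UM" and y: "y \<in> UM"
  from assms(1)[OF e] have s: "small (S e)" .
  then show "(y = mk (S e)) = (iset y \<and> (\<forall>z\<in>UM. (z \<in> E y) = (z \<in> S e)))"
    using mk[of "S e"] small_U[OF s] E_subset_U[of y] by (auto intro!: set_eqI)
qed auto

lemma D_in_insert: "T t \<Longrightarrow> T s \<Longrightarrow> D (\<lambda>e. t e \<in> S e) \<Longrightarrow> D (\<lambda>e. t e \<in> insert (s e) (S e))"
  by (rule D_cong[of _ "\<lambda>e. t e = s e \<or> t e \<in> S e"]) ((auto)[1], intro def_intros)
declare D_in_insert[def_intros]

lemma T_upair [def_intros]: assumes "T t" "T s" shows "T (\<lambda>e. mk {t e, s e})"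
proof (rule T_mk)
  show "D (\<lambda>e. e 0 \<in> {t (\<lambda>i. e (Suc i)), s (\<lambda>i. e (Suc i))})"
    by (rule D_cong[of _ "\<lambda>e. e 0 = t (\<lambda>i. e (Suc i)) \<or> e 0 = s (\<lambda>i. e (Suc i))"], (auto)[1],
        intro def_intros T_shift assms)
qed (use assms in \<open>simp add: T_U small_upair\<close>)
lemma T_sing [def_intros]: assumes "T t" shows "T (\<lambda>e. mk {t e})"
  using T_upair[OF assms assms] by simp

definition succ :: "'m \<Rightarrow> 'm" where "succ x = mk (insert x (E x))"
definition opair :: "'m \<Rightarrow> 'm \<Rightarrow> 'm" where "opair x y = mk {mk {x}, mk {x, y}}"

lemma T_opair [def_intros]: "T t \<Longrightarrow> T s \<Longrightarrow> T (\<lambda>e. opair (t e) (s e))"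
  unfolding opair_def by (intro def_intros)
lemma T_succ [def_intros]: assumes "T t" shows "T (\<lambda>e. succ (t e))"
  unfolding succ_def
proof (rule T_mk)
  show "D (\<lambda>e. e 0 \<in> insert (t (\<lambda>i. e (Suc i))) (E (t (\<lambda>i. e (Suc i)))))"
    by (intro def_intros T_shift assms)
qed (use assms in \<open>simp add: T_U small_insert\<close>)

lemma opair_U [simp]: "opair x y \<in> UM" by (simp add: opair_def)
lemma opair_iset: "iset (opair x y)" by (simp add: opair_def mk)
lemma succ_U [simp]: "succ x \<in> UM" by (simp add: succ_def)
lemma succ_iset [simp]: "iset (succ x)" by (simp add: succ_def mk)
lemma E_succ: "x \<in> UM \<Longrightarrow> E (succ x) = insert x (E x)" by (simp add: succ_def E_mk small_insert)
lemma E_upair: "x \<in> UM \<Longrightarrow> y \<in> UM \<Longrightarrow> E (mk {x, y}) = {x, y}" by (simp add: E_mk small_upair)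
lemma E_sing: "x \<in> UM \<Longrightarrow> E (mk {x}) = {x}" by (simp add: E_mk small_sing)
lemma E_opair: "E (opair x y) = {mk {x}, mk {x, y}}" by (simp add: opair_def E_mk small_upair)

lemma opair_inj: assumes "x \<in> UM" "y \<in> UM" "x' \<in> UM" "y' \<in> UM"
  shows "opair x y = opair x' y' \<longleftrightarrow> x = x' \<and> y = y'"
proof
  assume "opair x y = opair x' y'"
  then have "{mk {x}, mk {x, y}} = {mk {x'}, mk {x', y'}}" using E_opair by metis
  then have "{{x},{x,y}} = {{x'},{x',y'}}"
    using assms by (metis (no_types, lifting) E_sing E_upair doubleton_eq_iff)
  then show "x = x' \<and> y = y'" by (auto simp: doubleton_eq_iff)
qed auto

text \<open>Definite description made total by the junk value \<open>zero\<close>, so that it is always definable.\<close>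

definition theU :: "('m \<Rightarrow> bool) \<Rightarrow> 'm" where
  "theU P = (if \<exists>!y. y \<in> UM \<and> P y then THE y. y \<in> UM \<and> P y else zero)"
lemma theU: assumes "\<exists>!y. y \<in> UM \<and> P y" shows "P (theU P)" "theU P \<in> UM"
  using theI'[OF assms] assms by (simp_all add: theU_def)
lemma theU_U [simp]: "theU P \<in> UM"
  using theU(2) by (cases "\<exists>!y. y \<in> UM \<and> P y") (simp_all add: theU_def)
lemma theU_I:
  assumes "y \<in> UM" "P y" "\<And>z. z \<in> UM \<Longrightarrow> P z \<Longrightarrow> z = y" shows "theU P = y"
proof -
  have ex: "\<exists>!y. y \<in> UM \<and> P y" by (rule ex1I[of _ y]) (simp add: assms(1,2), blast intro: assms(3))
  show ?thesis by (rule assms(3)[OF theU(2)[OF ex] theU(1)[OF ex]])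
qed
text \<open>The distinction between a unique witness and the default \<open>zero\<close> is itself
  expressible, so the total operation has a definable graph.\<close>

lemma T_theU [def_intros]:
  assumes "D (\<lambda>e. P (e 0) (\<lambda>i. e (Suc i)))" shows "T (\<lambda>e. theU (\<lambda>y. P y e))"
proof (rule T_I[where Q="\<lambda>y e. if \<exists>!y. y \<in> UM \<and> P y e then P y e else y = zero"])
  show "D (\<lambda>e. if \<exists>!y. y \<in> UM \<and> P y (\<lambda>i. e (Suc i)) then P (e 0) (\<lambda>i. e (Suc i)) else e 0 = zero)"
    using assms D_sub2[OF assms] by (intro def_intros) auto
  show "(y = theU (\<lambda>y. P y e)) = (if \<exists>!y. y \<in> UM \<and> P y e then P y e else y = zero)"
    if "y \<in> UM" for y e
  proof (cases "\<exists>!y. y \<in> UM \<and> P y e")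
    case True
    then show ?thesis using theU[OF True] that by (auto simp only: if_True)
  next
    case False
    then show ?thesis by (simp only: theU_def if_False)
  qed
qed auto

lemma T_if [def_intros]: assumes "D P" "T t" "T s" shows "T (\<lambda>e. if P e then t e else s e)"
proof (rule T_I[where Q="\<lambda>y e. if P e then y = t e else y = s e"])
  show "D (\<lambda>e. if P (\<lambda>i. e (Suc i)) then e 0 = t (\<lambda>i. e (Suc i)) else e 0 = s (\<lambda>i. e (Suc i)))"
    by (intro def_intros T_shift D_shift assms)
qed (use assms in \<open>auto simp: T_U\<close>)

text \<open>In contrast to \<open>T_mk\<close> no smallness has to be supplied: separation provides
  it for every assignment.\<close>

lemma T_sep [def_intros]: assumes "T t" "D (\<lambda>e. P (e 0) (\<lambda>i. e (Suc i)))"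
  shows "T (\<lambda>e. mk {z\<in>E (t e). P z e})"
proof (rule T_I[where Q="\<lambda>y e. iset y \<and> (\<forall>z\<in>UM. z \<in> E y \<longleftrightarrow> z \<in> E (t e) \<and> P z e)"])
  show "D (\<lambda>e. iset (e 0) \<and> (\<forall>z\<in>UM. z \<in> E (e 0) \<longleftrightarrow> z \<in> E (t (\<lambda>i. e (Suc i))) \<and> P z (\<lambda>i. e (Suc i))))"
    using assms D_sub2[OF assms(2)] T_sub[OF assms(1), of "\<lambda>i. Suc (Suc i)"] by (intro def_intros)
  fix y and e :: "nat \<Rightarrow> 'm" assume e: "range e \<subseteq> UM" "y \<in> UM"
  \<comment> \<open>Separation is wanted in \<open>z\<close> alone, so the fixed assignment
    \<open>e\<close> has to join the parameters of the formula.\<close>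
  have "D (\<lambda>e'. P (e' 0) e)"
  proof -
    obtain p c where c: "range c \<subseteq> UM" "\<And>e. range e \<subseteq> UM \<Longrightarrow> P (e 0) (\<lambda>i. e (Suc i)) = sat M (mix e c) p"
      using assms(2) unfolding D_def by auto
    define f :: "nat \<Rightarrow> nat" where
      "f = mix (case_nat 0 (\<lambda>j. Suc (2 * (2 * j)))) (\<lambda>k. Suc (2 * Suc (2 * k)))"
    have "(\<lambda>i. mix e' (mix e c) (f i)) = mix (case_nat (e' 0) e) c" for e'
    proof (rule mix_eqI)
      show "mix e' (mix e c) (f (2 * k)) = case_nat (e' 0) e k" for k
        by (cases k) (simp_all only: f_def mix_simps nat.case mult_0_right)
    qed (simp only: f_def mix_simps)
    then have P: "P (e' 0) e = sat M (mix e' (mix e c)) (ren f p)" if "range e' \<subseteq> UM" for e'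
      using c(2)[OF env_case[OF e(1), of "e' 0"]] that by (simp add: sat_ren image_subset_iff)
    have "range (mix e c) \<subseteq> UM" using e c by (auto simp: mix_def)
    then show ?thesis unfolding D_def by (intro exI[of _ "ren f p"] exI[of _ "mix e c"] conjI allI impI P)
  qed
  then have "small {z\<in>E (t e). P z e}" by (rule small_sep[OF small_E[OF T_U[OF assms(1) e(1)]]])
  then have E: "E (mk {z\<in>E (t e). P z e}) = {z\<in>E (t e). P z e}" by (rule E_mk)
  show "(y = mk {z \<in> E (t e). P z e}) = (iset y \<and> (\<forall>z\<in>UM. (z \<in> E y) = (z \<in> E (t e) \<and> P z e)))"
  proof
    assume "iset y \<and> (\<forall>z\<in>UM. (z \<in> E y) = (z \<in> E (t e) \<and> P z e))"
    then have "iset y" "E y = {z \<in> E (t e). P z e}" using E_U by blast+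
    then show "y = mk {z \<in> E (t e). P z e}" using mk_eqI by metis
  qed (simp add: E mk(1))
qed auto

definition times :: "'m set \<Rightarrow> 'm set \<Rightarrow> 'm set" where "times X Y = {opair x y |x y. x \<in> X \<and> y \<in> Y}"

text \<open>Kuratowski pairs are sets of subsets of \<open>X \<union> Y\<close>, so the product is
  separated from a double power set.\<close>

lemma small_times: assumes "small X" "small Y" shows "small (times X Y)"
proof -
  let ?Z = "{z. iset z \<and> E z \<subseteq> {w. iset w \<and> E w \<subseteq> X \<union> Y}}"
  have "small ?Z" using assms by (intro small_Pow small_Un)
  moreover have "D (\<lambda>e. \<exists>x\<in>E (mk X). \<exists>y\<in>E (mk Y). e 0 = opair x y)"
    by (intro def_intros) auto
  ultimately show ?thesis
  proof (rule small_subset[where P="\<lambda>p. \<exists>x\<in>E (mk X). \<exists>y\<in>E (mk Y). p = opair x y"])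
    fix p
    show "(p \<in> times X Y) = (p \<in> ?Z \<and> (\<exists>x\<in>E (mk X). \<exists>y\<in>E (mk Y). p = opair x y))"
      using assms small_U[OF assms(1)] small_U[OF assms(2)]
      by (auto simp: times_def E_mk opair_iset E_opair mk small_sing small_upair subset_iff)
  qed
qed

lemma times_mem: "x \<in> UM \<Longrightarrow> y \<in> UM \<Longrightarrow> X \<subseteq> UM \<Longrightarrow> Y \<subseteq> UM \<Longrightarrow> opair x y \<in> times X Y \<longleftrightarrow> x \<in> X \<and> y \<in> Y"
  unfolding times_def using opair_inj[of x y] by blast

section \<open>Functions and transitive substructures\<close>

definition func :: "'m \<Rightarrow> 'm set \<Rightarrow> 'm set \<Rightarrow> bool" where
  "func f X Y \<longleftrightarrow> iset f \<and> E f \<subseteq> times X Y \<and> (\<forall>x\<in>X. \<exists>!y. y \<in> UM \<and> opair x y \<in> E f)"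
text \<open>Total thanks to the default of \<open>theU\<close>; internal functions can thus be
  treated with the HOL notions of image, \<open>inj_on\<close> and \<open>bij_betw\<close>.\<close>

definition app :: "'m \<Rightarrow> 'm \<Rightarrow> 'm" where "app f x = theU (\<lambda>y. opair x y \<in> E f)"

lemma app_U [simp]: "app f x \<in> UM" by (simp add: app_def)
lemma T_app [def_intros]: "T t \<Longrightarrow> T s \<Longrightarrow> T (\<lambda>e. app (t e) (s e))"
  unfolding app_def by (intro def_intros; (rule T_shift)?; simp)

lemma func_app: assumes "func f X Y" "x \<in> X" shows "opair x (app f x) \<in> E f"
  using theU(1)[of "\<lambda>y. opair x y \<in> E f"] assms by (simp add: func_def app_def)
lemma func_iff: assumes "func f X Y" "X \<subseteq> UM" "Y \<subseteq> UM" "x \<in> UM" "y \<in> UM"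
  shows "opair x y \<in> E f \<longleftrightarrow> x \<in> X \<and> y = app f x"
proof
  assume a: "opair x y \<in> E f"
  then have "opair x y \<in> times X Y" using assms by (auto simp: func_def)
  then have x: "x \<in> X" using assms by (simp add: times_mem)
  have "\<exists>!y. y \<in> UM \<and> opair x y \<in> E f" using assms x by (simp add: func_def)
  then show "x \<in> X \<and> y = app f x" using x a assms(5) func_app[OF assms(1) x] app_U[of f x] by blast
qed (use func_app assms in auto)
lemma func_in: assumes "func f X Y" "X \<subseteq> UM" "Y \<subseteq> UM" "x \<in> X" shows "app f x \<in> Y"
proof -
  have "opair x (app f x) \<in> times X Y" using func_app[OF assms(1,4)] assms(1) by (auto simp: func_def)
  then show ?thesis using assms by (subst (asm) times_mem) auto
qed
lemma func_E: assumes "func f X Y" "X \<subseteq> UM" "Y \<subseteq> UM" shows "E f = (\<lambda>x. opair x (app f x)) ` X"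
proof
  show "E f \<subseteq> (\<lambda>x. opair x (app f x)) ` X"
  proof
    fix p assume p: "p \<in> E f"
    then have "p \<in> times X Y" using assms by (auto simp: func_def)
    then obtain x y where "x \<in> X" "y \<in> Y" "p = opair x y" by (auto simp: times_def)
    then show "p \<in> (\<lambda>x. opair x (app f x)) ` X" using func_iff[OF assms, of x y] p assms by auto
  qed
qed (use func_app assms in auto)

lemma funcI:
  assumes f: "iset f" "E f = (\<lambda>x. opair x (t x)) ` X" and t: "\<And>x. x \<in> X \<Longrightarrow> t x \<in> Y" and X: "X \<subseteq> UM" and Y: "Y \<subseteq> UM"
  shows "func f X Y" "x \<in> X \<Longrightarrow> app f x = t x"
proof -
  have *: "opair x y \<in> E f \<longleftrightarrow> y = t x" if "x \<in> X" "y \<in> UM" for x y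
  proof -
    have "opair x y = opair x' (t x') \<longleftrightarrow> x = x' \<and> y = t x'" if "x' \<in> X" for x'
      using that t X Y \<open>x \<in> X\<close> \<open>y \<in> UM\<close> by (intro opair_inj) auto
    then show ?thesis unfolding f(2) using that by auto
  qed
  show "func f X Y" unfolding func_def
  proof (intro conjI ballI)
    show "\<exists>!y. y \<in> UM \<and> opair x y \<in> E f" if "x \<in> X" for x
    proof (rule ex1I[of _ "t x"])
      show "t x \<in> UM \<and> opair x (t x) \<in> E f" using *[OF that, of "t x"] t[OF that] Y by auto
    qed (use * that in blast)
  qed (use f t in \<open>auto simp: times_def\<close>)
  then show "app f x = t x" if "x \<in> X"
    using * func_app that by (meson app_U)
qed

definition graph :: "('m \<Rightarrow> 'm) \<Rightarrow> 'm set \<Rightarrow> 'm" where "graph t X = mk ((\<lambda>x. opair x (t x)) ` X)"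

text \<open>Replacement turns a definable operation on a small set into a function that is an
  element of the structure.\<close>

lemma graph:
  assumes "small X" "T (\<lambda>e. t (e 0))"
  shows "E (graph t X) = (\<lambda>x. opair x (t x)) ` X" "iset (graph t X)"
    "(\<And>x. x \<in> X \<Longrightarrow> t x \<in> Y) \<Longrightarrow> Y \<subseteq> UM \<Longrightarrow> func (graph t X) X Y"
    "x \<in> X \<Longrightarrow> app (graph t X) x = t x"
proof -
  have "small ((\<lambda>x. opair x (t x)) ` X)"
    by (rule small_image[OF assms(1), where t="\<lambda>x. opair x (t x)"], intro def_intros assms)
  then show 1: "E (graph t X) = (\<lambda>x. opair x (t x)) ` X" "iset (graph t X)"
    unfolding graph_def using mk by (simp_all add: E_mk)
  show "func (graph t X) X Y" if "\<And>x. x \<in> X \<Longrightarrow> t x \<in> Y" "Y \<subseteq> UM"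
    using funcI[OF 1(2,1)] that small_U[OF assms(1)] by auto
  show "app (graph t X) x = t x" if "x \<in> X" for x
    by (rule funcI(2)[OF 1(2,1), of UM]) (use small_U[OF assms(1)] T_at[OF assms(2)] that in auto)
qed
lemma graph_U [simp]: "graph t X \<in> UM" by (simp add: graph_def)

lemma D_func [def_intros]: assumes "T f" "T x" "T y" shows "D (\<lambda>e. func (f e) (E (x e)) (E (y e)))"
proof (rule D_cong)
  show "func (f e) (E (x e)) (E (y e)) = (iset (f e) \<and>
     (\<forall>p\<in>E (f e). \<exists>u\<in>E (x e). \<exists>v\<in>E (y e). p = opair u v) \<and>
     (\<forall>u\<in>E (x e). \<exists>!v. v \<in> UM \<and> opair u v \<in> E (f e)))" for e
    unfolding func_def times_def by blast
  show "D (\<lambda>e. iset (f e) \<and>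
     (\<forall>p\<in>E (f e). \<exists>u\<in>E (x e). \<exists>v\<in>E (y e). p = opair u v) \<and>
     (\<forall>u\<in>E (x e). \<exists>!v. v \<in> UM \<and> opair u v \<in> E (f e)))"
    by (intro def_intros assms T_shift[OF assms(1)] T_shift[OF assms(2)] T_shift[OF assms(3)]
      T_shift[OF T_shift[OF assms(1)]] T_shift[OF T_shift[OF assms(3)]])
qed

definition trans :: "'m \<Rightarrow> bool" where "trans t \<longleftrightarrow> (\<forall>x\<in>E t. E x \<subseteq> E t)"
definition Ord :: "'m \<Rightarrow> bool" where
  "Ord a \<longleftrightarrow> iset a \<and> (\<forall>x\<in>E a. iset x \<and> E x \<subseteq> E a) \<and> (\<forall>x\<in>E a. \<forall>y\<in>E a. x \<in> E y \<or> x = y \<or> y \<in> E x)"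
definition Natl :: "'m \<Rightarrow> bool" where
  "Natl n \<longleftrightarrow> Ord n \<and> (\<forall>m\<in>UM. m \<in> E n \<or> m = n \<longrightarrow> m = zero \<or> (\<exists>k\<in>UM. m = succ k))"

lemma D_trans [def_intros]: "T t \<Longrightarrow> D (\<lambda>e. trans (t e))"
  unfolding trans_def by (intro def_intros; (intro T_shift)?; assumption)
lemma D_Ord [def_intros]: "T t \<Longrightarrow> D (\<lambda>e. Ord (t e))"
  unfolding Ord_def by (intro def_intros; (intro T_shift)?; assumption)
lemma D_Natl [def_intros]: "T t \<Longrightarrow> D (\<lambda>e. Natl (t e))"
  unfolding Natl_def by (intro def_intros; (intro T_shift)?; (assumption | simp))

end

text \<open>Absoluteness is proved once, for a transitive part \<open>N\<close> of \<open>M\<close>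
  with the same membership and atoms. It serves for \<open>N = M\<close>, to unfold notions of the
  ground model, and for the permutation model. Each lemma \<open>c_...\<close> translates a
  relativised notion into a statement about extensions.\<close>

locale tsub = zfa M for M :: "'m zfa_struct" +
  fixes N :: "'m zfa_struct"
  assumes N_sub: "univ N \<subseteq> univ M" and N_mem: "mem N = mem M" and N_atoms: "atoms N = atoms M"
    and N_trans: "\<And>x. x \<in> univ N \<Longrightarrow> E x \<subseteq> univ N"
begin

abbreviation "VN \<equiv> univ N"

lemma N_U: "x \<in> VN \<Longrightarrow> x \<in> UM" using N_sub by auto
lemma N_E: "x \<in> E y \<Longrightarrow> y \<in> VN \<Longrightarrow> x \<in> VN" using N_trans by auto
lemma mem_N: "x \<in> VN \<Longrightarrow> mem N x y \<longleftrightarrow> x \<in> E y" using N_U by (auto simp: N_mem E_def)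

lemma all_N: "y \<in> VN \<Longrightarrow> (\<forall>x\<in>VN. mem N x y \<longrightarrow> P x) \<longleftrightarrow> (\<forall>x\<in>E y. P x)"
  using N_E by (auto simp: mem_N)
lemma ex_N: "y \<in> VN \<Longrightarrow> (\<exists>x\<in>VN. mem N x y \<and> P x) \<longleftrightarrow> (\<exists>x\<in>E y. P x)"
  using N_E by (auto simp: mem_N)

lemma c_set: "is_set N x \<longleftrightarrow> x \<in> VN \<and> iset x"
  using mem_N[of x Atm] N_U[of x] by (auto simp: is_set_def is_atom_def N_atoms iset_iff E_def N_mem)

lemma c_sub: "x \<in> VN \<Longrightarrow> sub N x y \<longleftrightarrow> E x \<subseteq> E y"
  using N_E by (auto simp: sub_def mem_N)
lemma c_nonempty: "x \<in> VN \<Longrightarrow> nonempty N x \<longleftrightarrow> E x \<noteq> {}"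
  using N_E by (auto simp: nonempty_def mem_N)

lemma set_iff_N: "p \<in> VN \<Longrightarrow> (\<And>z. P z \<Longrightarrow> z \<in> VN) \<Longrightarrow> (\<forall>z\<in>VN. mem N z p \<longleftrightarrow> P z) \<longleftrightarrow> E p = {z. P z}"
  using N_E by (auto simp: mem_N)

lemma c_upair: "x \<in> VN \<Longrightarrow> y \<in> VN \<Longrightarrow> p \<in> VN \<Longrightarrow> is_upair N x y p \<longleftrightarrow> p = mk {x, y}"
proof -
  assume a: "x \<in> VN" "y \<in> VN" "p \<in> VN"
  then have "is_upair N x y p \<longleftrightarrow> E p = {z. z = x \<or> z = y}" unfolding is_upair_def by (intro set_iff_N) auto
  also have "{z. z = x \<or> z = y} = {x, y}" by auto
  also have "E p = {x, y} \<longleftrightarrow> p = mk {x, y}"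
    using a N_U isetI2[of p x] mk_eqI[of p] by (auto simp: E_upair)
  finally show ?thesis .
qed

lemma c_pair: assumes "x \<in> VN" "y \<in> VN" "p \<in> VN" shows "is_pair N x y p \<longleftrightarrow> p = opair x y"
proof
  assume "is_pair N x y p"
  then show "p = opair x y" using assms by (auto simp: is_pair_def c_upair opair_def)
next
  assume p: "p = opair x y"
  then have "mk {x} \<in> VN" "mk {x, y} \<in> VN" using N_E[OF _ assms(3)] by (auto simp: E_opair)
  then show "is_pair N x y p" using assms p unfolding is_pair_def
    by (intro bexI[of _ "mk {x}"] bexI[of _ "mk {x, y}"]) (auto simp: c_upair opair_def)
qed

text \<open>Transitivity leads from a pair down to its components; thus decomposing a pair means the
  same in \<open>N\<close> and in \<open>M\<close>.\<close>

lemma opair_N: "opair x y \<in> VN \<Longrightarrow> x \<in> UM \<Longrightarrow> y \<in> UM \<Longrightarrow> x \<in> VN \<and> y \<in> VN"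
proof -
  assume a: "opair x y \<in> VN" "x \<in> UM" "y \<in> UM"
  then have "mk {x, y} \<in> VN" using N_E[OF _ a(1)] by (auto simp: E_opair)
  then show ?thesis using N_E[of _ "mk {x,y}"] a by (auto simp: E_upair)
qed

lemma c_rel: "r \<in> VN \<Longrightarrow> x \<in> VN \<Longrightarrow> y \<in> VN \<Longrightarrow> rel N r x y \<longleftrightarrow> opair x y \<in> E r"
  unfolding rel_def using N_E by (auto simp: c_pair mem_N)

lemma ex_pair_N: "p \<in> VN \<Longrightarrow> (\<exists>x\<in>VN. \<exists>y\<in>VN. P x \<and> is_pair N x y p) \<longleftrightarrow> (\<exists>x\<in>UM. \<exists>y\<in>UM. P x \<and> p = opair x y)"
proof
  assume p: "p \<in> VN" and "\<exists>x\<in>UM. \<exists>y\<in>UM. P x \<and> p = opair x y"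
  then obtain x y where "x \<in> UM" "y \<in> UM" "P x" "p = opair x y" by auto
  with p opair_N[of x y] show "\<exists>x\<in>VN. \<exists>y\<in>VN. P x \<and> is_pair N x y p"
    by (intro bexI[of _ x] bexI[of _ y]) (simp_all add: c_pair)
next
  assume p: "p \<in> VN" and "\<exists>x\<in>VN. \<exists>y\<in>VN. P x \<and> is_pair N x y p"
  then obtain x y where "x \<in> VN" "y \<in> VN" "P x" "p = opair x y" by (auto simp: c_pair)
  then show "\<exists>x\<in>UM. \<exists>y\<in>UM. P x \<and> p = opair x y" using N_U by blast
qed

lemma c_relation: "r \<in> VN \<Longrightarrow> is_relation N r \<longleftrightarrow> iset r \<and> (\<forall>p\<in>E r. \<exists>x\<in>UM. \<exists>y\<in>UM. p = opair x y)"
proof -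
  assume r: "r \<in> VN"
  have "(\<exists>x\<in>VN. \<exists>y\<in>VN. is_pair N x y p) \<longleftrightarrow> (\<exists>x\<in>UM. \<exists>y\<in>UM. p = opair x y)" if "p \<in> E r" for p
    using ex_pair_N[of p "\<lambda>_. True"] N_E[OF that r] by simp
  then show ?thesis using r by (simp add: is_relation_def c_set all_N)
qed

text \<open>Closure of \<open>N\<close> under pairing is not assumed, so the product read in
  \<open>N\<close> collects just those pairs that lie in \<open>N\<close>.\<close>

lemma c_product: "X \<in> VN \<Longrightarrow> Y \<in> VN \<Longrightarrow> Z \<in> VN \<Longrightarrow>
  is_product N X Y Z \<longleftrightarrow> iset Z \<and> E Z = times (E X) (E Y) \<inter> VN"
proof -
  assume a: "X \<in> VN" "Y \<in> VN" "Z \<in> VN"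
  have "(\<exists>x\<in>VN. \<exists>y\<in>VN. mem N x X \<and> mem N y Y \<and> is_pair N x y p) \<longleftrightarrow> p \<in> times (E X) (E Y) \<inter> VN"
    if "p \<in> VN" for p
    using that a N_E by (auto simp: c_pair mem_N times_def)
  then have "(\<forall>p\<in>VN. mem N p Z \<longleftrightarrow> (\<exists>x\<in>VN. \<exists>y\<in>VN. mem N x X \<and> mem N y Y \<and> is_pair N x y p))
    \<longleftrightarrow> (\<forall>p\<in>VN. mem N p Z \<longleftrightarrow> p \<in> times (E X) (E Y) \<inter> VN)" by simp
  also have "\<dots> \<longleftrightarrow> E Z = times (E X) (E Y) \<inter> VN" using set_iff_N[OF a(3), of "\<lambda>p. p \<in> times (E X) (E Y) \<inter> VN"] by (simp add: Int_def)
  finally show ?thesis using a by (simp add: is_product_def c_set)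
qed

lemma c_fun: assumes "f \<in> VN" "X \<in> VN" "Y \<in> VN" shows "is_fun N f X Y \<longleftrightarrow> func f (E X) (E Y)"
proof -
  have 1: "(\<exists>x\<in>VN. \<exists>y\<in>VN. mem N x X \<and> mem N y Y \<and> is_pair N x y p) \<longleftrightarrow> p \<in> times (E X) (E Y)"
    if "p \<in> E f" for p
    using N_E[OF that assms(1)] assms N_E by (auto simp: c_pair mem_N times_def)
  have 2: "(\<exists>!y. y \<in> VN \<and> rel N f x y) \<longleftrightarrow> (\<exists>!y. y \<in> UM \<and> opair x y \<in> E f)" if "x \<in> E X" for x
  proof -
    have "y \<in> VN \<and> rel N f x y \<longleftrightarrow> y \<in> UM \<and> opair x y \<in> E f" for y
      using N_E[OF that assms(2)] opair_N[of x y] N_E[of _ f] assms(1) N_U by (auto simp: c_rel)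
    then show ?thesis by simp
  qed
  show ?thesis using assms 1 2 unfolding is_fun_def func_def by (auto simp: c_set all_N)
qed

lemma c_inj: assumes "f \<in> VN" "X \<in> VN" "Y \<in> VN"
  shows "is_inj N f X Y \<longleftrightarrow> func f (E X) (E Y) \<and> inj_on (app f) (E X)"
proof -
  have "(\<forall>x\<in>VN. \<forall>x'\<in>VN. \<forall>y\<in>VN. rel N f x y \<and> rel N f x' y \<longrightarrow> x = x') \<longleftrightarrow> inj_on (app f) (E X)"
    if f: "func f (E X) (E Y)"
  proof -
    have r: "rel N f x y \<longleftrightarrow> x \<in> E X \<and> y = app f x" if "x \<in> VN" "y \<in> VN" for x y
      using func_iff[OF f E_subset_U E_subset_U, of x y] that assms N_U by (simp add: c_rel)
    have "x \<in> VN \<and> app f x \<in> VN" if "x \<in> E X" for x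
      using func_in[OF f E_subset_U E_subset_U that] that N_E assms by auto
    then show ?thesis by (auto simp: r inj_on_def)
  qed
  then show ?thesis by (auto simp: is_inj_def c_fun[OF assms])
qed

lemma c_bij: assumes "f \<in> VN" "X \<in> VN" "Y \<in> VN"
  shows "is_bij N f X Y \<longleftrightarrow> func f (E X) (E Y) \<and> bij_betw (app f) (E X) (E Y)"
proof -
  have "(\<forall>y\<in>VN. mem N y Y \<longrightarrow> (\<exists>x\<in>VN. rel N f x y)) \<longleftrightarrow> app f ` E X = E Y"
    if f: "func f (E X) (E Y)"
  proof -
    have r: "rel N f x y \<longleftrightarrow> x \<in> E X \<and> y = app f x" if "x \<in> VN" "y \<in> VN" for x y
      using func_iff[OF f E_subset_U E_subset_U, of x y] that assms N_U by (simp add: c_rel)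
    have e: "(\<exists>x\<in>VN. rel N f x y) \<longleftrightarrow> y \<in> app f ` E X" if "y \<in> E Y" for y
      using N_E[OF that assms(3)] N_E assms by (auto simp: r)
    have "app f ` E X \<subseteq> E Y" using func_in[OF f E_subset_U E_subset_U] by auto
    then show ?thesis using e by (auto simp: all_N[OF assms(3)])
  qed
  then show ?thesis by (auto simp: is_bij_def c_inj[OF assms] bij_betw_def)
qed

lemma c_restr: assumes "f \<in> VN" "X \<in> VN" "s \<in> VN"
  shows "is_restr N f X s \<longleftrightarrow> iset s \<and> E s = {p\<in>E f. \<exists>x\<in>E X. \<exists>y\<in>UM. p = opair x y}"
proof -
  have "(mem N p f \<and> (\<exists>x\<in>VN. \<exists>y\<in>VN. mem N x X \<and> is_pair N x y p)) \<longleftrightarrow>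
     p \<in> E f \<and> (\<exists>x\<in>E X. \<exists>y\<in>UM. p = opair x y)" if "p \<in> VN" for p
  proof -
    have "(\<exists>x\<in>VN. \<exists>y\<in>VN. mem N x X \<and> is_pair N x y p) \<longleftrightarrow> (\<exists>x\<in>VN. \<exists>y\<in>VN. x \<in> E X \<and> is_pair N x y p)"
      by (simp add: mem_N)
    also have "\<dots> \<longleftrightarrow> (\<exists>x\<in>E X. \<exists>y\<in>UM. p = opair x y)"
      unfolding ex_pair_N[OF that] using E_U[of _ X] by blast
    finally show ?thesis using that by (simp add: mem_N)
  qed
  then have "(\<forall>p\<in>VN. mem N p s \<longleftrightarrow> mem N p f \<and> (\<exists>x\<in>VN. \<exists>y\<in>VN. mem N x X \<and> is_pair N x y p)) \<longleftrightarrow>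
    (\<forall>p\<in>VN. mem N p s \<longleftrightarrow> p \<in> E f \<and> (\<exists>x\<in>E X. \<exists>y\<in>UM. p = opair x y))" by simp
  also have "\<dots> \<longleftrightarrow> E s = {p. p \<in> E f \<and> (\<exists>x\<in>E X. \<exists>y\<in>UM. p = opair x y)}"
    using N_E[of _ f] assms(1) by (intro set_iff_N[OF assms(3)]) auto
  finally show ?thesis using assms by (simp add: is_restr_def c_set)
qed

lemma c_zero: "x \<in> VN \<Longrightarrow> is_zero N x \<longleftrightarrow> x = zero"
  using zero set_eqI[of x zero] by (auto simp: is_zero_def c_set c_nonempty)
lemma c_succ: assumes "x \<in> VN" "y \<in> VN" shows "is_succ N x y \<longleftrightarrow> y = succ x"
proof -
  have "is_succ N x y \<longleftrightarrow> (\<forall>z\<in>VN. mem N z y \<longleftrightarrow> z \<in> E x \<or> z = x)"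
    unfolding is_succ_def by (simp add: mem_N)
  also have "\<dots> \<longleftrightarrow> E y = {z. z \<in> E x \<or> z = x}"
    using N_E[of _ x] assms by (intro set_iff_N) auto
  also have "{z. z \<in> E x \<or> z = x} = insert x (E x)" by auto
  also have "E y = insert x (E x) \<longleftrightarrow> y = succ x"
    using assms N_U isetI2[of y x] set_eqI[of y "succ x"] by (auto simp: E_succ)
  finally show ?thesis .
qed
lemma c_trans: assumes "t \<in> VN" shows "transitive N t \<longleftrightarrow> trans t"
proof
  assume t: "transitive N t"
  show "trans t" unfolding trans_def
  proof (intro ballI subsetI)
    fix x y assume "x \<in> E t" "y \<in> E x"
    then show "y \<in> E t" using t N_E[OF \<open>x \<in> E t\<close> assms] N_E[OF \<open>y \<in> E x\<close>] mem_N unfolding transitive_def by blast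
  qed
next
  assume "trans t"
  then show "transitive N t" using mem_N unfolding transitive_def trans_def by blast
qed

lemma all2_N: "a \<in> VN \<Longrightarrow> (\<forall>x\<in>VN. \<forall>y\<in>VN. mem N x a \<and> mem N y a \<longrightarrow> P x y) \<longleftrightarrow> (\<forall>x\<in>E a. \<forall>y\<in>E a. P x y)"
  using N_E[of _ a] mem_N[of _ a] by blast

lemma c_ord: assumes a: "a \<in> VN" shows "is_ordinal N a \<longleftrightarrow> Ord a"
proof -
  have "(\<forall>x\<in>E a. \<forall>y\<in>E a. mem N x y \<or> x = y \<or> mem N y x) \<longleftrightarrow> (\<forall>x\<in>E a. \<forall>y\<in>E a. x \<in> E y \<or> x = y \<or> y \<in> E x)"
    using N_E[OF _ a] by (simp add: mem_N)
  moreover have "(\<forall>x\<in>E a. is_set N x) \<longleftrightarrow> (\<forall>x\<in>E a. iset x)"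
    using N_E[OF _ a] by (simp add: c_set)
  ultimately show ?thesis using a unfolding is_ordinal_def Ord_def all_N[OF a] all2_N[OF a] c_trans[OF a] trans_def
    by (auto simp: c_set)
qed
lemma c_nat: "n \<in> VN \<Longrightarrow> is_nat N n \<longleftrightarrow> Natl n"
proof -
  assume a: "n \<in> VN"
  have "(is_zero N m \<or> (\<exists>k\<in>VN. is_succ N k m)) \<longleftrightarrow> (m = zero \<or> (\<exists>k\<in>UM. m = succ k))" if "m \<in> VN" for m
  proof -
    have "k \<in> VN" if "m = succ k" "k \<in> UM" for k using N_E[OF _ \<open>m \<in> VN\<close>, of k] that by (simp add: E_succ)
    then show ?thesis using that N_U by (auto simp: c_zero c_succ)
  qed
  note * = this
  show ?thesis unfolding is_nat_def Natl_def c_ord[OF a]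
  proof (intro conj_cong refl iffI ballI impI)
    fix m assume h: "\<forall>m\<in>VN. mem N m n \<or> m = n \<longrightarrow> is_zero N m \<or> (\<exists>k\<in>VN. is_succ N k m)"
      and m: "m \<in> UM" "m \<in> E n \<or> m = n"
    from m(2) a N_E have mV: "m \<in> VN" by auto
    show "m = zero \<or> (\<exists>k\<in>UM. m = succ k)" using bspec[OF h mV] *[OF mV] m(2) mem_N[OF mV] by blast
  next
    fix m assume h: "\<forall>m\<in>UM. m \<in> E n \<or> m = n \<longrightarrow> m = zero \<or> (\<exists>k\<in>UM. m = succ k)"
      and m: "m \<in> VN" "mem N m n \<or> m = n"
    show "is_zero N m \<or> (\<exists>k\<in>VN. is_succ N k m)" using bspec[OF h N_U[OF m(1)]] *[OF m(1)] m mem_N[OF m(1)] by blast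
  qed
qed

end

text \<open>Provides the lemmas \<open>self.c_...\<close>, which unfold the notions read in
  \<open>M\<close> itself.\<close>

sublocale zfa \<subseteq> self: tsub M M
  by unfold_locales (auto simp: E_def)

context zfa begin

section \<open>The action of permutations of the atoms\<close>

lemma regularity: assumes "x \<in> UM" "E x \<noteq> {}" obtains y where "y \<in> E x" "E x \<inter> E y = {}"
proof -
  have "ax_regularity M" using zfa by (simp add: zfa_model_def)
  then have "nonempty M x \<longrightarrow> (\<exists>y\<in>UM. mem M y x \<and> \<not> (\<exists>z\<in>UM. mem M z x \<and> mem M z y))"
    unfolding ax_regularity_def using assms(1) by (rule bspec)
  moreover have "nonempty M x" using assms by (simp add: self.c_nonempty)
  ultimately obtain y where y: "y \<in> UM" "mem M y x" "\<not> (\<exists>z\<in>UM. mem M z x \<and> mem M z y)" by auto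
  show ?thesis by (rule that[of y]) (use y in \<open>auto simp: E_def\<close>)
qed

text \<open>
  By the recursion theorem \<open>W\<close> is the whole universe, but
  working in \<open>W\<close> makes that theorem unnecessary: \<open>W\<close> supports \<open>\<in>\<close>-induction, contains all members
  of permutation models, and is closed under every construction used here.
\<close>

definition W :: "'m set" where "W = {x\<in>UM. \<exists>t\<in>UM. trans t \<and> x \<in> E t}"

lemma W_U: "x \<in> W \<Longrightarrow> x \<in> UM" by (simp add: W_def)
lemma D_W [def_intros]: "T t \<Longrightarrow> D (\<lambda>e. t e \<in> W)"
  unfolding W_def mem_Collect_eq by (intro def_intros; (intro T_shift)?; assumption)
lemma W_elem: "x \<in> W \<Longrightarrow> z \<in> E x \<Longrightarrow> z \<in> W"
  unfolding W_def trans_def using E_U by blast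

text \<open>The counterexamples inside a transitive set containing \<open>x\<close> form a set
  because \<open>P\<close> is definable, and regularity yields a minimal one.\<close>

lemma W_induct [consumes 1, case_names D step]:
  assumes "x \<in> W" "D (\<lambda>e. P (e 0))" "\<And>x. x \<in> W \<Longrightarrow> (\<And>z. z \<in> E x \<Longrightarrow> P z) \<Longrightarrow> P x"
  shows "P x"
proof (rule ccontr)
  assume nP: "\<not> P x"
  obtain t where t: "t \<in> UM" "trans t" "x \<in> E t" using assms(1) by (auto simp: W_def)
  have s: "small {z\<in>E t. \<not> P z}" by (rule small_sep) (use t in \<open>simp_all add: D_not assms(2)\<close>)
  have "E (mk {z\<in>E t. \<not> P z}) \<noteq> {}" using nP t by (auto simp: E_mk[OF s])
  from regularity[OF mk_U this] obtain y where y: "y \<in> E t" "\<not> P y" "{z\<in>E t. \<not> P z} \<inter> E y = {}"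
    unfolding E_mk[OF s] by blast
  have "y \<in> W" using y t E_U by (auto simp: W_def)
  moreover have "P z" if "z \<in> E y" for z using that y t(2) unfolding trans_def by blast
  ultimately show False using assms(3) y(2) by blast
qed

definition is_tc :: "'m \<Rightarrow> 'm \<Rightarrow> bool" where
  "is_tc x t \<longleftrightarrow> trans t \<and> x \<in> E t \<and> (\<forall>s\<in>UM. trans s \<and> x \<in> E s \<longrightarrow> E t \<subseteq> E s)"
definition tc :: "'m \<Rightarrow> 'm" where "tc x = theU (is_tc x)"

lemma D_is_tc [def_intros]: "T t \<Longrightarrow> T s \<Longrightarrow> D (\<lambda>e. is_tc (t e) (s e))"
  unfolding is_tc_def by (intro def_intros; (intro T_shift)?; assumption)
lemma T_tc [def_intros]: "T t \<Longrightarrow> T (\<lambda>e. tc (t e))"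
  unfolding tc_def by (intro def_intros; (intro T_shift)?; assumption)

lemma c_tclosure: assumes "x \<in> UM" "t \<in> UM" shows "is_tclosure M x t \<longleftrightarrow> is_tc x t"
proof -
  have "(\<forall>s\<in>UM. transitive M s \<and> mem M x s \<longrightarrow> sub M t s) \<longleftrightarrow> (\<forall>s\<in>UM. trans s \<and> x \<in> E s \<longrightarrow> E t \<subseteq> E s)"
    using assms by (simp add: self.c_trans self.mem_N self.c_sub)
  then show ?thesis using assms by (simp add: is_tclosure_def is_tc_def self.c_trans self.mem_N)
qed

lemma is_tc_unique: assumes "t \<in> UM" "s \<in> UM" "is_tc x t" "is_tc x s" shows "t = s"
proof -
  have "E t = E s" using assms unfolding is_tc_def by blast
  moreover have "iset t" "iset s" using assms isetI2[of _ x] by (auto simp: is_tc_def)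
  ultimately show ?thesis by (intro set_eqI)
qed

text \<open>The closure is cut out of one transitive set containing \<open>x\<close> as the
  intersection of all of them; membership in \<open>W\<close> supplies that set.\<close>

lemma tc: assumes "x \<in> W" shows "is_tc x (tc x)" "tc x \<in> UM"
proof -
  obtain t where t: "t \<in> UM" "trans t" "x \<in> E t" using assms(1) by (auto simp: W_def)
  have x: "x \<in> UM" using assms W_U by auto
  let ?S = "{z\<in>E t. \<forall>s\<in>UM. trans s \<and> x \<in> E s \<longrightarrow> z \<in> E s}"
  have s: "small ?S" by (rule small_sep) (simp add: t, intro def_intros x)
  have "is_tc x (mk ?S)" unfolding is_tc_def trans_def[of "mk ?S"] E_mk[OF s]
    using t unfolding trans_def by blast
  then have "\<exists>!t. t \<in> UM \<and> is_tc x t" using is_tc_unique by (intro ex1I[of _ "mk ?S"]) auto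
  then show "is_tc x (tc x)" "tc x \<in> UM" unfolding tc_def using theU[of "is_tc x"] by simp_all
qed

text \<open>The closures of the elements form a set by replacement, and their union together with
  \<open>x\<close> is transitive.\<close>

lemma W_I: assumes "x \<in> UM" "E x \<subseteq> W" shows "x \<in> W"
proof -
  let ?S = "insert x (\<Union>z\<in>E x. E (tc z))"
  have s: "small ?S" by (rule small_insert[OF assms(1) small_UN]) (simp add: assms, intro def_intros)
  have "trans (mk ?S)" unfolding trans_def E_mk[OF s]
  proof (intro ballI subsetI)
    fix u v assume u: "u \<in> ?S" and v: "v \<in> E u"
    show "v \<in> ?S"
    proof (cases "u = x")
      case True
      then have "v \<in> E (tc v)" using tc(1)[of v] v assms(2) by (auto simp: is_tc_def)
      then show ?thesis using True v by blast
    next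
      case False
      then obtain z where z: "z \<in> E x" "u \<in> E (tc z)" using u by blast
      then have "v \<in> E (tc z)" using tc(1)[of z] v assms(2) unfolding is_tc_def trans_def by blast
      then show ?thesis using z by blast
    qed
  qed
  then show ?thesis unfolding W_def using assms E_mk[OF s] by auto
qed

lemma W_iff: "x \<in> W \<longleftrightarrow> x \<in> UM \<and> E x \<subseteq> W" using W_I W_elem W_U by blast
lemma W_atom: "a \<in> E Atm \<Longrightarrow> a \<in> W" using atom_E E_U by (intro W_I) auto
lemma W_upair: "x \<in> UM \<Longrightarrow> y \<in> UM \<Longrightarrow> mk {x, y} \<in> W \<longleftrightarrow> x \<in> W \<and> y \<in> W"
  by (subst W_iff) (auto simp: E_upair)
lemma W_sing: "x \<in> UM \<Longrightarrow> mk {x} \<in> W \<longleftrightarrow> x \<in> W" using W_upair[of x x] by simp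
lemma W_opair: "x \<in> UM \<Longrightarrow> y \<in> UM \<Longrightarrow> opair x y \<in> W \<longleftrightarrow> x \<in> W \<and> y \<in> W"
  unfolding opair_def by (auto simp: W_upair W_sing)

lemma T_image: assumes "T t" "T (\<lambda>e. h (e 0))" shows "T (\<lambda>e. mk (h ` E (t e)))"
proof (rule T_mk)
  show "small (h ` E (t e))" if "range e \<subseteq> UM" for e
    using T_U[OF assms(1) that] assms(2) by (intro small_image small_E)
  show "D (\<lambda>e. e 0 \<in> h ` E (t (\<lambda>i. e (Suc i))))"
    by (rule D_cong[of _ "\<lambda>e. \<exists>z\<in>E (t (\<lambda>i. e (Suc i))). e 0 = h z"], blast,
        intro def_intros T_shift assms(1) T_sub[OF assms(2), of "\<lambda>i. i"])
qed

section \<open>Permutations of the atoms and their action\<close>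

definition perm :: "'m \<Rightarrow> bool" where
  "perm g \<longleftrightarrow> g \<in> UM \<and> func g (E Atm) (E Atm) \<and> bij_betw (app g) (E Atm) (E Atm)"

lemma perm_U: "perm g \<Longrightarrow> g \<in> UM" by (simp add: perm_def)
lemma c_perm: "g \<in> UM \<Longrightarrow> is_bij M g Atm Atm \<longleftrightarrow> perm g" by (simp add: self.c_bij perm_def)
lemma perm_in: "perm g \<Longrightarrow> a \<in> E Atm \<Longrightarrow> app g a \<in> E Atm"
  unfolding perm_def by (elim conjE) (rule func_in[OF _ E_subset_U E_subset_U])

definition act :: "'m \<Rightarrow> 'm \<Rightarrow> 'm \<Rightarrow> bool" where
  "act g t f \<longleftrightarrow> trans t \<and> (\<exists>Y\<in>UM. func f (E t) (E Y)) \<and>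
    (\<forall>u\<in>E t. if u \<in> E Atm then app f u = app g u
       else iset (app f u) \<and> (\<forall>z\<in>UM. z \<in> E (app f u) \<longleftrightarrow> (\<exists>w\<in>E u. z = app f w)))"
definition acts_to :: "'m \<Rightarrow> 'm \<Rightarrow> 'm \<Rightarrow> bool" where
  "acts_to g x y \<longleftrightarrow> (\<exists>t\<in>UM. \<exists>f\<in>UM. act g t f \<and> x \<in> E t \<and> y = app f x)"
text \<open>The action as a total operation, so that it may occur in terms and images; the recursion
  equations are proved for arguments in \<open>W\<close>.\<close>

definition pi :: "'m \<Rightarrow> 'm \<Rightarrow> 'm" where "pi g x = theU (acts_to g x)"

lemma D_act [def_intros]: "T g \<Longrightarrow> T t \<Longrightarrow> T f \<Longrightarrow> D (\<lambda>e. act (g e) (t e) (f e))"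
  unfolding act_def by (intro def_intros; (intro T_shift)?; (assumption | simp))
lemma D_acts_to [def_intros]: "T g \<Longrightarrow> T t \<Longrightarrow> T f \<Longrightarrow> D (\<lambda>e. acts_to (g e) (t e) (f e))"
  unfolding acts_to_def by (intro def_intros; (intro T_shift)?; (assumption | simp))
lemma T_pi [def_intros]: "T g \<Longrightarrow> T t \<Longrightarrow> T (\<lambda>e. pi (g e) (t e))"
  unfolding pi_def by (intro def_intros; (intro T_shift)?; (assumption | simp))
lemma pi_U [simp]: "pi g x \<in> UM" by (simp add: pi_def)

lemma act_E: assumes "act g t f" "u \<in> E t" "u \<notin> E Atm" shows "iset (app f u) \<and> E (app f u) = app f ` E u"
proof -
  have *: "iset (app f u)" "\<forall>z\<in>UM. z \<in> E (app f u) \<longleftrightarrow> (\<exists>w\<in>E u. z = app f w)"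
    using assms by (simp_all add: act_def)
  have "z \<in> E (app f u) \<longleftrightarrow> z \<in> app f ` E u" for z
    using bspec[OF *(2), of z] E_U[of z "app f u"] app_U[of f] by blast
  then show ?thesis using *(1) by blast
qed
lemma act_atom: "act g t f \<Longrightarrow> u \<in> E t \<Longrightarrow> u \<in> E Atm \<Longrightarrow> app f u = app g u"
  unfolding act_def by auto
lemma act_trans: "act g t f \<Longrightarrow> x \<in> E t \<Longrightarrow> z \<in> E x \<Longrightarrow> z \<in> E t"
  unfolding act_def trans_def by blast

lemma c_action: assumes "perm g" "t \<in> UM" "f \<in> UM"
  shows "is_action_fun M g t f \<longleftrightarrow> act g t f"
proof -
  have g: "g \<in> UM" "func g (E Atm) (E Atm)" using assms by (auto simp: perm_def)
  have Y: "(\<exists>Y\<in>UM. is_fun M f t Y) \<longleftrightarrow> (\<exists>Y\<in>UM. func f (E t) (E Y))" using assms by (simp add: self.c_fun)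
  show ?thesis
  proof (cases "trans t \<and> (\<exists>Y\<in>UM. func f (E t) (E Y))")
    case True
    then have tr: "trans t" and "\<exists>Y\<in>UM. func f (E t) (E Y)" by auto
    then obtain Y where "func f (E t) (E Y)" by auto
    then have r: "rel M f u v \<longleftrightarrow> u \<in> E t \<and> v = app f u" if "u \<in> UM" "v \<in> UM" for u v
      using that assms func_iff[of f "E t" "E Y" u v] E_subset_U by (simp add: self.c_rel)
    have rg: "rel M g u v \<longleftrightarrow> u \<in> E Atm \<and> v = app g u" if "u \<in> UM" "v \<in> UM" for u v
      using that g func_iff[of g "E Atm" "E Atm" u v] E_subset_U by (simp add: self.c_rel)
    define Q where "Q u v = (if is_atom M u then rel M g u v
         else is_set M v \<and> (\<forall>z\<in>UM. mem M z v \<longleftrightarrow> (\<exists>w\<in>UM. mem M w u \<and> rel M f w z)))" for u v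
    define R where "R u = (if u \<in> E Atm then app f u = app g u
       else iset (app f u) \<and> (\<forall>z\<in>UM. z \<in> E (app f u) \<longleftrightarrow> (\<exists>w\<in>E u. z = app f w)))" for u
    have QR: "Q u (app f u) \<longleftrightarrow> R u" if u: "u \<in> E t" for u
    proof -
      have uU: "u \<in> UM" using u E_U by auto
      have "(\<exists>w\<in>UM. mem M w u \<and> rel M f w z) \<longleftrightarrow> (\<exists>w\<in>E u. z = app f w)" if "z \<in> UM" for z
      proof -
        have "(\<exists>w\<in>UM. mem M w u \<and> rel M f w z) \<longleftrightarrow> (\<exists>w\<in>E u. rel M f w z)" by (rule self.ex_N[OF uU])
        also have "\<dots> \<longleftrightarrow> (\<exists>w\<in>E u. z = app f w)"
          using tr u E_U[of _ u] r[OF _ that] unfolding trans_def by blast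
        finally show ?thesis .
      qed
      moreover have "is_atom M u \<longleftrightarrow> u \<in> E Atm" using uU by (simp add: is_atom_def self.mem_N)
      ultimately show ?thesis unfolding Q_def R_def using uU by (simp add: rg self.mem_N)
    qed
    have "(\<forall>u\<in>UM. \<forall>v\<in>UM. rel M f u v \<longrightarrow> Q u v) \<longleftrightarrow> (\<forall>u\<in>E t. Q u (app f u))"
      using r E_U[of _ t] app_U[of f] by blast
    also have "\<dots> \<longleftrightarrow> (\<forall>u\<in>E t. R u)" using QR by simp
    finally have "(\<forall>u\<in>UM. \<forall>v\<in>UM. rel M f u v \<longrightarrow> Q u v) \<longleftrightarrow> (\<forall>u\<in>E t. R u)" .
    then show ?thesis unfolding is_action_fun_def act_def Q_def R_def Y self.c_trans[OF assms(2)] by blast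
  next
    case False
    then show ?thesis unfolding is_action_fun_def act_def Y self.c_trans[OF assms(2)] by blast
  qed
qed

lemma c_acts: assumes "perm g" "x \<in> UM" "y \<in> UM" shows "acts M g x y \<longleftrightarrow> acts_to g x y"
proof -
  have "is_action_fun M g t f \<and> rel M f x y \<longleftrightarrow> act g t f \<and> x \<in> E t \<and> y = app f x" if "t \<in> UM" "f \<in> UM" for t f
  proof -
    have "rel M f x y \<longleftrightarrow> x \<in> E t \<and> y = app f x" if a: "act g t f"
    proof -
      obtain Y where "func f (E t) (E Y)" using a by (auto simp: act_def)
      then show ?thesis using func_iff[of f "E t" "E Y" x y] E_subset_U assms \<open>f \<in> UM\<close> by (simp add: self.c_rel)
    qed
    then show ?thesis using c_action[OF assms(1) that] by blast
  qed
  then show ?thesis unfolding acts_def acts_to_def by blast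
qed

text \<open>Membership induction: solutions of the recursion have transitive domains, so below a
  common argument both are defined.\<close>

lemma act_unique:
  assumes "x \<in> W" "act g t f" "act g t' f'" "x \<in> E t" "x \<in> E t'" "t \<in> UM" "t' \<in> UM" "f \<in> UM" "f' \<in> UM"
  shows "app f x = app f' x"
proof -
  have "x \<in> E t \<longrightarrow> x \<in> E t' \<longrightarrow> app f x = app f' x" using assms(1)
  proof (induction x rule: W_induct)
    case D show ?case by (intro def_intros assms)
  next
    case (step x)
    show ?case
    proof (intro impI)
      assume x: "x \<in> E t" "x \<in> E t'"
      show "app f x = app f' x"
      proof (cases "x \<in> E Atm")
        case True then show ?thesis using act_atom[OF assms(2) x(1)] act_atom[OF assms(3) x(2)] by simp
      next
        case False
        have "app f z = app f' z" if "z \<in> E x" for z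
          using step.IH[OF that] act_trans[OF assms(2) x(1) that] act_trans[OF assms(3) x(2) that] by simp
        then have "app f ` E x = app f' ` E x" by (rule image_cong[OF refl])
        then show ?thesis using act_E[OF assms(2) x(1) False] act_E[OF assms(3) x(2) False] by (intro set_eqI) auto
      qed
    qed
  qed
  then show ?thesis using assms by simp
qed

lemma acts_to_unique: "x \<in> W \<Longrightarrow> acts_to g x y \<Longrightarrow> acts_to g x y' \<Longrightarrow> y = y'"
  unfolding acts_to_def using act_unique by blast
lemma acts_to_pi: assumes "x \<in> W" "acts_to g x y" shows "pi g x = y"
proof -
  have "y \<in> UM" using assms(2) by (auto simp: acts_to_def)
  then show ?thesis unfolding pi_def using assms acts_to_unique by (intro theU_I) auto
qed

lemma acts_to_eq: assumes "x \<in> W" "acts_to g x y"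
  shows "x \<in> E Atm \<Longrightarrow> y = app g x" "x \<notin> E Atm \<Longrightarrow> iset y \<and> E y = pi g ` E x" "\<And>z. z \<in> E x \<Longrightarrow> acts_to g z (pi g z)"
proof -
  obtain t f where t: "t \<in> UM" "f \<in> UM" "act g t f" "x \<in> E t" "y = app f x" using assms(2) by (auto simp: acts_to_def)
  show "x \<in> E Atm \<Longrightarrow> y = app g x" using t act_atom by auto
  have *: "acts_to g z (app f z)" if "z \<in> E x" for z
    unfolding acts_to_def using t act_trans[OF t(3,4) that] by blast
  have pi: "pi g z = app f z" if "z \<in> E x" for z
    by (rule acts_to_pi[OF W_elem[OF assms(1) that] *[OF that]])
  then show "\<And>z. z \<in> E x \<Longrightarrow> acts_to g z (pi g z)" using * by simp
  have "pi g ` E x = app f ` E x" using pi by (rule image_cong[OF refl])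
  then show "x \<notin> E Atm \<Longrightarrow> iset y \<and> E y = pi g ` E x" using t act_E by auto
qed

text \<open>Membership induction. The part \<open>D0\<close> of a transitive set where the action is
  already defined is transitive and contains the elements of \<open>x\<close>; adding
  \<open>x\<close> to it leaves only one new value to be given.\<close>

lemma acts_to_ex: assumes g: "g \<in> UM" and "x \<in> W" shows "\<exists>y\<in>UM. acts_to g x y"
  using assms(2)
proof (induction x rule: W_induct)
  case D show ?case by (intro def_intros g)
next
  case (step x)
  obtain t where t: "t \<in> UM" "trans t" "x \<in> E t" using step(1) by (auto simp: W_def)
  have tW: "z \<in> W" if "z \<in> E t" for z using that t E_U by (auto simp: W_def)
  define D0 where "D0 = {z\<in>E t. \<exists>y\<in>UM. acts_to g z y}"
  have sD0: "small D0" unfolding D0_def by (rule small_sep) (simp add: t, intro def_intros g)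
  have D0: "acts_to g z (pi g z)" "z \<in> W" if "z \<in> D0" for z using that acts_to_pi tW unfolding D0_def by auto
  have D0t: "w \<in> D0" if "z \<in> D0" "w \<in> E z" for w z
  proof -
    have "w \<in> E t" using that t(2) unfolding D0_def trans_def by blast
    moreover have "acts_to g w (pi g w)" using acts_to_eq(3)[OF D0(2) D0(1)] that by blast
    ultimately show ?thesis unfolding D0_def by auto
  qed
  have xD0: "E x \<subseteq> D0" using step(2) t unfolding D0_def trans_def by blast
  \<comment> \<open>One step of the recursion: on \<open>D0\<close> it reproduces
    \<open>pi g\<close>, and at \<open>x\<close> it supplies the missing value.\<close>
  define h where "h u = (if u \<in> E Atm then app g u else mk (pi g ` E u))" for u
  have Th: "T (\<lambda>e. h (e 0))" unfolding h_def by (intro def_intros g T_image) simp_all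
  define s where "s = mk (insert x D0)"
  have xU: "x \<in> UM" using step(1) W_U by auto
  have Es: "E s = insert x D0" unfolding s_def by (intro E_mk small_insert xU sD0)
  have hpi: "h z = pi g z" if "z \<in> D0" for z
    using acts_to_eq(1,2)[OF D0(2,1)[OF that]] mk_eqI[of "pi g z"] by (auto simp: h_def)
  have tr: "trans s" unfolding trans_def Es using xD0 D0t by blast
  have sub: "E u \<subseteq> D0" if "u \<in> E s" for u using that xD0 D0t unfolding Es by auto
  have G: "func (graph h (E s)) (E s) UM'" if "\<And>x. x \<in> E s \<Longrightarrow> h x \<in> UM'" "UM' \<subseteq> UM" for UM'
    using that by (intro graph(3)[OF _ Th]) (simp_all add: s_def)
  have aph: "app (graph h (E s)) u = h u" if "u \<in> E s" for u
    using that by (intro graph(4)[OF _ Th]) (simp_all add: s_def)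
  have "act g s (graph h (E s))" unfolding act_def
  proof (intro conjI ballI tr)
    have sY: "small (h ` E s)" by (rule small_image[OF _ Th]) (simp add: s_def)
    show "\<exists>Y\<in>UM. func (graph h (E s)) (E s) (E Y)"
      by (rule bexI[of _ "mk (h ` E s)"]) (simp_all add: E_mk[OF sY] G small_U[OF sY])
    fix u assume u: "u \<in> E s"
    have im: "pi g ` E u = (\<lambda>w. app (graph h (E s)) w) ` E u"
      using sub[OF u] hpi aph Es by (intro image_cong[OF refl]) auto
    have sm: "small (pi g ` E u)"
      using E_U[OF u] by (intro small_image) (simp, intro def_intros g)
    show "if u \<in> E Atm then app (graph h (E s)) u = app g u
       else iset (app (graph h (E s)) u) \<and> (\<forall>z\<in>UM. z \<in> E (app (graph h (E s)) u) \<longleftrightarrow> (\<exists>w\<in>E u. z = app (graph h (E s)) w))"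
    proof (cases "u \<in> E Atm")
      case True then show ?thesis using aph[OF u] by (simp add: h_def)
    next
      case False
      then have "app (graph h (E s)) u = mk (pi g ` E u)" using aph[OF u] by (simp add: h_def)
      then have "iset (app (graph h (E s)) u)" "E (app (graph h (E s)) u) = (\<lambda>w. app (graph h (E s)) w) ` E u"
        using mk(1) E_mk[OF sm] im by simp_all
      then show ?thesis using False by auto
    qed
  qed
  then have "acts_to g x (app (graph h (E s)) x)" unfolding acts_to_def
    by (intro bexI[of _ s] bexI[of _ "graph h (E s)"] conjI refl) (simp_all only: Es insertI1 graph_U, simp add: s_def)
  then show ?case by auto
qed

lemma acts_to_iff: assumes "g \<in> UM" "x \<in> W" shows "acts_to g x y \<longleftrightarrow> y = pi g x"
  using acts_to_ex[OF assms] acts_to_pi[OF assms(2)] by metis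
lemma acts_iff: "perm g \<Longrightarrow> x \<in> W \<Longrightarrow> y \<in> UM \<Longrightarrow> acts M g x y \<longleftrightarrow> y = pi g x"
  using c_acts[of g x y] acts_to_iff perm_U W_U by simp

lemma pi_atom: "perm g \<Longrightarrow> a \<in> E Atm \<Longrightarrow> pi g a = app g a"
  using acts_to_eq(1)[of a g "pi g a"] acts_to_iff[of g a] W_atom perm_U by simp
lemma pi_set: assumes "perm g" "x \<in> W" "iset x" shows "iset (pi g x)" "E (pi g x) = pi g ` E x"
  using acts_to_eq(2)[of x g "pi g x"] acts_to_iff[of g x] assms perm_U iset_iff[of x] by auto
lemma pi_atom_in: "perm g \<Longrightarrow> a \<in> E Atm \<Longrightarrow> pi g a \<in> E Atm" by (simp add: pi_atom perm_in)

lemma pi_W: assumes g: "perm g" and "x \<in> W" shows "pi g x \<in> W"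
  using assms(2)
proof (induction x rule: W_induct)
  case D show ?case by (intro def_intros perm_U[OF g])
next
  case (step x)
  show ?case
  proof (cases "x \<in> E Atm")
    case True then show ?thesis using pi_atom_in[OF g] W_atom by simp
  next
    case False
    then have "E (pi g x) = pi g ` E x" using pi_set[OF g step(1)] W_U[OF step(1)] atom_or_set by simp
    then show ?thesis using step(2) by (intro W_I) auto
  qed
qed

lemma pi_comp: assumes p: "perm g" "perm h" "perm k" and eq: "\<And>a. a \<in> E Atm \<Longrightarrow> app k a = app g (app h a)"
    and "x \<in> W" shows "pi k x = pi g (pi h x)"
  using assms(5)
proof (induction x rule: W_induct)
  case D show ?case by (intro def_intros perm_U p)
next
  case (step x)
  show ?case
  proof (cases "x \<in> E Atm")
    case True then show ?thesis using p eq by (simp add: pi_atom perm_in)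
  next
    case False
    then have x: "iset x" using W_U[OF step(1)] atom_or_set by simp
    note h = pi_set[OF p(2) step(1) x] and k = pi_set[OF p(3) step(1) x]
    note g = pi_set[OF p(1) pi_W[OF p(2) step(1)] h(1)]
    show ?thesis
    proof (rule set_eqI[OF k(1) g(1)])
      show "E (pi k x) = E (pi g (pi h x))" unfolding g(2) h(2) k(2) image_image
        by (rule image_cong[OF refl]) (rule step(2))
    qed
  qed
qed

lemma pi_fix_set: "perm g \<Longrightarrow> x \<in> W \<Longrightarrow> iset x \<Longrightarrow> (\<And>z. z \<in> E x \<Longrightarrow> pi g z = z) \<Longrightarrow> pi g x = x"
  using pi_set[of g x] by (intro set_eqI) auto

lemma pi_id: assumes g: "perm g" and eq: "\<And>a. a \<in> E Atm \<Longrightarrow> app g a = a" and "x \<in> W" shows "pi g x = x"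
  using assms(3)
proof (induction x rule: W_induct)
  case D show ?case by (intro def_intros perm_U g)
next
  case (step x)
  show ?case
  proof (cases "x \<in> E Atm")
    case True then show ?thesis using g eq by (simp add: pi_atom)
  next
    case False
    then have "iset x" using W_U[OF step(1)] atom_or_set by simp
    then show ?thesis using step(2) by (rule pi_fix_set[OF g step(1)])
  qed
qed

text \<open>A permutation moves a set only through atoms in its transitive closure, and
  \<open>t\<close> shuts these out.\<close>

lemma pi_pure: assumes g: "perm g" and t: "t \<in> UM" "trans t" "\<And>x. x \<in> E t \<Longrightarrow> iset x" and "x \<in> E t"
  shows "pi g x = x"
proof -
  have "x \<in> W" using t assms(5) E_U by (auto simp: W_def)
  then have "x \<in> E t \<longrightarrow> pi g x = x"
  proof (induction x rule: W_induct)
    case D show ?case by (intro def_intros perm_U g t)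
  next
    case (step x)
    show ?case
    proof
      assume x: "x \<in> E t"
      have "pi g z = z" if "z \<in> E x" for z using step(2)[OF that] that x t(2) unfolding trans_def by blast
      then show "pi g x = x" by (rule pi_fix_set[OF g step(1) t(3)[OF x]])
    qed
  qed
  then show ?thesis using assms(5) by simp
qed

section \<open>Group operations on permutations\<close>

lemma perm_graph:
  assumes "T (\<lambda>e. t (e 0))" "bij_betw t (E Atm) (E Atm)"
  shows "perm (graph t (E Atm))" "a \<in> E Atm \<Longrightarrow> app (graph t (E Atm)) a = t a"
proof -
  have s: "small (E Atm)" by simp
  show app: "app (graph t (E Atm)) a = t a" if "a \<in> E Atm" for a by (rule graph(4)[OF s assms(1) that])
  have "bij_betw (app (graph t (E Atm))) (E Atm) (E Atm) \<longleftrightarrow> bij_betw t (E Atm) (E Atm)"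
    by (rule bij_betw_cong) (rule app)
  moreover have "func (graph t (E Atm)) (E Atm) (E Atm)"
    using assms(2) E_subset_U by (intro graph(3)[OF s assms(1)]) (auto simp: bij_betw_def)
  ultimately show "perm (graph t (E Atm))" using assms(2) by (simp add: perm_def)
qed

lemma perm_id: obtains i where "perm i" "\<And>a. a \<in> E Atm \<Longrightarrow> app i a = a"
  using perm_graph[of "\<lambda>a. a", OF T_var] bij_betw_id[of "E Atm"] by (auto simp: id_def)

lemma perm_comp: assumes "perm g" "perm h"
  obtains k where "perm k" "\<And>a. a \<in> E Atm \<Longrightarrow> app k a = app g (app h a)"
proof -
  have "T (\<lambda>e. app g (app h (e 0)))" by (intro def_intros perm_U assms)
  moreover have "bij_betw (\<lambda>a. app g (app h a)) (E Atm) (E Atm)"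
    using assms bij_betw_trans[of "app h" _ _ "app g"] by (auto simp: perm_def comp_def)
  ultimately show ?thesis using perm_graph[of "\<lambda>a. app g (app h a)"] that by blast
qed

lemma perm_inv: assumes g: "perm g"
  obtains k where "perm k" "\<And>a. a \<in> E Atm \<Longrightarrow> app k (app g a) = a" "\<And>a. a \<in> E Atm \<Longrightarrow> app g (app k a) = a"
proof -
  \<comment> \<open>The inverse is described by \<open>theU\<close> to make it definable;
    \<open>inv_into\<close> only serves to compute its values.\<close>
  let ?k = "\<lambda>b. theU (\<lambda>a. a \<in> E Atm \<and> app g a = b)"
  have b: "bij_betw (app g) (E Atm) (E Atm)" using g by (simp add: perm_def)
  have k: "?k b = inv_into (E Atm) (app g) b" if "b \<in> E Atm" for b
  proof (rule theU_I)
    have "inv_into (E Atm) (app g) b \<in> E Atm" using b that by (metis bij_betw_def inv_into_into)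
    then show "inv_into (E Atm) (app g) b \<in> UM"
      "inv_into (E Atm) (app g) b \<in> E Atm \<and> app g (inv_into (E Atm) (app g) b) = b"
      using b that bij_betw_inv_into_right[OF b that] E_U by auto
    show "z = inv_into (E Atm) (app g) b" if "z \<in> E Atm \<and> app g z = b" for z
      using that bij_betw_inv_into_left[OF b] by auto
  qed
  have "T (\<lambda>e. ?k (e 0))" by (intro def_intros perm_U[OF g]) simp_all
  moreover have "bij_betw ?k (E Atm) (E Atm)"
    using bij_betw_inv_into[OF b] k by (subst bij_betw_cong[of _ _ "inv_into (E Atm) (app g)"]) auto
  ultimately have *: "perm (graph ?k (E Atm))" "\<And>a. a \<in> E Atm \<Longrightarrow> app (graph ?k (E Atm)) a = inv_into (E Atm) (app g) a"
    using perm_graph[of ?k] k by auto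
  show ?thesis
  proof (rule that[OF *(1)])
    show "app (graph ?k (E Atm)) (app g a) = a" if "a \<in> E Atm" for a
      using that *(2)[OF perm_in[OF g that]] bij_betw_inv_into_left[OF b] by simp
    show "app g (app (graph ?k (E Atm)) a) = a" if "a \<in> E Atm" for a
      using that *(2)[OF that] bij_betw_inv_into_right[OF b] by simp
  qed
qed

lemma pi_inv: assumes "perm g" "perm k" "\<And>a. a \<in> E Atm \<Longrightarrow> app k (app g a) = a" "x \<in> W"
  shows "pi k (pi g x) = x"
proof -
  obtain i where i: "perm i" "\<And>a. a \<in> E Atm \<Longrightarrow> app i a = a" using perm_id by blast
  have "pi i x = pi k (pi g x)" using assms i by (intro pi_comp) auto
  then show ?thesis using pi_id[OF i assms(4)] by simp
qed

lemma pi_inj: assumes "perm g" "x \<in> W" "y \<in> W" "pi g x = pi g y" shows "x = y"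
  using perm_inv[OF assms(1)] pi_inv[OF assms(1)] assms by metis

lemma pi_upair: assumes "perm g" "x \<in> W" "y \<in> W" shows "pi g (mk {x, y}) = mk {pi g x, pi g y}"
  using pi_set[OF assms(1), of "mk {x, y}"] assms W_U mk(1) W_upair[of x y]
  by (intro mk_eqI[symmetric]) (auto simp: E_upair)
lemma pi_opair: assumes "perm g" "x \<in> W" "y \<in> W" shows "pi g (opair x y) = opair (pi g x) (pi g y)"
  using pi_upair[OF assms(1,2,2)] pi_upair[OF assms] pi_upair[OF assms(1), of "mk {x}" "mk {x, y}"]
    assms W_U W_upair[of x y] W_sing[of x] unfolding opair_def by simp

section \<open>Ordinals, natural numbers, countability\<close>

lemma timesI: "x \<in> X \<Longrightarrow> y \<in> Y \<Longrightarrow> opair x y \<in> times X Y" by (auto simp: times_def)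
lemma timesE: assumes "p \<in> times X Y" obtains x y where "x \<in> X" "y \<in> Y" "p = opair x y"
  using assms by (auto simp: times_def)
lemma E_zero: "E zero = {}" by (rule zero)

lemma no_loop: assumes "x \<in> UM" shows "x \<notin> E x"
proof
  assume x: "x \<in> E x"
  obtain y where "y \<in> E (mk {x})" "E (mk {x}) \<inter> E y = {}"
    by (rule regularity[of "mk {x}"]) (auto simp: E_sing assms)
  then show False using x by (auto simp: E_sing assms)
qed
lemma no_loop2: assumes "x \<in> E y" shows "y \<notin> E x"
proof
  assume y: "y \<in> E x"
  have U: "x \<in> UM" "y \<in> UM" using assms y E_U by auto
  obtain z where "z \<in> E (mk {x, y})" "E (mk {x, y}) \<inter> E z = {}"
    by (rule regularity[of "mk {x, y}"]) (auto simp: E_upair U)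
  then show False using assms y by (auto simp: E_upair U)
qed
lemma succ_inj: assumes "n \<in> UM" "m \<in> UM" "succ n = succ m" shows "n = m"
proof -
  have "insert n (E n) = insert m (E m)" using E_succ assms by metis
  then have "n = m \<or> n \<in> E m" "m = n \<or> m \<in> E n" by blast+
  then show ?thesis using no_loop2 by blast
qed
lemma no_loop3: assumes "x \<in> E y" "y \<in> E z" shows "z \<notin> E x"
proof
  assume z: "z \<in> E x"
  have U: "x \<in> UM" "y \<in> UM" "z \<in> UM" using assms z E_U by auto
  have s: "small {x, y, z}" by (intro small_insert U small_empty)
  obtain w where "w \<in> E (mk {x, y, z})" "E (mk {x, y, z}) \<inter> E w = {}"
    by (rule regularity[of "mk {x, y, z}"]) (auto simp: E_mk[OF s])
  then show False using assms z by (auto simp: E_mk[OF s])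
qed

section \<open>Ordinals and their comparison\<close>

lemma Ord_iset: "Ord a \<Longrightarrow> iset a" by (simp add: Ord_def)
lemma Ord_U: "Ord a \<Longrightarrow> a \<in> UM" using Ord_iset iset_U by auto
lemma Ord_sub: "Ord a \<Longrightarrow> x \<in> E a \<Longrightarrow> E x \<subseteq> E a" by (simp add: Ord_def)
lemma Ord_lin: "Ord a \<Longrightarrow> x \<in> E a \<Longrightarrow> y \<in> E a \<Longrightarrow> x \<in> E y \<or> x = y \<or> y \<in> E x"
  by (simp add: Ord_def)
lemma Ord_elem_iset: "Ord a \<Longrightarrow> x \<in> E a \<Longrightarrow> iset x" by (simp add: Ord_def)

lemma Ord_elem: assumes "Ord a" "x \<in> E a" shows "Ord x"
  unfolding Ord_def
proof (intro conjI ballI subsetI)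
  show "iset x" using assms by (rule Ord_elem_iset)
  fix y assume y: "y \<in> E x"
  then have ya: "y \<in> E a" using Ord_sub[OF assms] by blast
  then show "iset y" using Ord_elem_iset assms(1) by blast
  show "z \<in> E x" if z: "z \<in> E y" for z
  proof -
    have "z \<in> E a" using Ord_sub[OF assms(1) ya] z by blast
    \<comment> \<open>\<open>x\<close> and \<open>z\<close> are comparable in \<open>a\<close>; the
      cases \<open>z = x\<close> and \<open>x \<in> E z\<close> would close a membership cycle of
      length two or three.\<close>
    then consider "z \<in> E x" | "z = x" | "x \<in> E z" using Ord_lin[OF assms(1) _ assms(2)] by blast
    then show ?thesis using no_loop2[OF y] no_loop3[OF z y] z by cases auto
  qed
  show "y \<in> E z \<or> y = z \<or> z \<in> E y" if "z \<in> E x" for z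
    using Ord_lin[OF assms(1) ya] Ord_sub[OF assms] that by blast
qed

lemma Ord_succ: assumes "Ord a" shows "Ord (succ a)"
proof -
  have a: "iset a" "a \<in> UM" using Ord_iset Ord_U assms by auto
  show ?thesis unfolding Ord_def[of "succ a"] E_succ[OF a(2)]
  proof (intro conjI ballI)
    fix x assume x: "x \<in> insert a (E a)"
    then show "iset x" "E x \<subseteq> insert a (E a)" using a Ord_elem_iset[OF assms] Ord_sub[OF assms] by auto
    fix y assume "y \<in> insert a (E a)"
    then show "x \<in> E y \<or> x = y \<or> y \<in> E x" using x Ord_lin[OF assms] by auto
  qed simp
qed

text \<open>A membership-minimal element \<open>y\<close> of the difference has exactly the elements
  of \<open>c\<close>, hence is \<open>c\<close>.\<close>

lemma Ord_psub: assumes a: "Ord a" and c: "Ord c" and sub: "E c \<subseteq> E a" and ne: "c \<noteq> a" shows "c \<in> E a"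
proof -
  have aU: "a \<in> UM" "c \<in> UM" using a c Ord_U by auto
  have s: "small (E a - E c)" by (rule small_subset[of "E a" "\<lambda>x. x \<notin> E c"]) (simp_all add: aU, intro def_intros aU)
  have "E a \<noteq> E c" using ne set_eqI a c Ord_iset by blast
  then have "E (mk (E a - E c)) \<noteq> {}" using sub by (auto simp: E_mk[OF s])
  from regularity[OF mk_U this] obtain y where y: "y \<in> E a" "y \<notin> E c" "(E a - E c) \<inter> E y = {}"
    unfolding E_mk[OF s] by blast
  have "E y = E c"
  proof
    show "E y \<subseteq> E c" using Ord_sub[OF a y(1)] y(3) by blast
    show "E c \<subseteq> E y"
    proof
      fix z assume z: "z \<in> E c"
      then consider "z \<in> E y" | "z = y" | "y \<in> E z" using Ord_lin[OF a _ y(1)] sub by blast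
      then show "z \<in> E y" using z y(2) Ord_sub[OF c z] by cases auto
    qed
  qed
  then have "y = c" using set_eqI Ord_iset[OF c] Ord_elem_iset[OF a y(1)] by blast
  then show ?thesis using y by simp
qed

text \<open>The intersection \<open>c\<close> is an ordinal; were it different from both, it would
  be an element of both and thus of itself.\<close>

lemma Ord_tri: assumes a: "Ord a" and b: "Ord b" shows "a \<in> E b \<or> a = b \<or> b \<in> E a"
proof -
  have U: "a \<in> UM" "b \<in> UM" using a b Ord_U by auto
  have s: "small (E a \<inter> E b)" by (rule small_subset[of "E a" "\<lambda>x. x \<in> E b"]) (simp_all add: U, intro def_intros U)
  define c where "c = mk (E a \<inter> E b)"
  have Ec: "E c = E a \<inter> E b" unfolding c_def by (rule E_mk[OF s])
  have c: "Ord c" unfolding Ord_def Ec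
  proof (intro conjI ballI)
    show "iset c" by (simp add: c_def mk)
    fix x assume x: "x \<in> E a \<inter> E b"
    then show "iset x" "E x \<subseteq> E a \<inter> E b" using Ord_elem_iset[OF a] Ord_sub[OF a] Ord_sub[OF b] by auto
    fix y assume "y \<in> E a \<inter> E b"
    then show "x \<in> E y \<or> x = y \<or> y \<in> E x" using x Ord_lin[OF a] by auto
  qed
  have "c = a \<or> c \<in> E a" using Ord_psub[OF a c] Ec by auto
  moreover have "c = b \<or> c \<in> E b" using Ord_psub[OF b c] Ec by auto
  moreover have "\<not> (c \<in> E a \<and> c \<in> E b)" using no_loop[of c] Ec Ord_U[OF c] by auto
  ultimately show ?thesis by auto
qed

lemma Ord_W: assumes "Ord a" shows "a \<in> W"
  unfolding W_def
proof (intro CollectI conjI bexI)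
  show "trans (succ a)" using Ord_succ[OF assms] by (simp add: trans_def Ord_def)
  show "a \<in> E (succ a)" using Ord_U[OF assms] by (simp add: E_succ)
qed (simp_all add: Ord_U assms)

text \<open>This lets a transposition change only the atom coordinate of a pair of an atom and an
  ordinal.\<close>

lemma pi_Ord: assumes g: "perm g" and a: "Ord a" shows "pi g a = a"
proof (rule pi_pure[OF g, of "succ a"])
  show "trans (succ a)" using Ord_succ[OF a] by (simp add: trans_def Ord_def)
  show "iset x" if "x \<in> E (succ a)" for x using Ord_elem_iset[OF Ord_succ[OF a] that] .
  show "a \<in> E (succ a)" using Ord_U[OF a] by (simp add: E_succ)
qed simp

text \<open>A definable selection from sets of ordinals, which takes the place of a choice of
  indices.\<close>

definition least_elt :: "'m set \<Rightarrow> 'm" where "least_elt S = theU (\<lambda>x. x \<in> S \<and> (\<forall>y\<in>E x. y \<notin> S))"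
lemma least_elt: assumes "small S" "S \<noteq> {}" "\<And>x. x \<in> S \<Longrightarrow> Ord x" shows "least_elt S \<in> S" "y \<in> E (least_elt S) \<Longrightarrow> y \<notin> S"
proof -
  obtain x where x: "x \<in> S" "S \<inter> E x = {}"
    using regularity[of "mk S"] assms by (auto simp: E_mk)
  have "\<exists>!x. x \<in> UM \<and> x \<in> S \<and> (\<forall>y\<in>E x. y \<notin> S)"
  proof (rule ex1I[of _ x])
    show "x \<in> UM \<and> x \<in> S \<and> (\<forall>y\<in>E x. y \<notin> S)" using x small_U[OF assms(1)] by auto
    fix z assume z: "z \<in> UM \<and> z \<in> S \<and> (\<forall>y\<in>E z. y \<notin> S)"
    then show "z = x" using Ord_tri[OF assms(3) assms(3), of x z] x by auto
  qed
  from theU(1)[OF this, folded least_elt_def] show "least_elt S \<in> S" "y \<in> E (least_elt S) \<Longrightarrow> y \<notin> S" by blast+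
qed

section \<open>Natural numbers of the structure\<close>

definition Om :: "'m set" where "Om = {n\<in>UM. Natl n}"

lemma Natl_Ord: "Natl n \<Longrightarrow> Ord n" by (simp add: Natl_def)
lemma Om_Ord: "n \<in> Om \<Longrightarrow> Ord n" by (simp add: Om_def Natl_Ord)
lemma Natl_Om: "Natl n \<longleftrightarrow> n \<in> Om" using Natl_Ord Ord_U by (auto simp: Om_def)
lemma Om_U: "n \<in> Om \<Longrightarrow> n \<in> UM" by (simp add: Om_def)
lemma D_Om [def_intros]: "T t \<Longrightarrow> D (\<lambda>e. t e \<in> Om)"
  unfolding Om_def mem_Collect_eq by (intro def_intros)

lemma Om_zero: "zero \<in> Om"
  by (auto simp: Om_def Natl_def Ord_def zero)
lemma Om_elem: assumes "n \<in> Om" "m \<in> E n" shows "m \<in> Om"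
proof -
  have n: "Natl n" "Ord n" using assms(1) Om_def Om_Ord by auto
  have "k \<in> E n" if "k \<in> E m \<or> k = m" for k using that assms(2) Ord_sub[OF n(2) assms(2)] by auto
  then have "Natl m" using n(1) Ord_elem[OF n(2) assms(2)] unfolding Natl_def by blast
  then show ?thesis by (simp add: Natl_Om)
qed
lemma Om_succ: assumes "n \<in> Om" shows "succ n \<in> Om"
proof -
  have n: "Natl n" "Ord n" "n \<in> UM" using assms(1) Om_def Om_Ord by auto
  have "Natl (succ n)" unfolding Natl_def[of "succ n"] E_succ[OF n(3)] using Ord_succ[OF n(2)] n(1,3) unfolding Natl_def by blast
  then show ?thesis by (simp add: Natl_Om)
qed
lemma Om_cases: assumes "n \<in> Om" obtains "n = zero" | k where "k \<in> Om" "n = succ k"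
proof -
  have "n = zero \<or> (\<exists>k\<in>UM. n = succ k)" using assms unfolding Om_def Natl_def by blast
  then show ?thesis using that Om_elem[OF assms] E_succ by auto
qed

text \<open>An instance of membership induction: a nonzero natural number has its predecessor as an
  element.\<close>

lemma Om_induct [consumes 1, case_names D zero succ]:
  assumes "n \<in> Om" "D (\<lambda>e. P (e 0))" "P zero" "\<And>n. n \<in> Om \<Longrightarrow> P n \<Longrightarrow> P (succ n)"
  shows "P n"
proof -
  have "n \<in> W" using Ord_W Om_Ord assms(1) by auto
  then have "n \<in> Om \<longrightarrow> P n"
  proof (induction n rule: W_induct)
    case D show ?case by (intro def_intros assms)
  next
    case (step n)
    show ?case
    proof
      assume "n \<in> Om"
      then show "P n"
      proof (cases rule: Om_cases)
        case 1 then show ?thesis using assms by simp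
      next
        case (2 k) then show ?thesis using step(2)[of k] assms(4)[of k] Om_U by (simp add: E_succ)
      qed
    qed
  qed
  then show ?thesis using assms(1) by simp
qed

text \<open>\<open>Om\<close> is at first only a class; internal induction places it inside the
  inductive set of the axiom of infinity, and separation makes it a set.\<close>

lemma small_Om: "small Om"
proof -
  have "ax_infinity M" using zfa by (simp add: zfa_model_def)
  then obtain x where x: "x \<in> UM" "\<exists>z\<in>UM. is_zero M z \<and> mem M z x"
    "\<forall>y\<in>UM. mem M y x \<longrightarrow> (\<exists>s\<in>UM. is_succ M y s \<and> mem M s x)"
    unfolding ax_infinity_def by blast
  have z: "zero \<in> E x" using x(2) by (auto simp: self.c_zero self.mem_N)
  have s: "succ y \<in> E x" if "y \<in> E x" for y
    using bspec[OF x(3), of y] that E_U[OF that] by (auto simp: self.c_succ self.mem_N)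
  have "n \<in> E x" if "n \<in> Om" for n
    using that
  proof (induction n rule: Om_induct)
    case D show ?case by (intro def_intros x)
  qed (use z s in auto)
  then have "Om = {n\<in>E x. n \<in> Om}" by blast
  moreover have "small {n\<in>E x. n \<in> Om}" by (rule small_sep) (simp add: x, intro def_intros)
  ultimately show ?thesis by simp
qed

definition om :: 'm where "om = mk Om"
lemma om_U [simp]: "om \<in> UM" by (simp add: om_def)
lemma E_om: "E om = Om" by (simp add: om_def E_mk small_Om)
lemma om_iset: "iset om" by (simp add: om_def mk)
lemma Om_sub_U: "Om \<subseteq> UM" by (auto simp: Om_def)

lemma Ord_om: "Ord om"
  unfolding Ord_def E_om using om_iset Om_elem Om_Ord Ord_iset Ord_tri by blast

section \<open>Countability, pairing and countable unions\<close>

definition cnt :: "'m set \<Rightarrow> bool" where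
  "cnt S \<longleftrightarrow> small S \<and> (\<exists>f\<in>UM. func f S Om \<and> inj_on (app f) S)"

lemma D_inj [def_intros]: assumes "T f" "T x" shows "D (\<lambda>e. inj_on (app (f e)) (E (x e)))"
  unfolding inj_on_def by (intro def_intros assms T_shift[OF assms(1)] T_shift[OF assms(2)] T_shift[OF T_shift[OF assms(1)]])
lemma D_cnt [def_intros]: assumes "T x" shows "D (\<lambda>e. cnt (E (x e)))"
proof (rule D_cong)
  show "cnt (E (x e)) = (\<exists>f\<in>UM. func f (E (x e)) (E om) \<and> inj_on (app f) (E (x e)))" if "range e \<subseteq> UM" for e
    using T_U[OF assms that] by (simp add: cnt_def E_om)
  show "D (\<lambda>e. \<exists>f\<in>UM. func f (E (x e)) (E om) \<and> inj_on (app f) (E (x e)))"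
    by (intro def_intros T_shift assms om_U)
qed

lemma cntI: assumes "small S" "T (\<lambda>e. t (e 0))" "\<And>x. x \<in> S \<Longrightarrow> t x \<in> Om" "inj_on t S" shows "cnt S"
  unfolding cnt_def
proof (intro conjI bexI assms(1))
  show "func (graph t S) S Om" by (rule graph(3)[OF assms(1,2)]) (use assms Om_sub_U in auto)
  show "inj_on (app (graph t S)) S" using assms(4) by (rule inj_on_cong[THEN iffD1, rotated]) (simp add: graph(4)[OF assms(1,2)])
qed simp
lemma cnt_small: "cnt S \<Longrightarrow> small S" by (simp add: cnt_def)
lemma cntE: assumes "cnt S" obtains f where "f \<in> UM" "func f S Om" "inj_on (app f) S" "\<And>x. x \<in> S \<Longrightarrow> app f x \<in> Om"
  using assms func_in[OF _ small_U[OF cnt_small[OF assms]] Om_sub_U] unfolding cnt_def by blast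
lemma cnt_inj: assumes "small S" "T (\<lambda>e. t (e 0))" "\<And>x. x \<in> S \<Longrightarrow> t x \<in> R" "inj_on t S" "cnt R" shows "cnt S"
proof -
  obtain f where f: "f \<in> UM" "inj_on (app f) R" "\<And>x. x \<in> R \<Longrightarrow> app f x \<in> Om" using cntE[OF assms(5)] by metis
  show ?thesis
  proof (rule cntI[OF assms(1), of "\<lambda>x. app f (t x)"])
    show "T (\<lambda>e. app f (t (e 0)))" by (intro def_intros f assms)
    show "inj_on (\<lambda>x. app f (t x)) S" using assms(3,4) f(2) by (auto simp: inj_on_def)
  qed (use f assms in auto)
qed
lemma cnt_subset: "small S \<Longrightarrow> S \<subseteq> R \<Longrightarrow> cnt R \<Longrightarrow> cnt S"
  by (rule cnt_inj[of S "\<lambda>x. x" R]) (auto intro: T_var)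

lemma c_countable: assumes "x \<in> UM" shows "countable_set M x \<longleftrightarrow> cnt (E x)"
proof -
  have o: "is_omega M w \<longleftrightarrow> w = om" if "w \<in> UM" for w
  proof -
    have "is_omega M w \<longleftrightarrow> iset w \<and> (\<forall>x\<in>UM. mem M x w \<longleftrightarrow> x \<in> Om)"
      using that by (simp add: is_omega_def self.c_nat Natl_Om)
    also have "(\<forall>x\<in>UM. mem M x w \<longleftrightarrow> x \<in> Om) \<longleftrightarrow> E w = {x. x \<in> Om}"
      using that Om_U by (intro self.set_iff_N)
    also have "iset w \<and> E w = {x. x \<in> Om} \<longleftrightarrow> w = om"
      using set_eqI[of w om] om_iset E_om by auto
    finally show ?thesis .
  qed
  have "countable_set M x \<longleftrightarrow> card_le M x om" unfolding countable_set_def using o om_U by blast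
  also have "\<dots> \<longleftrightarrow> (\<exists>f\<in>UM. func f (E x) Om \<and> inj_on (app f) (E x))"
    using assms by (simp add: card_le_def self.c_inj E_om)
  finally show ?thesis using assms by (simp add: cnt_def)
qed

text \<open>
  The least relation on \<open>\<omega> \<times> X\<close> that contains \<open>(0, x0)\<close> and is closed under \<open>(n, x) \<mapsto> (n + 1, h x)\<close> is
  the graph of \<open>n \<mapsto> h\<^sup>n(x0)\<close>.
\<close>

lemma gen_cnt:
  assumes X: "small X" "x0 \<in> X" "\<And>x. x \<in> X \<Longrightarrow> h x \<in> X" and h: "T (\<lambda>e. h (e 0))"
    and gen: "\<And>C. small C \<Longrightarrow> C \<subseteq> X \<Longrightarrow> x0 \<in> C \<Longrightarrow> (\<And>x. x \<in> C \<Longrightarrow> h x \<in> C) \<Longrightarrow> X \<subseteq> C"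
  shows "cnt X"
proof -
  have XU: "X \<subseteq> UM" using X(1) small_U by auto
  define closed where "closed C \<longleftrightarrow> opair zero x0 \<in> C \<and> (\<forall>n\<in>Om. \<forall>x\<in>X. opair n x \<in> C \<longrightarrow> opair (succ n) (h x) \<in> C)" for C
  have clE: "closed (E C) \<longleftrightarrow> opair zero x0 \<in> E C \<and> (\<forall>n\<in>E om. \<forall>x\<in>E (mk X). opair n x \<in> E C \<longrightarrow> opair (succ n) (h x) \<in> E C)" for C
    unfolding closed_def by (simp add: E_om E_mk[OF X(1)])
  have x0: "x0 \<in> UM" using X XU by auto
  define R where "R = {p\<in>times Om X. \<forall>C\<in>UM. closed (E C) \<longrightarrow> p \<in> E C}"
  have sR: "small R" unfolding R_def clE
    by (rule small_sep[OF small_times[OF small_Om X(1)]])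
      (intro def_intros x0 zero_U om_U mk_U T_sub[OF h])
  have RU: "R \<subseteq> UM" using sR small_U by auto
  have p: "opair n x \<in> times Om X" if "n \<in> Om" "x \<in> X" for n x using that by (auto simp: times_def)
  have clR: "closed R" unfolding closed_def R_def using p Om_zero X Om_succ unfolding closed_def by blast
  have minR: "R \<subseteq> C" if "small C" "closed C" for C
  proof
    fix p assume "p \<in> R"
    then have "closed (E (mk C)) \<longrightarrow> p \<in> E (mk C)" unfolding R_def using mk_U by blast
    then show "p \<in> C" using that by (simp add: E_mk)
  qed
  have R_dom: "n \<in> Om \<and> x \<in> X" if "opair n x \<in> R" "n \<in> UM" "x \<in> UM" for n x
    using that Om_sub_U XU by (auto simp: R_def times_mem)
  have R0: "opair zero x0 \<in> R" and Rs: "\<And>n x. n \<in> Om \<Longrightarrow> x \<in> X \<Longrightarrow> opair n x \<in> R \<Longrightarrow> opair (succ n) (h x) \<in> R"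
    using clR unfolding closed_def by blast+
  have del: "small (R - {q})" if "q \<in> UM" for q
    by (rule small_subset[OF sR, of "\<lambda>x. x \<noteq> q"]) (intro def_intros that, auto)
  have inj: "opair n x = opair m y \<longleftrightarrow> n = m \<and> x = y" if "n \<in> Om" "x \<in> X" "m \<in> Om" "y \<in> X" for n x m y
    using that Om_U XU by (intro opair_inj) auto
  have sinj: "succ n = succ m \<Longrightarrow> n = m" if "n \<in> Om" "m \<in> Om" for n m
    using succ_inj Om_U that by blast
  have snz: "succ n \<noteq> zero" if "n \<in> Om" for n using E_succ[OF Om_U[OF that]] zero by auto
  have uniq: "\<forall>x\<in>X. \<forall>y\<in>X. opair n x \<in> R \<longrightarrow> opair n y \<in> R \<longrightarrow> x = y" if "n \<in> Om" for n
    using that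
  proof (induction n rule: Om_induct)
    case D
    have "D (\<lambda>e. \<forall>x\<in>E (mk X). \<forall>y\<in>E (mk X). opair (e 0) x \<in> E (mk R) \<longrightarrow> opair (e 0) y \<in> E (mk R) \<longrightarrow> x = y)"
      by (intro def_intros mk_U)
    then show ?case by (simp add: E_mk sR X(1))
  next
    case zero
    \<comment> \<open>A second value at \<open>zero\<close> could be deleted without destroying
      closedness, against the minimality of \<open>R\<close>.\<close>
    have "x = x0" if x: "x \<in> X" "opair zero x \<in> R" for x
    proof (rule ccontr)
      assume ne: "x \<noteq> x0"
      have "closed (R - {opair zero x})" unfolding closed_def
        using R0 Rs ne inj[OF Om_zero x(1) Om_zero X(2)] inj[OF Om_succ _ Om_zero x(1)] snz X(3) by auto
      from minR[OF del this] x show False by auto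
    qed
    then show ?case by blast
  next
    case (succ n)
    have "\<exists>z. \<forall>x\<in>X. opair n x \<in> R \<longrightarrow> x = z" using succ(2) by blast
    then obtain z where z: "\<And>x. x \<in> X \<Longrightarrow> opair n x \<in> R \<Longrightarrow> x = z" by blast
    \<comment> \<open>Again by deletion: closure forces a pair with first entry
      \<open>succ n\<close> only from the single pair \<open>(n, z)\<close>, so only
      \<open>h z\<close> is forced.\<close>
    have "x = h z" if x: "x \<in> X" "opair (succ n) x \<in> R" for x
    proof (rule ccontr)
      assume ne: "x \<noteq> h z"
      have "closed (R - {opair (succ n) x})" unfolding closed_def
      proof (intro conjI ballI impI)
        show "opair zero x0 \<in> R - {opair (succ n) x}"
          using R0 snz[OF succ(1)] inj[OF Om_succ[OF succ(1)] x(1) Om_zero X(2)] by auto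
        fix m y assume m: "m \<in> Om" "y \<in> X" "opair m y \<in> R - {opair (succ n) x}"
        have "opair (succ m) (h y) \<noteq> opair (succ n) x"
        proof
          assume "opair (succ m) (h y) = opair (succ n) x"
          then have "succ m = succ n" "h y = x" using inj[OF Om_succ[OF m(1)] X(3)[OF m(2)] Om_succ[OF succ(1)] x(1)] by auto
          then show False using sinj[OF m(1) succ(1)] z[OF m(2)] m(3) ne by auto
        qed
        then show "opair (succ m) (h y) \<in> R - {opair (succ n) x}" using Rs m by auto
      qed
      from minR[OF del this] x show False by auto
    qed
    then show ?case by blast
  qed
  define C where "C = {x\<in>X. \<exists>n\<in>E om. opair n x \<in> E (mk R)}"
  have sC: "small C" unfolding C_def by (rule small_sep[OF X(1)]) (intro def_intros om_U mk_U)
  have C: "x \<in> C \<longleftrightarrow> x \<in> X \<and> (\<exists>n\<in>Om. opair n x \<in> R)" for x by (simp add: C_def E_om E_mk sR)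
  have "X \<subseteq> C"
  proof (rule gen[OF sC])
    show "x0 \<in> C" using C X R0 Om_zero by blast
    show "h x \<in> C" if "x \<in> C" for x using that C X(3) Rs Om_succ by blast
  qed (auto simp: C)
  \<comment> \<open>An element may be reached at several stages; its least index gives the injection
    into \<open>\<omega>\<close>.\<close>
  define S where "S x = {n\<in>E om. opair n x \<in> E (mk R)}" for x
  have S: "n \<in> S x \<longleftrightarrow> n \<in> Om \<and> opair n x \<in> R" for n x by (simp add: S_def E_om E_mk sR)
  have sS: "small (S x)" if "x \<in> UM" for x unfolding S_def by (rule small_sep) (simp, intro def_intros mk_U that)
  have L: "least_elt (S x) \<in> S x" if "x \<in> X" for x
  proof (rule least_elt(1)[OF sS])
    show "x \<in> UM" using that XU by blast
    have "x \<in> C" using that \<open>X \<subseteq> C\<close> by blast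
    then show "S x \<noteq> {}" using C S by blast
    show "Ord n" if "n \<in> S x" for n using that S Om_Ord by blast
  qed
  show ?thesis
  proof (rule cntI[OF X(1), of "\<lambda>x. least_elt (S x)"])
    have "D (\<lambda>e. e 0 \<in> S (e (Suc 0)))" unfolding S_def mem_Collect_eq by (intro def_intros om_U mk_U)
    then show "T (\<lambda>e. least_elt (S (e 0)))" unfolding least_elt_def
      by (intro def_intros) (use D_sub[of "\<lambda>e. e 0 \<in> S (e (Suc 0))" "case_nat 0 (\<lambda>i. Suc (Suc i))"] in simp_all)
    show "least_elt (S x) \<in> Om" if "x \<in> X" for x using L[OF that] S by auto
    show "inj_on (\<lambda>x. least_elt (S x)) X"
    proof (rule inj_onI)
      fix x y assume xy: "x \<in> X" "y \<in> X" "least_elt (S x) = least_elt (S y)"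
      then have "least_elt (S x) \<in> Om" "opair (least_elt (S x)) x \<in> R" "opair (least_elt (S x)) y \<in> R" using L[of x] L[of y] S by auto
      then show "x = y" using uniq[of "least_elt (S x)"] xy by blast
    qed
  qed
qed

definition pfst :: "'m \<Rightarrow> 'm" where "pfst q = theU (\<lambda>x. \<exists>y\<in>UM. q = opair x y)"
definition psnd :: "'m \<Rightarrow> 'm" where "psnd q = theU (\<lambda>y. \<exists>x\<in>UM. q = opair x y)"
lemma T_pfst [def_intros]: "T t \<Longrightarrow> T (\<lambda>e. pfst (t e))"
  unfolding pfst_def by (intro def_intros; (intro T_shift)?; assumption)
lemma T_psnd [def_intros]: "T t \<Longrightarrow> T (\<lambda>e. psnd (t e))"
  unfolding psnd_def by (intro def_intros; (intro T_shift)?; assumption)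
lemma pfst: "x \<in> UM \<Longrightarrow> y \<in> UM \<Longrightarrow> pfst (opair x y) = x"
  unfolding pfst_def by (rule theU_I) (auto simp: opair_inj)
lemma psnd: "x \<in> UM \<Longrightarrow> y \<in> UM \<Longrightarrow> psnd (opair x y) = y"
  unfolding psnd_def by (rule theU_I) (auto simp: opair_inj)

text \<open>The enumeration runs through the shells \<open>max i j = n\<close>, each in the order
  \<open>(0,n), \<dots>, (n,n), (n,0), \<dots>, (n,n-1)\<close>.\<close>

lemma cnt_times_Om: "cnt (times Om Om)"
proof -
  \<comment> \<open>The shell of 0 is the single point \<open>(0,0)\<close> and is left directly for
    \<open>(0,1)\<close>; a shell \<open>n > 0\<close> ends at \<open>(n,n-1)\<close>, which is
    followed by \<open>(0,n+1)\<close>.\<close>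
  define h where "h q = (if pfst q \<in> E (psnd q) then opair (succ (pfst q)) (psnd q)
    else if pfst q = psnd q then (if pfst q = zero then opair zero (succ zero) else opair (pfst q) zero)
    else if succ (psnd q) = pfst q then opair zero (succ (pfst q)) else opair (pfst q) (succ (psnd q)))" for q
  have h: "h (opair i j) = (if i \<in> E j then opair (succ i) j
    else if i = j then (if i = zero then opair zero (succ zero) else opair i zero)
    else if succ j = i then opair zero (succ i) else opair i (succ j))" if "i \<in> Om" "j \<in> Om" for i j
    using that Om_U by (simp add: h_def pfst psnd)
  have pr: "opair i j \<in> times Om Om" if "i \<in> Om" "j \<in> Om" for i j using that by (auto simp: times_def)
  show ?thesis
  proof (rule gen_cnt[where h = h and ?x0.0 = "opair zero zero"])
    show "small (times Om Om)" by (intro small_times small_Om)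
    show "opair zero zero \<in> times Om Om" using pr Om_zero by auto
    show "T (\<lambda>e. h (e 0))" unfolding h_def by (intro def_intros zero_U succ_U opair_U)
    show "h q \<in> times Om Om" if q: "q \<in> times Om Om" for q
    proof -
      from q obtain i j where "i \<in> Om" "j \<in> Om" "q = opair i j" by (rule timesE)
      then show ?thesis using pr Om_zero Om_succ by (simp add: h)
    qed
    fix C assume sC: "small C" and c0: "opair zero zero \<in> C" and ch: "\<And>x. x \<in> C \<Longrightarrow> h x \<in> C"
    have up1: "opair i n \<in> C" if n: "n \<in> Om" "opair zero n \<in> C" and i: "i \<in> Om" "i \<in> E n \<or> i = n" for i n
    proof -
      have "i \<in> E n \<or> i = n \<longrightarrow> opair i n \<in> C" using i(1)
      proof (induction i rule: Om_induct)
        case D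
        have "D (\<lambda>e. e 0 \<in> E n \<or> e 0 = n \<longrightarrow> opair (e 0) n \<in> E (mk C))" by (intro def_intros mk_U Om_U n)
        then show ?case by (simp add: E_mk[OF sC])
      next
        case zero show ?case using n by simp
      next
        case (succ i)
        show ?case
        proof
          assume "succ i \<in> E n \<or> succ i = n"
          then have "i \<in> E n" using Ord_sub[OF Om_Ord[OF n(1)], of "succ i"] E_succ[OF Om_U[OF succ(1)]] by auto
          then show "opair (succ i) n \<in> C" using ch[of "opair i n"] succ by (simp add: h n)
        qed
      qed
      then show ?thesis using i(2) by simp
    qed
    have up2: "opair n j \<in> C" if n: "n \<in> Om" "opair zero n \<in> C" and j: "j \<in> Om" "j \<in> E n" for j n
    proof -
      have "j \<in> E n \<longrightarrow> opair n j \<in> C" using j(1)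
      proof (induction j rule: Om_induct)
        case D
        have "D (\<lambda>e. e 0 \<in> E n \<longrightarrow> opair n (e 0) \<in> E (mk C))" by (intro def_intros mk_U Om_U n)
        then show ?case by (simp add: E_mk[OF sC])
      next
        case zero
        show ?case
        proof
          assume "zero \<in> E n"
          then have "n \<noteq> zero" by (auto simp: E_zero)
          then show "opair n zero \<in> C" using ch[OF up1[OF n n(1)]] no_loop[OF Om_U[OF n(1)]] by (simp add: h n)
        qed
      next
        case (succ j)
        show ?case
        proof
          assume s: "succ j \<in> E n"
          then have "j \<in> E n" using Ord_sub[OF Om_Ord[OF n(1)], of "succ j"] E_succ[OF Om_U[OF succ(1)]] by auto
          moreover have "n \<notin> E j" "n \<noteq> j" "succ j \<noteq> n" using \<open>j \<in> E n\<close> no_loop2[of j n] no_loop[OF Om_U[OF n(1)]] s by auto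
          ultimately show "opair n (succ j) \<in> C" using ch[of "opair n j"] succ by (simp add: h n)
        qed
      qed
      then show ?thesis using j(2) by simp
    qed
    \<comment> \<open>\<open>up1\<close> and \<open>up2\<close> sweep a shell from its starting
      point, and its last point leads to the start of the next shell.\<close>
    have base: "opair zero n \<in> C" if "n \<in> Om" for n
      using that
    proof (induction n rule: Om_induct)
      case D
      have "D (\<lambda>e. opair zero (e 0) \<in> E (mk C))" by (intro def_intros mk_U zero_U)
      then show ?case by (simp add: E_mk[OF sC])
    next
      case zero show ?case by (rule c0)
    next
      case (succ n)
      show ?case using succ(1)
      proof (cases rule: Om_cases)
        case 1
        then show ?thesis using ch[OF c0] by (simp add: h Om_zero E_zero)
      next
        case (2 k)
        then have k: "k \<in> E n" using E_succ[OF Om_U] by auto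
        then have "n \<notin> E k" "n \<noteq> k" using no_loop2[of k n] no_loop[OF Om_U[OF succ(1)]] by auto
        then show ?thesis using ch[OF up2[OF succ(1,2) 2(1) k]] 2 by (simp add: h Om_succ)
      qed
    qed
    show "times Om Om \<subseteq> C"
    proof
      fix q assume "q \<in> times Om Om"
      then obtain i j where q: "i \<in> Om" "j \<in> Om" "q = opair i j" by (auto simp: times_def)
      then show "q \<in> C" using Ord_tri[OF Om_Ord Om_Ord, OF q(1,2)] up1[OF q(2) base[OF q(2)] q(1)] up2[OF q(1) base[OF q(1)] q(2)] by auto
    qed
  qed
qed

lemma cnt_times: assumes "cnt X" "cnt Y" shows "cnt (times X Y)"
proof -
  obtain f where f: "f \<in> UM" "inj_on (app f) X" "\<And>x. x \<in> X \<Longrightarrow> app f x \<in> Om" using cntE[OF assms(1)] by metis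
  obtain g where g: "g \<in> UM" "inj_on (app g) Y" "\<And>x. x \<in> Y \<Longrightarrow> app g x \<in> Om" using cntE[OF assms(2)] by metis
  have U: "X \<subseteq> UM" "Y \<subseteq> UM" using assms cnt_small small_U by auto
  show ?thesis
  proof (rule cnt_inj[OF _ _ _ _ cnt_times_Om, of _ "\<lambda>q. opair (app f (pfst q)) (app g (psnd q))"])
    show "small (times X Y)" using assms cnt_small small_times by auto
    show "T (\<lambda>e. opair (app f (pfst (e 0))) (app g (psnd (e 0))))" by (intro def_intros f g)
    show "opair (app f (pfst q)) (app g (psnd q)) \<in> times Om Om" if q: "q \<in> times X Y" for q
    proof -
      from q obtain x y where "x \<in> X" "y \<in> Y" "q = opair x y" by (rule timesE)
      then show ?thesis using U f(3) g(3) by (auto simp: pfst psnd subset_iff intro!: timesI)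
    qed
    show "inj_on (\<lambda>q. opair (app f (pfst q)) (app g (psnd q))) (times X Y)"
    proof (rule inj_onI)
      fix q r assume "q \<in> times X Y" "r \<in> times X Y" and eq: "opair (app f (pfst q)) (app g (psnd q)) = opair (app f (pfst r)) (app g (psnd r))"
      then obtain x y x' y' where *: "x \<in> X" "y \<in> Y" "q = opair x y" "x' \<in> X" "y' \<in> Y" "r = opair x' y'" by (auto simp: times_def)
      then have "opair (app f x) (app g y) = opair (app f x') (app g y')" using eq U by (simp add: pfst psnd subset_iff)
      then have "app f x = app f x'" "app g y = app g y'" by (simp_all add: opair_inj)
      then show "q = r" using * f(2) g(2) by (auto simp: inj_on_def)
    qed
  qed
qed

text \<open>The codes of \<open>S\<close> are shifted by one to free \<open>zero\<close> for the new
  element.\<close>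

lemma cnt_insert: assumes "cnt S" "x \<in> UM" shows "cnt (insert x S)"
proof -
  obtain f where f: "f \<in> UM" "inj_on (app f) S" "\<And>x. x \<in> S \<Longrightarrow> app f x \<in> Om" using cntE[OF assms(1)] by metis
  show ?thesis
  proof (rule cntI[of _ "\<lambda>y. if y = x then zero else succ (app f y)"])
    show "small (insert x S)" using assms cnt_small small_insert by auto
    show "T (\<lambda>e. if e 0 = x then zero else succ (app f (e 0)))" by (intro def_intros f assms zero_U)
    show "(if y = x then zero else succ (app f y)) \<in> Om" if "y \<in> insert x S" for y
      using that f Om_zero Om_succ by auto
    have snz: "succ n \<noteq> zero" if "n \<in> Om" for n using E_succ[OF Om_U[OF that]] zero by auto
    have sinj: "succ n = succ m \<Longrightarrow> n = m" if "n \<in> Om" "m \<in> Om" for n m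
      using succ_inj Om_U that by blast
    show "inj_on (\<lambda>y. if y = x then zero else succ (app f y)) (insert x S)"
    proof (rule inj_onI)
      fix y z assume a: "y \<in> insert x S" "z \<in> insert x S" "(if y = x then zero else succ (app f y)) = (if z = x then zero else succ (app f z))"
      show "y = z"
      proof (cases "y = x \<or> z = x")
        case True
        then show ?thesis using a f(3) snz by (metis insertE)
      next
        case False
        then have "y \<in> S" "z \<in> S" "app f y = app f z" using a sinj[OF f(3) f(3)] by auto
        then show ?thesis using f(2) by (auto simp: inj_on_def)
      qed
    qed
  qed
qed

text \<open>Induction is internal, as \<open>n\<close> may be nonstandard. An injection of
  \<open>n\<close> cannot be onto \<open>s\<close>, for its inverse would count \<open>s\<close>; a
  missed point becomes the value at the new argument.\<close>

lemma uncountable_inj: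
  assumes s: "s \<in> UM" "\<not> cnt (E s)" and "n \<in> Om" shows "\<exists>f\<in>UM. func f (E n) (E s) \<and> inj_on (app f) (E n)"
  using assms(3)
proof (induction n rule: Om_induct)
  case D show ?case by (intro def_intros s)
next
  case zero
  have "func (graph (\<lambda>x. x) {}) {} (E s)" by (rule graph(3)) (auto intro: T_var simp: E_subset_U)
  then show ?case by (intro bexI[of _ "graph (\<lambda>x. x) {}"]) (simp_all add: E_zero)
next
  case (succ n)
  from succ(2) obtain f where f: "f \<in> UM" "func f (E n) (E s)" "inj_on (app f) (E n)" by blast
  have nU: "n \<in> UM" using Om_U succ(1) by simp
  have "\<exists>y\<in>E s. y \<notin> app f ` E n"
  proof (rule ccontr)
    assume "\<not> (\<exists>y\<in>E s. y \<notin> app f ` E n)"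
    then have sur: "E s \<subseteq> app f ` E n" by blast
    define t where "t y = theU (\<lambda>x. x \<in> E n \<and> app f x = y)" for y
    have t: "t (app f x) = x" if "x \<in> E n" for x unfolding t_def
      by (rule theU_I) (use that f(3) E_U in \<open>auto simp: inj_on_def\<close>)
    have "cnt (E s)"
    proof (rule cntI[of _ t])
      show "T (\<lambda>e. t (e 0))" unfolding t_def by (intro def_intros f nU)
      show "t y \<in> Om" if "y \<in> E s" for y using that sur t Om_elem[OF succ(1)] by auto
      show "inj_on t (E s)"
      proof (rule inj_onI)
        fix y z assume "y \<in> E s" "z \<in> E s" "t y = t z"
        then obtain u v where "u \<in> E n" "v \<in> E n" "y = app f u" "z = app f v" using sur by blast
        then show "y = z" using \<open>t y = t z\<close> t by simp
      qed
    qed (simp add: s)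
    then show False using s by simp
  qed
  then obtain y where y: "y \<in> E s" "y \<notin> app f ` E n" by blast
  define t where "t x = (if x = n then y else app f x)" for x
  have T: "T (\<lambda>e. t (e 0))" unfolding t_def by (intro def_intros f nU E_U[OF y(1)])
  have sm: "small (E (succ n))" by simp
  have nn: "n \<notin> E n" using no_loop nU by auto
  show ?case
  proof (intro bexI[of _ "graph t (E (succ n))"] conjI)
    show "func (graph t (E (succ n))) (E (succ n)) (E s)"
      by (rule graph(3)[OF sm T]) (use y func_in[OF f(2) E_subset_U E_subset_U] E_subset_U in \<open>auto simp: t_def E_succ nU\<close>)
    have "inj_on t (E (succ n))" unfolding E_succ[OF nU]
    proof (rule inj_onI)
      fix a b assume "a \<in> insert n (E n)" "b \<in> insert n (E n)" "t a = t b"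
      then show "a = b" using y nn f(3) by (auto simp: t_def inj_on_def split: if_splits)
    qed
    then show "inj_on (app (graph t (E (succ n)))) (E (succ n))"
      by (rule inj_on_cong[THEN iffD1, rotated]) (simp add: graph(4)[OF sm T])
  qed simp
qed

text \<open>Choice picks an injection into \<open>\<omega>\<close> for every member of the family.
  Disjointness makes the member containing \<open>a\<close> definable from \<open>a\<close>, and the
  code of that member together with the code of \<open>a\<close> in it determines
  \<open>a\<close>.\<close>

lemma cnt_Union:
  assumes AC: "axiom_of_choice M" and P: "P \<in> UM" "cnt (E P)" "\<And>p. p \<in> E P \<Longrightarrow> cnt (E p)"
    and disj: "\<And>p q a. p \<in> E P \<Longrightarrow> q \<in> E P \<Longrightarrow> a \<in> E p \<Longrightarrow> a \<in> E q \<Longrightarrow> p = q"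
  shows "cnt (\<Union>p\<in>E P. E p)"
proof -
  let ?A = "\<Union>p\<in>E P. E p"
  have sA: "small ?A" using P by (intro small_Union) simp
  define B where "B = mk {y. iset y \<and> E y \<subseteq> times ?A Om}"
  have B: "E B = {y. iset y \<and> E y \<subseteq> times ?A Om}" unfolding B_def
    by (intro E_mk small_Pow small_times sA small_Om)
  have BU: "B \<in> UM" by (simp add: B_def)
  \<comment> \<open>The injections of \<open>p\<close> into \<open>\<omega>\<close>, taken inside
    the fixed power set \<open>B\<close> so that they form a set; the choice function is applied to
    these sets.\<close>
  define J where "J p = mk {f\<in>E B. func f (E p) (E om) \<and> inj_on (app f) (E p)}" for p
  have TJ: "T (\<lambda>e. J (e 0))" unfolding J_def by (intro def_intros BU om_U)
  have EJ: "E (J p) = {f\<in>E B. func f (E p) Om \<and> inj_on (app f) (E p)}" if "p \<in> UM" for p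
    unfolding J_def E_om[symmetric] by (rule E_mk, rule small_sep) (simp add: BU, intro def_intros om_U that)
  have Jne: "E (J p) \<noteq> {}" if p: "p \<in> E P" for p
  proof -
    obtain f where f: "f \<in> UM" "func f (E p) Om" "inj_on (app f) (E p)" using cntE[OF P(3)[OF p]] by metis
    have "times (E p) Om \<subseteq> times ?A Om" using p by (auto simp: times_def)
    then have "f \<in> E B" using f(2) unfolding B by (auto simp: func_def)
    then show ?thesis using f EJ[OF E_U[OF p]] by blast
  qed
  define X where "X = mk (J ` E P)"
  have EX: "E X = J ` E P" unfolding X_def by (intro E_mk small_image TJ) (simp add: P)
  have XU: "X \<in> UM" by (simp add: X_def)
  have "\<forall>x\<in>UM. mem M x X \<longrightarrow> nonempty M x" using Jne by (auto simp: self.mem_N EX self.c_nonempty)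
  then obtain c where c: "c \<in> UM" "is_choice M c X" using AC XU unfolding axiom_of_choice_def by blast
  then obtain Y where Y: "Y \<in> UM" "func c (E X) (E Y)" unfolding is_choice_def using self.c_fun XU by blast
  have cJ: "app c (J p) \<in> E (J p)" if p: "p \<in> E P" for p
  proof -
    have "opair (J p) (app c (J p)) \<in> E c" using func_app[OF Y(2), of "J p"] EX p by blast
    moreover have "J p \<in> UM" by (simp add: J_def)
    ultimately have "rel M c (J p) (app c (J p))" using c(1) by (simp add: self.c_rel)
    then have "mem M (app c (J p)) (J p)" using c(2) \<open>J p \<in> UM\<close> app_U unfolding is_choice_def by blast
    then show ?thesis by (simp add: self.mem_N)
  qed
  define j where "j p = app c (J p)" for p
  have j: "func (j p) (E p) Om" "inj_on (app (j p)) (E p)" if p: "p \<in> E P" for p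
    using cJ[OF p] EJ[OF E_U[OF p]] unfolding j_def by auto
  obtain i where i: "i \<in> UM" "inj_on (app i) (E P)" "\<And>x. x \<in> E P \<Longrightarrow> app i x \<in> Om" using cntE[OF P(2)] by metis
  define b where "b a = theU (\<lambda>p. p \<in> E P \<and> a \<in> E p)" for a
  have b: "b a \<in> E P" "a \<in> E (b a)" if a: "a \<in> ?A" for a
  proof -
    obtain p where p: "p \<in> E P" "a \<in> E p" using a by blast
    have "b a = p" unfolding b_def by (rule theU_I) (use p disj E_U in auto)
    then show "b a \<in> E P" "a \<in> E (b a)" using p by auto
  qed
  show ?thesis
  proof (rule cnt_inj[OF sA _ _ _ cnt_times_Om, of "\<lambda>a. opair (app i (b a)) (app (j (b a)) a)"])
    show "T (\<lambda>e. opair (app i (b (e 0))) (app (j (b (e 0))) (e 0)))"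
      unfolding j_def b_def J_def by (intro def_intros i P c BU om_U)
    show "opair (app i (b a)) (app (j (b a)) a) \<in> times Om Om" if "a \<in> ?A" for a
      using b[OF that] i(3) func_in[OF j(1) E_subset_U Om_sub_U] by (intro timesI) auto
    show "inj_on (\<lambda>a. opair (app i (b a)) (app (j (b a)) a)) ?A"
    proof (rule inj_onI)
      fix a a' assume a: "a \<in> ?A" "a' \<in> ?A" "opair (app i (b a)) (app (j (b a)) a) = opair (app i (b a')) (app (j (b a')) a')"
      then have e: "app i (b a) = app i (b a')" "app (j (b a)) a = app (j (b a')) a'" by (simp_all add: opair_inj)
      then have "b a = b a'" using i(2) b(1)[OF a(1)] b(1)[OF a(2)] by (auto simp: inj_on_def)
      then show "a = a'" using e(2) j(2)[OF b(1)[OF a(1)]] b(2)[OF a(1)] b(2)[OF a(2)] by (auto simp: inj_on_def)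
    qed
  qed
qed

section \<open>The ordinal \<open>\<omega>\<^sub>1\<close>\<close>

text \<open>
  A countable ordinal is determined by the relation on \<open>\<omega>\<close> to which some injection carries its
  reflexive membership relation. Replacement along this partial map from relations to ordinals
  collects all countable ordinals in a set. Reflexivity makes the range of the injection the field of the relation.
\<close>

definition codes :: "'m \<Rightarrow> 'm \<Rightarrow> 'm \<Rightarrow> bool" where
  "codes R f a \<longleftrightarrow> func f (E a) (E om) \<and> inj_on (app f) (E a) \<and>
    (\<forall>p\<in>UM. p \<in> E R \<longleftrightarrow> (\<exists>x\<in>E a. \<exists>y\<in>E a. (x \<in> E y \<or> x = y) \<and> p = opair (app f x) (app f y)))"

lemma codes_iff: assumes "codes R f a" "x \<in> E a" "y \<in> E a"
  shows "opair (app f x) (app f y) \<in> E R \<longleftrightarrow> x \<in> E y \<or> x = y"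
proof -
  have i: "app f x = app f u \<Longrightarrow> x = u" "app f y = app f u \<Longrightarrow> y = u" if "u \<in> E a" for u
    using assms that unfolding codes_def inj_on_def by blast+
  have "opair (app f x) (app f y) \<in> E R \<longleftrightarrow>
    (\<exists>u\<in>E a. \<exists>v\<in>E a. (u \<in> E v \<or> u = v) \<and> opair (app f x) (app f y) = opair (app f u) (app f v))"
    using assms(1) unfolding codes_def by simp
  also have "\<dots> \<longleftrightarrow> x \<in> E y \<or> x = y" using i assms(2,3) by (simp add: opair_inj) blast
  finally show ?thesis .
qed

lemma codes_field: assumes "codes R f a" "opair u v \<in> E R" "u \<in> UM" "v \<in> UM"
  obtains x y where "x \<in> E a" "y \<in> E a" "x \<in> E y \<or> x = y" "u = app f x" "v = app f y"
proof -
  have "\<exists>x\<in>E a. \<exists>y\<in>E a. (x \<in> E y \<or> x = y) \<and> opair u v = opair (app f x) (app f y)"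
    using assms unfolding codes_def by simp
  then show ?thesis using that assms by (auto simp: opair_inj)
qed

text \<open>Membership induction on \<open>x\<close>: through the common relation the elements of
  \<open>x\<close> and of \<open>x'\<close> carry the same codes, so they coincide by induction.
  Injectivity excludes the reflexive pairs.\<close>

lemma codes_agree:
  assumes a: "Ord a" "codes R f a" "f \<in> UM" and b: "Ord b" "codes R f' b" "f' \<in> UM"
    and x: "x \<in> E a" "x' \<in> E b" "app f x = app f' x'"
  shows "x = x'"
proof -
  have U: "a \<in> UM" "b \<in> UM" using a b Ord_U by auto
  have fi: "u = v" if "u \<in> E a" "v \<in> E a" "app f u = app f v" for u v using a(2) that unfolding codes_def inj_on_def by blast
  have fi': "u = v" if "u \<in> E b" "v \<in> E b" "app f' u = app f' v" for u v using b(2) that unfolding codes_def inj_on_def by blast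
  have "x \<in> W" using Ord_W Ord_elem a x by blast
  then have "\<forall>x'\<in>E b. x \<in> E a \<longrightarrow> app f x = app f' x' \<longrightarrow> x = x'"
  proof (induction x rule: W_induct)
    case D show ?case by (intro def_intros a b U)
  next
    case (step x)
    show ?case
    proof (intro ballI impI)
      fix x' assume x': "x' \<in> E b" "x \<in> E a" "app f x = app f' x'"
      have ox: "Ord x" "Ord x'" using Ord_elem a b x' by blast+
      show "x = x'"
      proof (rule set_eqI[OF Ord_iset[OF ox(1)] Ord_iset[OF ox(2)]], intro set_eqI equalityI subsetI)
        fix z assume z: "z \<in> E x"
        then have za: "z \<in> E a" using Ord_sub a(1) x'(2) by blast
        then have "opair (app f z) (app f x) \<in> E R" using codes_iff[OF a(2) za x'(2)] z by blast
        from codes_field[OF b(2) this] obtain u v where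
          uv: "u \<in> E b" "v \<in> E b" "u \<in> E v \<or> u = v" "app f z = app f' u" "app f x = app f' v" by auto
        have "v = x'" using fi'[OF uv(2) x'(1)] uv(5) x'(3) by simp
        moreover have "z = u" using step(2)[OF z] uv(1,4) za by blast
        moreover have "u \<noteq> v" using fi[OF za x'(2)] uv(4,5) no_loop[of x] z E_U by auto
        ultimately show "z \<in> E x'" using uv(3) by blast
      next
        fix z assume z: "z \<in> E x'"
        then have zb: "z \<in> E b" using Ord_sub b(1) x'(1) by blast
        then have "opair (app f' z) (app f' x') \<in> E R" using codes_iff[OF b(2) zb x'(1)] z by blast
        from codes_field[OF a(2) this] obtain u v where
          uv: "u \<in> E a" "v \<in> E a" "u \<in> E v \<or> u = v" "app f' z = app f u" "app f' x' = app f v" by auto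
        have v: "v = x" using fi[OF uv(2) x'(2)] uv(5) x'(3) by simp
        have "u \<noteq> v" using fi'[OF zb x'(1)] uv(4,5) no_loop[of x'] z E_U by auto
        then have "u \<in> E x" using uv(3) v by blast
        moreover have "u = z" using step(2)[OF \<open>u \<in> E x\<close>] zb uv(1,4) by auto
        ultimately show "z \<in> E x" by simp
      qed
    qed
  qed
  then show ?thesis using x by blast
qed

text \<open>By reflexivity the code of an element of \<open>a\<close> is in the field of
  \<open>R\<close>, hence also the code of an element of \<open>b\<close>.\<close>

lemma codes_unique:
  assumes a: "Ord a" "codes R f a" "f \<in> UM" and b: "Ord b" "codes R f' b" "f' \<in> UM"
  shows "E a \<subseteq> E b"
proof
  fix x assume x: "x \<in> E a"
  then have "opair (app f x) (app f x) \<in> E R" using codes_iff[OF a(2) x x] by simp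
  from codes_field[OF b(2) this] obtain u where "u \<in> E b" "app f x = app f' u" by auto
  then show "x \<in> E b" using codes_agree[OF a b x] by simp
qed

definition COrd :: "'m set" where "COrd = {a\<in>UM. Ord a \<and> cnt (E a)}"

lemma small_COrd: "small COrd"
proof -
  let ?R = "{y. iset y \<and> E y \<subseteq> times Om Om}"
  let ?P = "\<lambda>R a. Ord a \<and> (\<exists>f\<in>UM. codes R f a)"
  have "small {a\<in>UM. \<exists>R\<in>?R. ?P R a}"
  proof (rule small_rel)
    show "small ?R" by (intro small_Pow small_times small_Om)
    show "D (\<lambda>e. ?P (e 0) (e (Suc 0)))" unfolding codes_def by (intro def_intros om_U)
    fix R a b assume "?P R a" "?P R b"
    then have "Ord a" "Ord b" "E a = E b" using codes_unique by blast+
    then show "a = b" using set_eqI Ord_iset by blast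
  qed
  moreover have "{a\<in>UM. \<exists>R\<in>?R. ?P R a} = COrd"
  proof (intro equalityI subsetI)
    fix a assume "a \<in> {a\<in>UM. \<exists>R\<in>?R. ?P R a}"
    then show "a \<in> COrd" unfolding COrd_def cnt_def codes_def E_om by auto
  next
    fix a assume a: "a \<in> COrd"
    then obtain f where f: "f \<in> UM" "func f (E a) Om" "inj_on (app f) (E a)" "\<And>x. x \<in> E a \<Longrightarrow> app f x \<in> Om"
      using cntE[of "E a"] unfolding COrd_def by blast
    have aU: "a \<in> UM" "Ord a" using a by (auto simp: COrd_def)
    let ?S = "{p\<in>times Om Om. \<exists>x\<in>E a. \<exists>y\<in>E a. (x \<in> E y \<or> x = y) \<and> p = opair (app f x) (app f y)}"
    have s: "small ?S" by (rule small_sep[OF small_times[OF small_Om small_Om]]) (intro def_intros aU f)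
    have "codes (mk ?S) f a" unfolding codes_def E_om E_mk[OF s]
      using f(2-4) by (auto intro: timesI)
    moreover have "mk ?S \<in> ?R" using E_mk[OF s] mk(1) by auto
    ultimately show "a \<in> {a\<in>UM. \<exists>R\<in>?R. ?P R a}" using aU f(1) by blast
  qed
  ultimately show ?thesis by simp
qed

definition omega1 :: 'm where "omega1 = mk COrd"
lemma E_omega1: "E omega1 = COrd" by (simp add: omega1_def E_mk small_COrd)
lemma omega1_U [simp]: "omega1 \<in> UM" by (simp add: omega1_def)
lemma Ord_omega1: "Ord omega1"
  unfolding Ord_def E_omega1
proof (intro conjI ballI subsetI)
  show "iset omega1" by (simp add: omega1_def mk)
  fix x assume x: "x \<in> COrd"
  then have ox: "Ord x" "cnt (E x)" by (auto simp: COrd_def)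
  show "iset x" using ox Ord_iset by blast
  show "y \<in> COrd" if "y \<in> E x" for y
  proof -
    have oy: "Ord y" using Ord_elem ox that by blast
    have "cnt (E y)" by (rule cnt_subset[OF _ Ord_sub[OF ox(1) that] ox(2)]) (simp add: Ord_U oy)
    then show ?thesis using oy Ord_U by (simp add: COrd_def)
  qed
  show "x \<in> E y \<or> x = y \<or> y \<in> E x" if "y \<in> COrd" for y using Ord_tri ox that by (simp add: COrd_def)
qed
text \<open>The Burali-Forti argument: otherwise \<open>omega1\<close> would be a countable ordinal
  and so an element of itself.\<close>

lemma uncountable_COrd: "\<not> cnt COrd"
proof
  assume "cnt COrd"
  then have "omega1 \<in> E omega1" using Ord_omega1 E_omega1 by (simp add: COrd_def)
  then show False using no_loop[OF omega1_U] by blast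
qed

end

section \<open>The countable partition model\<close>

locale pmodel = zfa M for M :: "'m zfa_struct" +
  fixes G F :: 'm
  assumes AC: "axiom_of_choice M" and A_uncountable: "\<not> countable_set M (atoms M)"
    and G_U: "G \<in> univ M" and G_full: "is_full_sym_group M G"
    and F_U: "F \<in> univ M" and F_filter: "is_countable_partition_filter M G F"
begin

lemma A_cnt: "\<not> cnt (E Atm)" using A_uncountable c_countable[OF Atm_U] by simp
lemma G_iff: "g \<in> E G \<longleftrightarrow> perm g"
  using G_full c_perm[of g] self.mem_N[of g G] perm_U[of g] E_U[of g G] unfolding is_full_sym_group_def by blast

text \<open>Nonemptiness reads \<open>E p \<noteq> E zero\<close> so that the definability rule for
  equality of extensions applies.\<close>

definition cpartition :: "'m \<Rightarrow> bool" where
  "cpartition P \<longleftrightarrow> iset P \<and> cnt (E P) \<and> (\<forall>p\<in>E P. E p \<noteq> E zero \<and> E p \<subseteq> E Atm) \<and>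
    (\<forall>p\<in>E P. \<forall>q\<in>E P. \<forall>z\<in>E p. z \<in> E q \<longrightarrow> p = q) \<and> (\<forall>x\<in>E Atm. \<exists>p\<in>E P. x \<in> E p)"
definition fixes_blocks :: "'m \<Rightarrow> 'm \<Rightarrow> bool" where
  "fixes_blocks P g \<longleftrightarrow> perm g \<and> (\<forall>p\<in>E P. pi g p = p)"
text \<open>Quantification over \<open>UM\<close> and \<open>E G\<close> keeps the predicate visibly
  definable; \<open>sym_iff\<close> gives the form with \<open>fixes_blocks\<close> used in
  arguments.\<close>

definition sym :: "'m \<Rightarrow> bool" where
  "sym x \<longleftrightarrow> (\<exists>P\<in>UM. cpartition P \<and> (\<forall>g\<in>E G. (\<forall>p\<in>E P. pi g p = p) \<longrightarrow> pi g x = x))"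
definition HS :: "'m set" where "HS = {x\<in>W. \<forall>y\<in>E (tc x). sym y}"

lemma D_cpartition [def_intros]: "T t \<Longrightarrow> D (\<lambda>e. cpartition (t e))"
  unfolding cpartition_def by (intro def_intros; (intro T_shift)?; (assumption | simp))
lemma D_sym [def_intros]: "T t \<Longrightarrow> D (\<lambda>e. sym (t e))"
  unfolding sym_def by (intro def_intros; (intro T_shift)?; (assumption | simp add: G_U))
lemma D_HS [def_intros]: "T t \<Longrightarrow> D (\<lambda>e. t e \<in> HS)"
  unfolding HS_def mem_Collect_eq by (intro def_intros; (intro T_shift)?; assumption)

lemma sym_iff: "sym x \<longleftrightarrow> (\<exists>P. cpartition P \<and> (\<forall>g. fixes_blocks P g \<longrightarrow> pi g x = x))"
  unfolding sym_def fixes_blocks_def using G_iff by (auto simp: cpartition_def iset_U)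

lemma cpartition_U: "cpartition P \<Longrightarrow> P \<in> UM" by (simp add: cpartition_def iset_U)
lemma cpartition_block: assumes "cpartition P" "p \<in> E P" shows "E p \<noteq> {}" "E p \<subseteq> E Atm" "p \<in> UM" "iset p" "p \<in> W"
proof -
  show 1: "E p \<noteq> {}" "E p \<subseteq> E Atm" using assms by (auto simp: cpartition_def E_zero)
  show U: "p \<in> UM" using assms(2) E_U by blast
  show "iset p" using isetI[OF U 1(1)] .
  show "p \<in> W" using W_I[OF U] 1(2) W_atom by blast
qed
lemma cpartition_cover: "cpartition P \<Longrightarrow> a \<in> E Atm \<Longrightarrow> \<exists>p\<in>E P. a \<in> E p" unfolding cpartition_def by blast
lemma cpartition_disj: "cpartition P \<Longrightarrow> p \<in> E P \<Longrightarrow> q \<in> E P \<Longrightarrow> z \<in> E p \<Longrightarrow> z \<in> E q \<Longrightarrow> p = q"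
  unfolding cpartition_def by blast

lemma c_partition: assumes "P \<in> UM" shows "is_partition M Atm P \<and> countable_set M P \<longleftrightarrow> cpartition P"
proof -
  have 1: "(\<forall>p\<in>UM. mem M p P \<longrightarrow> nonempty M p \<and> sub M p Atm) \<longleftrightarrow> (\<forall>p\<in>E P. E p \<noteq> E zero \<and> E p \<subseteq> E Atm)"
    using self.all_N[OF assms, of "\<lambda>p. nonempty M p \<and> sub M p Atm"] E_U[of _ P]
    by (simp add: self.c_nonempty self.c_sub E_zero)
  have "(\<forall>p\<in>UM. \<forall>q\<in>UM. mem M p P \<and> mem M q P \<and> p \<noteq> q \<longrightarrow> \<not> (\<exists>z\<in>UM. mem M z p \<and> mem M z q)) \<longleftrightarrow>
    (\<forall>p\<in>UM. \<forall>q\<in>UM. mem M p P \<and> mem M q P \<longrightarrow> p \<noteq> q \<longrightarrow> \<not> (\<exists>z\<in>UM. mem M z p \<and> mem M z q))" by blast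
  also have "\<dots> \<longleftrightarrow> (\<forall>p\<in>E P. \<forall>q\<in>E P. p \<noteq> q \<longrightarrow> \<not> (\<exists>z\<in>UM. mem M z p \<and> mem M z q))"
    by (rule self.all2_N[OF assms])
  also have "\<dots> \<longleftrightarrow> (\<forall>p\<in>E P. \<forall>q\<in>E P. \<forall>z\<in>E p. z \<in> E q \<longrightarrow> p = q)"
    unfolding E_def[of P] by (intro ball_cong refl) (auto simp: E_def)
  finally have 2: "(\<forall>p\<in>UM. \<forall>q\<in>UM. mem M p P \<and> mem M q P \<and> p \<noteq> q \<longrightarrow> \<not> (\<exists>z\<in>UM. mem M z p \<and> mem M z q)) \<longleftrightarrow>
    (\<forall>p\<in>E P. \<forall>q\<in>E P. \<forall>z\<in>E p. z \<in> E q \<longrightarrow> p = q)" .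
  have 3: "(\<forall>x\<in>UM. mem M x Atm \<longrightarrow> (\<exists>p\<in>UM. mem M p P \<and> mem M x p)) \<longleftrightarrow> (\<forall>x\<in>E Atm. \<exists>p\<in>E P. x \<in> E p)"
  proof -
    have "(\<forall>x\<in>UM. mem M x Atm \<longrightarrow> (\<exists>p\<in>UM. mem M p P \<and> mem M x p)) \<longleftrightarrow> (\<forall>x\<in>E Atm. \<exists>p\<in>UM. mem M p P \<and> mem M x p)"
      by (rule self.all_N[OF Atm_U])
    also have "\<dots> \<longleftrightarrow> (\<forall>x\<in>E Atm. \<exists>p\<in>E P. mem M x p)" using self.ex_N[OF assms] by simp
    also have "\<dots> \<longleftrightarrow> (\<forall>x\<in>E Atm. \<exists>p\<in>E P. x \<in> E p)" using E_U[of _ Atm] self.mem_N by simp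
    finally show ?thesis .
  qed
  show ?thesis unfolding is_partition_def cpartition_def 1 2 3 c_countable[OF assms] by blast
qed

definition fixset :: "'m \<Rightarrow> 'm" where "fixset P = mk {g\<in>E G. \<forall>p\<in>E P. pi g p = p}"
lemma E_fixset: assumes "P \<in> UM" shows "E (fixset P) = {g. perm g \<and> (\<forall>p\<in>E P. pi g p = p)}"
proof -
  have "small {g\<in>E G. \<forall>p\<in>E P. pi g p = p}" by (rule small_sep) (simp add: G_U, intro def_intros assms)
  then show ?thesis by (simp add: fixset_def E_mk G_iff)
qed
lemma c_fix: assumes "P \<in> UM" "E P \<subseteq> W" "K \<in> UM" shows "is_fix M G P K \<longleftrightarrow> K = fixset P"
proof -
  have "g \<in> E G \<and> (\<forall>y\<in>UM. mem M y P \<longrightarrow> acts M g y y) \<longleftrightarrow> g \<in> E (fixset P)" for g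
  proof -
    have "(\<forall>y\<in>UM. mem M y P \<longrightarrow> acts M g y y) \<longleftrightarrow> (\<forall>p\<in>E P. pi g p = p)" if g: "perm g"
    proof -
      have "acts M g p p \<longleftrightarrow> pi g p = p" if "p \<in> E P" for p
        using acts_iff[OF g, of p p] assms that E_U by auto
      then show ?thesis by (simp add: self.all_N[OF assms(1)])
    qed
    then show ?thesis using G_iff by (auto simp: E_fixset[OF assms(1)])
  qed
  then have "(\<forall>g\<in>UM. mem M g K \<longleftrightarrow> mem M g G \<and> (\<forall>y\<in>UM. mem M y P \<longrightarrow> acts M g y y)) \<longleftrightarrow>
    (\<forall>g\<in>UM. mem M g K \<longleftrightarrow> g \<in> E (fixset P))" by (simp add: self.mem_N)
  also have "\<dots> \<longleftrightarrow> E K = {g. g \<in> E (fixset P)}" using assms E_U by (intro self.set_iff_N) auto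
  finally show ?thesis unfolding is_fix_def using set_eqI[of K "fixset P"] mk(1) by (auto simp: fixset_def)
qed

lemma F_iff: "H \<in> E F \<longleftrightarrow> H \<in> UM \<and> is_subgroup M G H \<and> (\<exists>P. cpartition P \<and> (\<forall>g. fixes_blocks P g \<longrightarrow> g \<in> E H))"
proof (cases "H \<in> UM")
  case True
  have "(\<exists>P\<in>UM. \<exists>K\<in>UM. is_partition M Atm P \<and> countable_set M P \<and> is_fix M G P K \<and> sub M K H) \<longleftrightarrow>
    (\<exists>P. cpartition P \<and> (\<forall>g. fixes_blocks P g \<longrightarrow> g \<in> E H))"
  proof
    assume "\<exists>P\<in>UM. \<exists>K\<in>UM. is_partition M Atm P \<and> countable_set M P \<and> is_fix M G P K \<and> sub M K H"
    then obtain P K where P: "P \<in> UM" "K \<in> UM" "cpartition P" "is_fix M G P K" "sub M K H" using c_partition by blast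
    then have "K = fixset P" using c_fix[of P K] cpartition_block(5)[OF P(3)] by blast
    then have "E (fixset P) \<subseteq> E H" using P True by (simp add: self.c_sub)
    then show "\<exists>P. cpartition P \<and> (\<forall>g. fixes_blocks P g \<longrightarrow> g \<in> E H)"
      using P(3) E_fixset[OF P(1)] unfolding fixes_blocks_def by blast
  next
    assume "\<exists>P. cpartition P \<and> (\<forall>g. fixes_blocks P g \<longrightarrow> g \<in> E H)"
    then obtain P where P: "cpartition P" "\<forall>g. fixes_blocks P g \<longrightarrow> g \<in> E H" by blast
    note PU = cpartition_U[OF P(1)]
    have KU: "fixset P \<in> UM" by (simp add: fixset_def)
    have "sub M (fixset P) H" using P(2) E_fixset[OF PU] KU unfolding fixes_blocks_def by (auto simp: self.c_sub)
    moreover have "is_fix M G P (fixset P)" using c_fix[of P] PU KU cpartition_block(5)[OF P(1)] by blast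
    ultimately show "\<exists>P\<in>UM. \<exists>K\<in>UM. is_partition M Atm P \<and> countable_set M P \<and> is_fix M G P K \<and> sub M K H"
      using c_partition[OF PU] P(1) PU KU by blast
  qed
  then show ?thesis using F_filter True self.mem_N[OF True, of F] unfolding is_countable_partition_filter_def by simp
next
  case False then show ?thesis using E_U by blast
qed

section \<open>Subgroups and symmetric sets\<close>

lemma rel_ext: assumes "k \<in> UM" "k' \<in> UM" "is_relation M k" "is_relation M k'"
    "\<And>x y. x \<in> UM \<Longrightarrow> y \<in> UM \<Longrightarrow> rel M k x y \<longleftrightarrow> rel M k' x y" shows "k = k'"
proof (rule set_eqI)
  have r: "iset k" "\<forall>p\<in>E k. \<exists>x\<in>UM. \<exists>y\<in>UM. p = opair x y" "iset k'" "\<forall>p\<in>E k'. \<exists>x\<in>UM. \<exists>y\<in>UM. p = opair x y"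
    using assms(1-4) by (simp_all add: self.c_relation)
  then show "iset k" "iset k'" by auto
  have e: "opair x y \<in> E k \<longleftrightarrow> opair x y \<in> E k'" if "x \<in> UM" "y \<in> UM" for x y
    using assms(5)[OF that] that assms(1,2) by (simp add: self.c_rel)
  show "E k = E k'"
  proof (intro equalityI subsetI)
    fix p assume p: "p \<in> E k"
    then obtain x y where "x \<in> UM" "y \<in> UM" "p = opair x y" using r(2) by blast
    then show "p \<in> E k'" using e p by blast
  next
    fix p assume p: "p \<in> E k'"
    then obtain x y where "x \<in> UM" "y \<in> UM" "p = opair x y" using r(4) by blast
    then show "p \<in> E k" using e p by blast
  qed
qed

lemma perm_rel: assumes "perm g" shows "is_relation M g" "x \<in> UM \<Longrightarrow> y \<in> UM \<Longrightarrow> rel M g x y \<longleftrightarrow> x \<in> E Atm \<and> y = app g x"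
proof -
  have f: "func g (E Atm) (E Atm)" and g: "g \<in> UM" using assms by (auto simp: perm_def)
  have "iset g" using f by (simp add: func_def)
  moreover have "\<exists>x\<in>UM. \<exists>y\<in>UM. p = opair x y" if "p \<in> E g" for p
  proof -
    obtain x where "x \<in> E Atm" "p = opair x (app g x)" using \<open>p \<in> E g\<close> func_E[OF f E_subset_U E_subset_U] by blast
    then show ?thesis using E_U app_U by blast
  qed
  ultimately show "is_relation M g" using g by (simp add: self.c_relation)
  show "x \<in> UM \<Longrightarrow> y \<in> UM \<Longrightarrow> rel M g x y \<longleftrightarrow> x \<in> E Atm \<and> y = app g x"
    using func_iff[OF f E_subset_U E_subset_U] g by (simp add: self.c_rel)
qed

text \<open>The group laws speak of arbitrary relations that are products or inverses.
  Extensionality identifies these with the permutations built from \<open>app\<close>, so closure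
  can be checked on atoms.\<close>

lemma subgroupI:
  assumes H: "H \<in> UM" "iset H" "\<And>g. g \<in> E H \<Longrightarrow> perm g"
    and id: "\<And>i. perm i \<Longrightarrow> (\<And>a. a \<in> E Atm \<Longrightarrow> app i a = a) \<Longrightarrow> i \<in> E H"
    and comp: "\<And>g h k. g \<in> E H \<Longrightarrow> h \<in> E H \<Longrightarrow> perm k \<Longrightarrow> (\<And>a. a \<in> E Atm \<Longrightarrow> app k a = app g (app h a)) \<Longrightarrow> k \<in> E H"
    and inv: "\<And>g k. g \<in> E H \<Longrightarrow> perm k \<Longrightarrow> (\<And>a. a \<in> E Atm \<Longrightarrow> app k (app g a) = a) \<Longrightarrow> k \<in> E H"
  shows "is_subgroup M G H"
  unfolding is_subgroup_def
proof (intro conjI ballI impI)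
  show "is_set M H" "sub M H G" using H G_iff by (auto simp: self.c_sub)
  obtain i where i: "perm i" "\<And>a. a \<in> E Atm \<Longrightarrow> app i a = a" using perm_id by blast
  have "rel M i x y \<longleftrightarrow> mem M x Atm \<and> x = y" if "x \<in> UM" "y \<in> UM" for x y
    using perm_rel(2)[OF i(1) that] i(2) self.mem_N[OF that(1), of Atm] by auto
  then have "is_identity M Atm i" using perm_rel(1)[OF i(1)] by (simp add: is_identity_def)
  then show "\<exists>i\<in>UM. is_identity M Atm i \<and> mem M i H" using id[OF i] i perm_U by (auto simp: self.mem_N)
next
  fix g h k assume U: "g \<in> UM" "h \<in> UM" "k \<in> UM" and a: "mem M g H \<and> mem M h H \<and> is_comp M g h k"
  have gh: "g \<in> E H" "h \<in> E H" using a U by (auto simp: self.mem_N)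
  obtain k' where k': "perm k'" "\<And>a. a \<in> E Atm \<Longrightarrow> app k' a = app g (app h a)" using perm_comp H(3) gh by metis
  have "k = k'"
  proof (rule rel_ext)
    show "is_relation M k" using a by (simp add: is_comp_def)
    fix x z assume x: "x \<in> UM" "z \<in> UM"
    have "rel M k x z \<longleftrightarrow> (\<exists>y\<in>UM. rel M h x y \<and> rel M g y z)" using a x by (simp add: is_comp_def)
    also have "\<dots> \<longleftrightarrow> x \<in> E Atm \<and> z = app g (app h x)"
      using perm_rel(2)[OF H(3)[OF gh(1)]] perm_rel(2)[OF H(3)[OF gh(2)]] x perm_in[OF H(3)[OF gh(2)]] app_U by auto
    also have "\<dots> \<longleftrightarrow> rel M k' x z" using perm_rel(2)[OF k'(1) x] k'(2) by auto
    finally show "rel M k x z \<longleftrightarrow> rel M k' x z" .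
  qed (simp_all add: U perm_rel(1)[OF k'(1)] perm_U[OF k'(1)])
  then show "mem M k H" using comp[OF gh k'] by (simp add: E_def)
next
  fix g k assume U: "g \<in> UM" "k \<in> UM" and a: "mem M g H \<and> is_inverse M g k"
  have g: "g \<in> E H" using a U by (auto simp: self.mem_N)
  obtain k' where k': "perm k'" "\<And>a. a \<in> E Atm \<Longrightarrow> app k' (app g a) = a" "\<And>a. a \<in> E Atm \<Longrightarrow> app g (app k' a) = a"
    using perm_inv H(3) g by metis
  have "k = k'"
  proof (rule rel_ext)
    show "is_relation M k" using a by (simp add: is_inverse_def)
    fix x y assume x: "x \<in> UM" "y \<in> UM"
    have "rel M k x y \<longleftrightarrow> rel M g y x" using a x by (simp add: is_inverse_def)
    also have "\<dots> \<longleftrightarrow> y \<in> E Atm \<and> x = app g y" using perm_rel(2)[OF H(3)[OF g]] x by auto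
    also have "\<dots> \<longleftrightarrow> x \<in> E Atm \<and> y = app k' x"
      using k'(2,3) perm_in[OF H(3)[OF g]] perm_in[OF k'(1)] by auto
    also have "\<dots> \<longleftrightarrow> rel M k' x y" using perm_rel(2)[OF k'(1) x] by auto
    finally show "rel M k x y \<longleftrightarrow> rel M k' x y" .
  qed (simp_all add: U perm_rel(1)[OF k'(1)] perm_U[OF k'(1)])
  then show "mem M k H" using inv[OF g k'(1,2)] by (simp add: E_def)
qed

lemma subgroup_fixing:
  assumes H: "H \<in> UM" "iset H" "X \<subseteq> W" "\<And>g. g \<in> E H \<longleftrightarrow> perm g \<and> (\<forall>x\<in>X. pi g x = x)"
  shows "is_subgroup M G H"
proof (rule subgroupI[OF H(1,2)])
  show "perm g" if "g \<in> E H" for g using H(4) that by simp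
  show "i \<in> E H" if "perm i" "\<And>a. a \<in> E Atm \<Longrightarrow> app i a = a" for i
    using that pi_id H(3) by (auto simp: H(4))
  show "k \<in> E H" if "g \<in> E H" "h \<in> E H" and k: "perm k" "\<And>a. a \<in> E Atm \<Longrightarrow> app k a = app g (app h a)" for g h k
  proof -
    have g: "perm g" "perm h" "\<And>x. x \<in> X \<Longrightarrow> pi g x = x" "\<And>x. x \<in> X \<Longrightarrow> pi h x = x" using that H(4) by auto
    have "pi k x = x" if "x \<in> X" for x using pi_comp[OF g(1,2) k, of x] g(3,4)[OF that] H(3) that by auto
    then show ?thesis using k by (simp add: H(4))
  qed
  show "k \<in> E H" if "g \<in> E H" and k: "perm k" "\<And>a. a \<in> E Atm \<Longrightarrow> app k (app g a) = a" for g k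
  proof -
    have g: "perm g" "\<And>x. x \<in> X \<Longrightarrow> pi g x = x" using that H(4) by auto
    have "pi k x = x" if "x \<in> X" for x using pi_inv[OF g(1) k, of x] g(2)[OF that] H(3) that by auto
    then show ?thesis using k by (simp add: H(4))
  qed
qed

text \<open>The stabilizer of \<open>x\<close> is the pointwise stabilizer of its singleton, so one
  operation covers both kinds of subgroup.\<close>

lemma c_stab: assumes "x \<in> W" "H \<in> UM" shows "is_stab M G x H \<longleftrightarrow> H = fixset (mk {x})"
proof -
  have xU: "x \<in> UM" using assms W_U by auto
  have "acts M g x x \<longleftrightarrow> pi g x = x" if "perm g" for g using acts_iff[OF that assms(1) xU] by auto
  then have "mem M g G \<and> acts M g x x \<longleftrightarrow> g \<in> E (fixset (mk {x}))" if "g \<in> UM" for g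
    using E_fixset[of "mk {x}"] that by (auto simp: E_sing xU self.mem_N G_iff)
  then have "(\<forall>g\<in>UM. mem M g H \<longleftrightarrow> mem M g G \<and> acts M g x x) \<longleftrightarrow> (\<forall>g\<in>UM. mem M g H \<longleftrightarrow> g \<in> E (fixset (mk {x})))"
    by simp
  also have "\<dots> \<longleftrightarrow> E H = {g. g \<in> E (fixset (mk {x}))}" using assms E_U by (intro self.set_iff_N) auto
  finally show ?thesis unfolding is_stab_def using set_eqI[of H "fixset (mk {x})"] mk(1) by (auto simp: fixset_def)
qed

lemma fixset_in_F: assumes "P \<in> UM" "E P \<subseteq> W"
  shows "fixset P \<in> E F \<longleftrightarrow> (\<exists>Q. cpartition Q \<and> (\<forall>g. fixes_blocks Q g \<longrightarrow> (\<forall>x\<in>E P. pi g x = x)))"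
proof -
  have U: "fixset P \<in> UM" "iset (fixset P)" by (simp_all add: fixset_def mk)
  have "is_subgroup M G (fixset P)"
    by (rule subgroup_fixing[OF U assms(2)]) (simp add: E_fixset[OF assms(1)])
  then show ?thesis using U unfolding F_iff E_fixset[OF assms(1)] fixes_blocks_def by blast
qed

lemma c_symmetric: assumes "x \<in> W" shows "symmetric M G F x \<longleftrightarrow> sym x"
proof -
  have xU: "x \<in> UM" using assms W_U by auto
  have U: "fixset (mk {x}) \<in> UM" by (simp add: fixset_def)
  have "symmetric M G F x \<longleftrightarrow> fixset (mk {x}) \<in> E F"
    unfolding symmetric_def using c_stab[OF assms] U self.mem_N by blast
  also have "\<dots> \<longleftrightarrow> sym x" using assms unfolding sym_iff by (subst fixset_in_F) (auto simp: E_sing xU)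
  finally show ?thesis .
qed

text \<open>Kept general in the filter \<open>F'\<close>, since the comparison with countable
  supports involves a second filter.\<close>

lemma c_hereditarily_symmetric: assumes "x \<in> UM" shows "hereditarily_symmetric M G F' x \<longleftrightarrow> x \<in> W \<and> (\<forall>y\<in>E (tc x). symmetric M G F' y)"
proof -
  have "hereditarily_symmetric M G F' x \<longleftrightarrow> (\<exists>t\<in>UM. is_tc x t \<and> (\<forall>y\<in>E t. symmetric M G F' y))"
    unfolding hereditarily_symmetric_def using c_tclosure[OF assms] self.all_N by blast
  also have "\<dots> \<longleftrightarrow> x \<in> W \<and> (\<forall>y\<in>E (tc x). symmetric M G F' y)"
  proof
    assume "\<exists>t\<in>UM. is_tc x t \<and> (\<forall>y\<in>E t. symmetric M G F' y)"
    then obtain t where t: "t \<in> UM" "is_tc x t" "\<forall>y\<in>E t. symmetric M G F' y" by blast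
    have "x \<in> W" using assms t unfolding W_def is_tc_def by blast
    moreover have "tc x = t" using tc[OF \<open>x \<in> W\<close>] is_tc_unique t by blast
    ultimately show "x \<in> W \<and> (\<forall>y\<in>E (tc x). symmetric M G F' y)" using t by blast
  qed (use tc in blast)
  finally show ?thesis .
qed

lemma tc_W: "x \<in> W \<Longrightarrow> y \<in> E (tc x) \<Longrightarrow> y \<in> W"
  using tc[of x] E_U unfolding is_tc_def W_def by blast

section \<open>The universe of the model and its closure properties\<close>

lemma univ_V: "univ (perm_model M G F) = HS"
proof -
  have "hereditarily_symmetric M G F x \<longleftrightarrow> x \<in> W \<and> (\<forall>y\<in>E (tc x). sym y)" if "x \<in> UM" for x
    unfolding c_hereditarily_symmetric[OF that] using c_symmetric tc_W by blast
  then show ?thesis using W_U by (auto simp: perm_model_def HS_def)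
qed

lemma HS_W: "x \<in> HS \<Longrightarrow> x \<in> W" by (simp add: HS_def)
lemma HS_U: "x \<in> HS \<Longrightarrow> x \<in> UM" using HS_W W_U by blast
lemma HS_sym: "x \<in> HS \<Longrightarrow> sym x" using tc[of x] by (auto simp: HS_def is_tc_def)
lemma tc_mono: "x \<in> W \<Longrightarrow> y \<in> E (tc x) \<Longrightarrow> E (tc y) \<subseteq> E (tc x)"
  using tc[of x] tc[of y] tc_W[of x y] unfolding is_tc_def by blast
lemma HS_elem: assumes "x \<in> HS" "y \<in> E x" shows "y \<in> HS"
proof -
  have "y \<in> E (tc x)" using tc(1)[OF HS_W[OF assms(1)]] assms(2) unfolding is_tc_def trans_def by blast
  then show ?thesis using assms(1) tc_mono[OF HS_W[OF assms(1)]] tc_W[OF HS_W[OF assms(1)]] unfolding HS_def by blast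
qed
text \<open>The part of the transitive closure formed by \<open>x\<close> and the members of
  \<open>HS\<close> is itself transitive, hence the whole closure.\<close>

lemma HS_I: assumes "x \<in> UM" "E x \<subseteq> HS" "sym x" shows "x \<in> HS"
proof -
  have xW: "x \<in> W" using assms HS_W by (intro W_I) auto
  let ?S = "{z\<in>E (tc x). z = x \<or> z \<in> HS}"
  have s: "small ?S" by (rule small_sep) (simp add: tc xW, intro def_intros assms)
  have "trans (mk ?S)" unfolding trans_def E_mk[OF s]
  proof (intro ballI subsetI)
    fix u v assume "u \<in> ?S" "v \<in> E u"
    then have "v \<in> HS" using assms(2) HS_elem by blast
    moreover have "v \<in> E (tc x)" using \<open>u \<in> ?S\<close> \<open>v \<in> E u\<close> tc(1)[OF xW] unfolding is_tc_def trans_def by blast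
    ultimately show "v \<in> ?S" by simp
  qed
  moreover have "x \<in> E (mk ?S)" using tc(1)[OF xW] unfolding E_mk[OF s] is_tc_def by simp
  ultimately have "E (tc x) \<subseteq> ?S" using tc(1)[OF xW] E_mk[OF s] mk_U[of ?S] unfolding is_tc_def by blast
  then show ?thesis using xW assms(3) HS_sym unfolding HS_def by blast
qed

text \<open>The blocks are the singletons of \<open>S\<close> and the set of remaining atoms, which
  is nonempty because \<open>A\<close> is uncountable.\<close>

lemma cpartition_countable_set: assumes S: "cnt S" "S \<subseteq> E Atm"
  obtains P where "cpartition P" "\<And>g a. fixes_blocks P g \<Longrightarrow> a \<in> S \<Longrightarrow> pi g a = a"
proof -
  have SU: "S \<subseteq> UM" and sS: "small S" using S cnt_small small_U by auto
  let ?s = "\<lambda>a. mk {a}"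
  have Ts: "T (\<lambda>e. ?s (e 0))" by (intro def_intros)
  define B where "B = mk (E Atm - S)"
  have sB: "small (E Atm - S)"
    by (rule small_subset[of "E Atm" "\<lambda>x. x \<notin> E (mk S)"]) (simp, intro def_intros mk_U, simp add: E_mk sS)
  have EB: "E B = E Atm - S" and BU: "B \<in> UM" by (simp_all add: B_def E_mk[OF sB])
  have EBne: "E B \<noteq> {}" using EB A_cnt S cnt_subset[of "E Atm" S] by auto
  have sim: "small (?s ` S)" by (rule small_image[OF sS Ts])
  define P where "P = mk (insert B (?s ` S))"
  have EP: "E P = insert B (?s ` S)" unfolding P_def by (intro E_mk small_insert BU sim)
  have Es: "E (?s a) = {a}" if "a \<in> S" for a using that SU by (intro E_sing) auto
  have "cnt (?s ` S)"
  proof (rule cnt_inj[OF sim, of "\<lambda>q. theU (\<lambda>a. a \<in> E q)" S])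
    have *: "theU (\<lambda>a. a \<in> E (?s b)) = b" if "b \<in> S" for b
      by (rule theU_I) (use that SU Es in auto)
    show "T (\<lambda>e. theU (\<lambda>a. a \<in> E (e 0)))" by (intro def_intros)
    show "theU (\<lambda>a. a \<in> E x) \<in> S" if "x \<in> ?s ` S" for x using that * by auto
    show "inj_on (\<lambda>q. theU (\<lambda>a. a \<in> E q)) (?s ` S)" by (rule inj_onI) (use * in auto)
  qed (rule S)
  then have cP: "cnt (E P)" unfolding EP by (rule cnt_insert[OF _ BU])
  have "cpartition P" unfolding cpartition_def
  proof (intro conjI ballI impI)
    show "iset P" by (simp add: P_def mk)
    show "cnt (E P)" by (rule cP)
    fix p assume p: "p \<in> E P"
    show "E p \<noteq> E zero" "E p \<subseteq> E Atm" using p EBne EB Es S(2) by (auto simp: EP E_zero)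
    fix q z assume "q \<in> E P" "z \<in> E p" "z \<in> E q"
    then show "p = q" using p EB Es by (auto simp: EP)
  next
    fix x assume "x \<in> E Atm"
    then show "\<exists>p\<in>E P. x \<in> E p" using EB Es by (cases "x \<in> S") (auto simp: EP)
  qed
  moreover have "pi g a = a" if g: "fixes_blocks P g" and a: "a \<in> S" for g a
  proof -
    have pg: "perm g" and fx: "pi g (?s a) = ?s a" using g a EP by (auto simp: fixes_blocks_def)
    have "a \<in> W" using a S(2) W_atom by blast
    then have "E (pi g (?s a)) = pi g ` E (?s a)"
      using a SU mk(1) W_sing[of a] by (intro pi_set(2)[OF pg]) auto
    then show ?thesis using fx Es[OF a] by simp
  qed
  ultimately show ?thesis using that by blast
qed

text \<open>A countable set of atoms acts as support. Closure of \<open>x\<close> under the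
  permutations fixing \<open>S\<close> pointwise already gives invariance, because their inverses
  fix \<open>S\<close> as well.\<close>

lemma HS_inv:
  assumes S: "cnt S" "S \<subseteq> E Atm" and x: "x \<in> UM" "E x \<subseteq> HS" "iset x"
    and closed: "\<And>g z. perm g \<Longrightarrow> (\<And>a. a \<in> S \<Longrightarrow> pi g a = a) \<Longrightarrow> z \<in> E x \<Longrightarrow> pi g z \<in> E x"
  shows "x \<in> HS"
proof (rule HS_I[OF x(1,2)])
  have xW: "x \<in> W" using x HS_W by (intro W_I) auto
  obtain P where P: "cpartition P" "\<And>g a. fixes_blocks P g \<Longrightarrow> a \<in> S \<Longrightarrow> pi g a = a" using cpartition_countable_set[OF S] by blast
  have "pi g x = x" if g: "fixes_blocks P g" for g
  proof -
    have pg: "perm g" using g by (simp add: fixes_blocks_def)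
    obtain k where k: "perm k" "\<And>a. a \<in> E Atm \<Longrightarrow> app k (app g a) = a" "\<And>a. a \<in> E Atm \<Longrightarrow> app g (app k a) = a"
      using perm_inv[OF pg] by blast
    have kg: "pi k (pi g z) = z" "pi g (pi k z) = z" if "z \<in> W" for z
      using pi_inv[OF pg k(1,2) that] pi_inv[OF k(1) pg k(3) that] by auto
    have kS: "pi k a = a" if "a \<in> S" for a
      using kg(1)[of a] P(2)[OF g that] W_atom S(2) that by auto
    note e = pi_set[OF pg xW x(3)]
    have "pi g ` E x = E x"
    proof (intro equalityI subsetI)
      fix z assume "z \<in> pi g ` E x"
      then show "z \<in> E x" using closed[OF pg P(2)[OF g]] by blast
    next
      fix z assume z: "z \<in> E x"
      have "pi k z \<in> E x" by (rule closed[OF k(1) kS z])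
      moreover have "z = pi g (pi k z)" using kg(2) W_elem[OF xW z] by simp
      ultimately show "z \<in> pi g ` E x" by blast
    qed
    then show ?thesis using e x(3) by (intro set_eqI) auto
  qed
  then show "sym x" using P(1) unfolding sym_iff by blast
qed

lemma cnt_empty: "cnt {}" by (rule cntI[of _ "\<lambda>x. x"]) (auto intro: T_var)
text \<open>The case of empty support, for sets closed under every permutation of the atoms.\<close>

lemmas HS_ginv = HS_inv[OF cnt_empty empty_subsetI]

lemma HS_atom: assumes "a \<in> E Atm" shows "a \<in> HS"
proof (rule HS_I)
  show "a \<in> UM" "E a \<subseteq> HS" using assms E_U atom_E by auto
  have "cnt {a}" by (rule cnt_insert[OF cnt_empty]) (rule E_U[OF assms])
  then obtain P where "cpartition P" "\<And>g b. fixes_blocks P g \<Longrightarrow> b \<in> {a} \<Longrightarrow> pi g b = b" using cpartition_countable_set[of "{a}"] assms by blast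
  then show "sym a" unfolding sym_iff by blast
qed
lemma HS_Atm: "Atm \<in> HS"
proof (rule HS_ginv)
  have "E Atm \<noteq> {}" using A_cnt cnt_empty by auto
  then show "iset Atm" by (intro isetI) auto
qed (use HS_atom pi_atom_in in auto)

lemma HS_Ord: assumes "Ord a" shows "a \<in> HS"
proof -
  have "a \<in> W" using Ord_W assms by blast
  then have "Ord a \<longrightarrow> a \<in> HS"
  proof (induction a rule: W_induct)
    case D show ?case by (intro def_intros)
  next
    case (step a)
    show ?case
    proof
      assume a: "Ord a"
      show "a \<in> HS"
      proof (rule HS_ginv)
        show "a \<in> UM" "iset a" using a Ord_U Ord_iset by auto
        show "E a \<subseteq> HS" using step(2) Ord_elem[OF a] by blast
        show "pi g z \<in> E a" if "perm g" "z \<in> E a" for g z using pi_Ord[OF that(1) Ord_elem[OF a that(2)]] that by simp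
      qed
    qed
  qed
  then show ?thesis using assms by simp
qed

text \<open>The nonempty intersections of a block of \<open>P\<close> with a block of
  \<open>Q\<close> are taken. Every block of \<open>P\<close> or \<open>Q\<close> is a union of such
  intersections, so it is fixed as soon as they are.\<close>

lemma cpartition_refine: assumes P: "cpartition P" and Q: "cpartition Q"
  obtains R where "cpartition R" "\<And>g. fixes_blocks R g \<Longrightarrow> fixes_blocks P g \<and> fixes_blocks Q g"
proof -
  note U = cpartition_U[OF P] cpartition_U[OF Q]
  define i where "i q = mk {z\<in>E (pfst q). z \<in> E (psnd q)}" for q
  have Ti: "T (\<lambda>e. i (e 0))" unfolding i_def by (intro def_intros)
  have i: "E (i (opair p q)) = E p \<inter> E q" if "p \<in> UM" "q \<in> UM" for p q
  proof -
    have "small {z\<in>E p. z \<in> E q}" by (rule small_sep) (simp add: that, intro def_intros that)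
    then show ?thesis using that by (simp add: i_def pfst psnd E_mk Int_def)
  qed
  have sPQ: "small (times (E P) (E Q))" by (intro small_times) (simp_all add: U)
  define B where "B = {r\<in>i ` times (E P) (E Q). E r \<noteq> E zero}"
  have sB: "small B" unfolding B_def by (rule small_sep[OF small_image[OF sPQ Ti]]) (intro def_intros zero_U)
  define R where "R = mk B"
  have ER: "E R = B" unfolding R_def by (rule E_mk[OF sB])
  have B: "\<exists>p\<in>E P. \<exists>q\<in>E Q. r = i (opair p q) \<and> E r = E p \<inter> E q \<and> E r \<noteq> {}" if r: "r \<in> B" for r
  proof -
    obtain p q where "p \<in> E P" "q \<in> E Q" "r = i (opair p q)" "E r \<noteq> {}"
      using r unfolding B_def times_def by (auto simp: E_zero)
    then show ?thesis using i[of p q] E_U by blast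
  qed
  have B2: "i (opair p q) \<in> B" if "p \<in> E P" "q \<in> E Q" "E p \<inter> E q \<noteq> {}" for p q
    using that i[of p q] E_U timesI[of p "E P" q "E Q"] unfolding B_def by (auto simp: E_zero)
  \<comment> \<open>A block of the refinement lies in exactly one block of each partition and is
    counted by this pair.\<close>
  have cB: "cnt B"
  proof (rule cnt_inj[OF sB, of "\<lambda>r. opair (theU (\<lambda>p. p \<in> E P \<and> E r \<subseteq> E p)) (theU (\<lambda>q. q \<in> E Q \<and> E r \<subseteq> E q))"])
    have *: "theU (\<lambda>p. p \<in> E P \<and> E r \<subseteq> E p) = p" "theU (\<lambda>q. q \<in> E Q \<and> E r \<subseteq> E q) = q"
      if "p \<in> E P" "q \<in> E Q" "E r = E p \<inter> E q" and ne: "E r \<noteq> {}" for r p q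
    proof -
      obtain z where z: "z \<in> E r" using ne by blast
      show "theU (\<lambda>p. p \<in> E P \<and> E r \<subseteq> E p) = p"
        by (rule theU_I) (use that z E_U cpartition_disj[OF P] in blast)+
      show "theU (\<lambda>q. q \<in> E Q \<and> E r \<subseteq> E q) = q"
        by (rule theU_I) (use that z E_U cpartition_disj[OF Q] in blast)+
    qed
    show "T (\<lambda>e. opair (theU (\<lambda>p. p \<in> E P \<and> E (e 0) \<subseteq> E p)) (theU (\<lambda>q. q \<in> E Q \<and> E (e 0) \<subseteq> E q)))"
      by (intro def_intros U)
    show "opair (theU (\<lambda>p. p \<in> E P \<and> E r \<subseteq> E p)) (theU (\<lambda>q. q \<in> E Q \<and> E r \<subseteq> E q)) \<in> times (E P) (E Q)" if "r \<in> B" for r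
    proof -
      from B[OF that] obtain p q where r: "p \<in> E P" "q \<in> E Q" "E r = E p \<inter> E q" "E r \<noteq> {}" by blast
      show ?thesis unfolding *[OF r] by (rule timesI[OF r(1,2)])
    qed
    show "inj_on (\<lambda>r. opair (theU (\<lambda>p. p \<in> E P \<and> E r \<subseteq> E p)) (theU (\<lambda>q. q \<in> E Q \<and> E r \<subseteq> E q))) B"
    proof (rule inj_onI)
      fix r s assume rs: "r \<in> B" "s \<in> B" and e: "opair (theU (\<lambda>p. p \<in> E P \<and> E r \<subseteq> E p)) (theU (\<lambda>q. q \<in> E Q \<and> E r \<subseteq> E q)) =
        opair (theU (\<lambda>p. p \<in> E P \<and> E s \<subseteq> E p)) (theU (\<lambda>q. q \<in> E Q \<and> E s \<subseteq> E q))"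
      obtain p q where r: "p \<in> E P" "q \<in> E Q" "r = i (opair p q)" "E r = E p \<inter> E q" "E r \<noteq> {}" using B[OF rs(1)] by blast
      obtain p' q' where s: "p' \<in> E P" "q' \<in> E Q" "s = i (opair p' q')" "E s = E p' \<inter> E q'" "E s \<noteq> {}" using B[OF rs(2)] by blast
      have "opair p q = opair p' q'" using e *[OF r(1,2,4,5)] *[OF s(1,2,4,5)] by simp
      then show "r = s" using r(3) s(3) by simp
    qed
    show "cnt (times (E P) (E Q))" using P Q by (intro cnt_times) (auto simp: cpartition_def)
  qed
  have R: "cpartition R" unfolding cpartition_def ER
  proof (intro conjI ballI impI)
    show "iset R" by (simp add: R_def mk)
    show "cnt B" by (rule cB)
    fix r assume r: "r \<in> B"
    then obtain p q where pq: "p \<in> E P" "q \<in> E Q" "r = i (opair p q)" "E r = E p \<inter> E q" "E r \<noteq> {}" using B by blast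
    show "E r \<noteq> E zero" "E r \<subseteq> E Atm" using pq cpartition_block(2)[OF P pq(1)] by (auto simp: E_zero)
    fix s z assume "s \<in> B" and z: "z \<in> E r" "z \<in> E s"
    then obtain p' q' where s: "p' \<in> E P" "q' \<in> E Q" "s = i (opair p' q')" "E s = E p' \<inter> E q'" "E s \<noteq> {}" using B by blast
    have "p = p'" using cpartition_disj[OF P pq(1) s(1), of z] z pq s by blast
    moreover have "q = q'" using cpartition_disj[OF Q pq(2) s(2), of z] z pq s by blast
    ultimately show "r = s" using pq s by simp
  next
    fix x assume x: "x \<in> E Atm"
    obtain p q where pq: "p \<in> E P" "q \<in> E Q" "x \<in> E p" "x \<in> E q" using cpartition_cover P Q x by blast
    then have "i (opair p q) \<in> B" "x \<in> E (i (opair p q))" using B2 i E_U by auto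
    then show "\<exists>p\<in>B. x \<in> E p" by blast
  qed
  have fixb: "pi g p = p" if g: "fixes_blocks R g" and p: "iset p" "p \<in> W" and cov: "\<And>a. a \<in> E p \<Longrightarrow> \<exists>r\<in>E R. a \<in> E r \<and> E r \<subseteq> E p" for g p
  proof -
    have pg: "perm g" using g by (simp add: fixes_blocks_def)
    have rr: "pi g ` E r = E r" if "r \<in> E R" for r
      using pi_set(2)[OF pg cpartition_block(5,4)[OF R that]] g that by (simp add: fixes_blocks_def)
    have "pi g ` E p = E p"
    proof (intro equalityI subsetI)
      fix z assume "z \<in> pi g ` E p"
      then obtain a where a: "a \<in> E p" "z = pi g a" by blast
      obtain r where "r \<in> E R" "a \<in> E r" "E r \<subseteq> E p" using cov[OF a(1)] by blast
      then show "z \<in> E p" using rr a by blast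
    next
      fix z assume z: "z \<in> E p"
      obtain r where "r \<in> E R" "z \<in> E r" "E r \<subseteq> E p" using cov[OF z] by blast
      then show "z \<in> pi g ` E p" using rr by blast
    qed
    then show ?thesis using pi_set[OF pg p(2,1)] p(1) by (intro set_eqI) auto
  qed
  have "fixes_blocks P g \<and> fixes_blocks Q g" if g: "fixes_blocks R g" for g
    unfolding fixes_blocks_def
  proof (intro conjI ballI)
    show "perm g" "perm g" using g by (auto simp: fixes_blocks_def)
    show "pi g p = p" if p: "p \<in> E P" for p
    proof (rule fixb[OF g cpartition_block(4,5)[OF P p]])
      fix a assume a: "a \<in> E p"
      then obtain q where q: "q \<in> E Q" "a \<in> E q" using cpartition_cover[OF Q] cpartition_block(2)[OF P p] by blast
      then have "i (opair p q) \<in> B" "E (i (opair p q)) = E p \<inter> E q" using B2[OF p q(1)] i p a E_U by auto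
      then show "\<exists>r\<in>E R. a \<in> E r \<and> E r \<subseteq> E p" using ER a q by blast
    qed
    show "pi g q = q" if q: "q \<in> E Q" for q
    proof (rule fixb[OF g cpartition_block(4,5)[OF Q q]])
      fix a assume a: "a \<in> E q"
      then obtain p where p: "p \<in> E P" "a \<in> E p" using cpartition_cover[OF P] cpartition_block(2)[OF Q q] by blast
      then have "i (opair p q) \<in> B" "E (i (opair p q)) = E p \<inter> E q" using B2[OF p(1) q] i q a E_U by auto
      then show "\<exists>r\<in>E R. a \<in> E r \<and> E r \<subseteq> E q" using ER a p by blast
    qed
  qed
  then show ?thesis using that R by blast
qed

lemma HS_upair: assumes "x \<in> HS" "y \<in> HS" shows "mk {x, y} \<in> HS"
proof (rule HS_I)
  have U: "x \<in> UM" "y \<in> UM" using assms HS_U by auto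
  show "E (mk {x, y}) \<subseteq> HS" using assms by (simp add: E_upair U)
  obtain P Q where P: "cpartition P" "\<forall>g. fixes_blocks P g \<longrightarrow> pi g x = x" and Q: "cpartition Q" "\<forall>g. fixes_blocks Q g \<longrightarrow> pi g y = y"
    using HS_sym assms sym_iff by metis
  obtain R where R: "cpartition R" "\<And>g. fixes_blocks R g \<Longrightarrow> fixes_blocks P g \<and> fixes_blocks Q g" using cpartition_refine[OF P(1) Q(1)] by blast
  have "pi g (mk {x, y}) = mk {x, y}" if g: "fixes_blocks R g" for g
    using pi_upair[of g x y] HS_W assms R(2)[OF g] P(2) Q(2) g by (simp add: fixes_blocks_def)
  then show "sym (mk {x, y})" using R(1) unfolding sym_iff by blast
qed simp
lemma HS_opair: assumes "x \<in> HS" "y \<in> HS" shows "opair x y \<in> HS"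
  unfolding opair_def using HS_upair[OF HS_upair[OF assms(1,1)] HS_upair[OF assms]] by simp
lemma HS_times: "X \<subseteq> HS \<Longrightarrow> Y \<subseteq> HS \<Longrightarrow> times X Y \<subseteq> HS" using HS_opair unfolding times_def by blast

end

text \<open>The permutation model is transitive in \<open>M\<close>, so the absoluteness lemmas
  become available for it as \<open>V.c_...\<close>.\<close>

sublocale pmodel \<subseteq> V: tsub M "perm_model M G F"
  by unfold_locales (use univ_V HS_U HS_elem in \<open>auto simp: perm_model_def\<close>)

context pmodel begin

section \<open>Failure of the choice principles\<close>

abbreviation "VM \<equiv> perm_model M G F"

section \<open>Transpositions within an uncountable block\<close>

definition transposition :: "'m \<Rightarrow> 'm \<Rightarrow> 'm" where
  "transposition a b = graph (\<lambda>x. if x = a then b else if x = b then a else x) (E Atm)"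

lemma transposition: assumes a: "a \<in> E Atm" "b \<in> E Atm"
  shows "perm (transposition a b)" "pi (transposition a b) a = b" "pi (transposition a b) b = a"
    "c \<in> E Atm \<Longrightarrow> c \<noteq> a \<Longrightarrow> c \<noteq> b \<Longrightarrow> pi (transposition a b) c = c"
proof -
  let ?t = "\<lambda>x. if x = a then b else if x = b then a else x"
  have U: "a \<in> UM" "b \<in> UM" using a E_U by auto
  have T: "T (\<lambda>e. ?t (e 0))" by (intro def_intros U)
  have bij: "bij_betw ?t (E Atm) (E Atm)"
    by (rule bij_betw_byWitness[where f' = ?t]) (use a in auto)
  note g = perm_graph[OF T bij, folded transposition_def]
  show p: "perm (transposition a b)" by (rule g(1))
  show "pi (transposition a b) a = b" using pi_atom[OF p a(1)] g(2)[OF a(1)] by simp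
  show "pi (transposition a b) b = a" using pi_atom[OF p a(2)] g(2)[OF a(2)] by simp
  show "pi (transposition a b) c = c" if "c \<in> E Atm" "c \<noteq> a" "c \<noteq> b" using pi_atom[OF p that(1)] g(2)[OF that(1)] that by simp
qed

lemma transposition_set: assumes p: "p \<in> W" "iset p" "E p \<subseteq> E Atm" and a: "a \<in> E p" "b \<in> E p"
  shows "pi (transposition a b) p = p"
proof -
  have A: "a \<in> E Atm" "b \<in> E Atm" using p a by auto
  have m: "pi (transposition a b) c \<in> E p" "pi (transposition a b) (pi (transposition a b) c) = c" if "c \<in> E p" for c
  proof -
    have cA: "c \<in> E Atm" using that p by blast
    consider "c = a" | "c = b" | "c \<noteq> a" "c \<noteq> b" by blast
    then have "pi (transposition a b) c \<in> E p \<and> pi (transposition a b) (pi (transposition a b) c) = c"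
      using transposition(2,3)[OF A] transposition(4)[OF A cA] a that by cases auto
    then show "pi (transposition a b) c \<in> E p" "pi (transposition a b) (pi (transposition a b) c) = c" by auto
  qed
  have "pi (transposition a b) ` E p = E p"
  proof (intro equalityI subsetI)
    fix z assume z: "z \<in> E p"
    then show "z \<in> pi (transposition a b) ` E p" using m[OF z] by (metis imageI)
  qed (use m(1) in blast)
  then show ?thesis using pi_set[OF transposition(1)[OF A] p(1,2)] p(2) by (intro set_eqI) auto
qed

text \<open>The block containing both atoms is permuted within itself, and every other block is
  fixed point by point.\<close>

lemma support: assumes "x \<in> HS"
  obtains P where "cpartition P" "\<And>p a b. p \<in> E P \<Longrightarrow> a \<in> E p \<Longrightarrow> b \<in> E p \<Longrightarrow> pi (transposition a b) x = x"
proof -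
  obtain P where P: "cpartition P" "\<And>g. fixes_blocks P g \<Longrightarrow> pi g x = x" using HS_sym[OF assms] sym_iff by blast
  have "pi (transposition a b) x = x" if p: "p \<in> E P" "a \<in> E p" "b \<in> E p" for p a b
  proof (rule P(2), unfold fixes_blocks_def, intro conjI ballI)
    have A: "a \<in> E Atm" "b \<in> E Atm" using p cpartition_block(2)[OF P(1) p(1)] by auto
    show "perm (transposition a b)" by (rule transposition(1)[OF A])
    fix q assume q: "q \<in> E P"
    note B = cpartition_block[OF P(1) q]
    show "pi (transposition a b) q = q"
    proof (cases "q = p")
      case True then show ?thesis using transposition_set[OF B(5,4,2)] p by blast
    next
      case False
      then have "a \<notin> E q" "b \<notin> E q" using cpartition_disj[OF P(1) p(1) q] p by blast+
      show ?thesis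
      proof (rule pi_fix_set[OF transposition(1)[OF A] B(5,4)])
        fix z assume "z \<in> E q"
        then have "z \<in> E Atm" "z \<noteq> a" "z \<noteq> b" using B(2) \<open>a \<notin> E q\<close> \<open>b \<notin> E q\<close> by blast+
        then show "pi (transposition a b) z = z" by (rule transposition(4)[OF A])
      qed
    qed
  qed
  then show ?thesis using that P(1) by blast
qed

lemma uncountable_block: assumes P: "cpartition P" shows "\<exists>p\<in>E P. \<not> cnt (E p)"
proof (rule ccontr)
  assume "\<not> (\<exists>p\<in>E P. \<not> cnt (E p))"
  then have "cnt (\<Union>p\<in>E P. E p)"
    using cpartition_U[OF P] P cpartition_disj[OF P] by (intro cnt_Union[OF AC]) (auto simp: cpartition_def)
  moreover have "E Atm \<subseteq> (\<Union>p\<in>E P. E p)" using cpartition_cover[OF P] by blast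
  ultimately have "cnt (E Atm)" by (intro cnt_subset[of "E Atm"]) auto
  then show False using A_cnt by simp
qed

lemma support_block: assumes "x \<in> HS"
  obtains p where "p \<in> UM" "iset p" "E p \<subseteq> E Atm" "\<not> cnt (E p)" "\<And>a b. a \<in> E p \<Longrightarrow> b \<in> E p \<Longrightarrow> pi (transposition a b) x = x"
proof -
  obtain P where P: "cpartition P" "\<And>p a b. p \<in> E P \<Longrightarrow> a \<in> E p \<Longrightarrow> b \<in> E p \<Longrightarrow> pi (transposition a b) x = x" using support[OF assms] by metis
  obtain p where p: "p \<in> E P" "\<not> cnt (E p)" using uncountable_block[OF P(1)] by blast
  show ?thesis using that[OF cpartition_block(3,4,2)[OF P(1) p(1)] p(2)] P(2)[OF p(1)] by blast
qed

text \<open>The way in which a symmetry of \<open>f\<close> is exploited: it carries points of the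
  graph to points of the graph.\<close>

lemma move_pair: assumes f: "f \<in> HS" and g: "perm g" "pi g f = f" and p: "opair u v \<in> E f" "u \<in> UM" "v \<in> UM"
  shows "opair (pi g u) (pi g v) \<in> E f"
proof -
  have fW: "f \<in> W" using HS_W[OF f] .
  have "opair u v \<in> W" using W_elem[OF fW p(1)] .
  then have uv: "u \<in> W" "v \<in> W" using W_opair p by auto
  have "iset f" using isetI2[OF W_U[OF fW] p(1)] .
  then have "pi g (opair u v) \<in> E (pi g f)" using pi_set(2)[OF g(1) fW] p(1) by auto
  then show ?thesis using g pi_opair[OF g(1) uv] by simp
qed

lemma avoid: assumes "p \<in> UM" "\<not> cnt (E p)" "x \<in> UM" "y \<in> UM" obtains z where "z \<in> E p" "z \<noteq> x" "z \<noteq> y"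
proof -
  have "cnt {x, y}" by (intro cnt_insert cnt_empty assms)
  then have "\<not> E p \<subseteq> {x, y}" using cnt_subset[of "E p" "{x, y}"] assms by auto
  then show ?thesis using that by auto
qed

lemma V_bij: assumes "f \<in> HS" "X \<in> HS" "Y \<in> HS"
  shows "is_bij VM f X Y \<longleftrightarrow> func f (E X) (E Y) \<and> bij_betw (app f) (E X) (E Y)"
  using V.c_bij assms univ_V by simp

section \<open>Fixed-point-free permutations and doubling\<close>

lemma no_fixpoint_free_perm: assumes f: "f \<in> HS" "fixpoint_free_perm VM f Atm" shows False
proof -
  have fU: "f \<in> UM" using f HS_U by blast
  have F: "func f (E Atm) (E Atm)" "bij_betw (app f) (E Atm) (E Atm)"
    using f(2) V_bij[OF f(1) HS_Atm HS_Atm] unfolding fixpoint_free_perm_def by blast+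
  have ff: "opair a a \<notin> E f" if "a \<in> E Atm" for a
    using f that HS_atom[OF that] V.c_rel[of f a a] univ_V unfolding fixpoint_free_perm_def by simp
  note iff = func_iff[OF F(1) E_subset_U E_subset_U]
  obtain p where p: "p \<in> UM" "iset p" "E p \<subseteq> E Atm" "\<not> cnt (E p)" "\<And>a b. a \<in> E p \<Longrightarrow> b \<in> E p \<Longrightarrow> pi (transposition a b) f = f"
    using support_block[OF f(1)] by blast
  obtain a where a: "a \<in> E p" using avoid[OF p(1,4) zero_U zero_U] by blast
  define b where "b = app f a"
  have aA: "a \<in> E Atm" and aU: "a \<in> UM" using a p(3) E_U by auto
  have ab: "opair a b \<in> E f" unfolding b_def by (rule func_app[OF F(1) aA])
  have bA: "b \<in> E Atm" unfolding b_def using func_in[OF F(1) E_subset_U E_subset_U aA] .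
  have bU: "b \<in> UM" using bA E_U by blast
  have ne: "b \<noteq> a" using ff[OF aA] ab by auto
  obtain c where c: "c \<in> E p" "c \<noteq> a" "c \<noteq> b" using avoid[OF p(1,4) aU bU] by blast
  have cA: "c \<in> E Atm" and cU: "c \<in> UM" using c p(3) E_U by auto
  \<comment> \<open>If \<open>b\<close> lies in the block, it is moved while \<open>a\<close> stays,
    and \<open>f\<close> gets two values at \<open>a\<close>. Otherwise \<open>a\<close> is moved
    while \<open>b\<close> stays, and \<open>f\<close> takes the value \<open>b\<close>
    twice.\<close>
  show False
  proof (cases "b \<in> E p")
    case True
    have "opair (pi (transposition b c) a) (pi (transposition b c) b) \<in> E f"
      by (rule move_pair[OF f(1) transposition(1)[OF bA cA] p(5)[OF True c(1)] ab aU bU])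
    then have "opair a c \<in> E f" using transposition(2)[OF bA cA] transposition(4)[OF bA cA aA] ne c by simp
    then show False using iff[OF aU cU] b_def c by simp
  next
    case False
    have "opair (pi (transposition a c) a) (pi (transposition a c) b) \<in> E f"
      by (rule move_pair[OF f(1) transposition(1)[OF aA cA] p(5)[OF a c(1)] ab aU bU])
    then have "opair c b \<in> E f" using transposition(2)[OF aA cA] transposition(4)[OF aA cA bA] ne c by simp
    then have "app f c = app f a" using iff[OF cU bU] b_def by simp
    then show False using F(2) aA cA c by (auto simp: bij_betw_def inj_on_def)
  qed
qed

text \<open>A bijection of the model with one of its natural numbers is also an element of
  \<open>M\<close> and would count the atoms there.\<close>

lemma V_infinite_A: "infinite_set VM Atm"
  unfolding infinite_set_def
proof
  have "iset Atm"
  proof -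
    have "E Atm \<noteq> {}" using A_cnt cnt_empty by auto
    then show ?thesis by (intro isetI) auto
  qed
  then show "is_set VM Atm" using V.c_set HS_Atm univ_V by simp
  show "\<not> finite_set VM Atm"
  proof
    assume "finite_set VM Atm"
    then obtain n f where n: "n \<in> HS" "is_nat VM n" "f \<in> HS" "is_bij VM f Atm n"
      unfolding finite_set_def equipotent_def univ_V by blast
    have f: "func f (E Atm) (E n)" "bij_betw (app f) (E Atm) (E n)" using n V_bij[OF n(3) HS_Atm n(1)] by auto
    have nO: "n \<in> Om" using n V.c_nat univ_V Natl_Om by simp
    have "cnt (E Atm)"
    proof (rule cntI[of _ "app f"])
      show "T (\<lambda>e. app f (e 0))" by (intro def_intros HS_U[OF n(3)])
      show "app f x \<in> Om" if "x \<in> E Atm" for x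
        using func_in[OF f(1) E_subset_U E_subset_U that] Om_elem[OF nO] by blast
    qed (use f in \<open>auto simp: bij_betw_def\<close>)
    then show False using A_cnt by simp
  qed
qed

lemma not_EPWFP: "\<not> EPWFP VM"
  using no_fixpoint_free_perm V_infinite_A HS_Atm unfolding EPWFP_def univ_V by blast
lemma not_ISAE: "\<not> ISAE VM"
  using no_fixpoint_free_perm V_infinite_A HS_Atm unfolding ISAE_def univ_V by blast

lemma Ord_zero: "Ord zero" using Om_Ord Om_zero by blast

lemma not_form3: "\<not> form3 VM"
proof
  assume form3: "form3 VM"
  let ?i = "succ zero" let ?t = "succ (succ zero)"
  have O: "Ord ?i" "Ord ?t" using Ord_succ Ord_zero by auto
  have Et: "E ?t = {?i, zero}" by (simp add: E_succ E_zero)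
  have two: "is_two VM ?t"
    unfolding is_two_def univ_V
    by (intro bexI[of _ zero] bexI[of _ ?i])
      (simp_all add: V.c_zero V.c_succ univ_V HS_Ord Ord_zero O)
  define Y where "Y = mk (times (E Atm) (E ?t))"
  have EY: "E Y = times (E Atm) (E ?t)" unfolding Y_def by (intro E_mk small_times) simp_all
  have EYV: "E Y \<subseteq> HS" unfolding EY using HS_times[of "E Atm" "E ?t"] HS_elem[OF HS_Atm] HS_elem[OF HS_Ord[OF O(2)]] by blast
  have YV: "Y \<in> HS"
  proof (rule HS_ginv[OF _ EYV])
    fix g z assume g: "perm g" and "z \<in> E Y"
    then obtain a i where z: "a \<in> E Atm" "i \<in> E ?t" "z = opair a i" unfolding EY by (auto elim: timesE)
    have "pi g z = opair (pi g a) i"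
      using z pi_opair[OF g W_atom Ord_W] pi_Ord[OF g] Ord_elem[OF O(2)] by simp
    then show "pi g z \<in> E Y" unfolding EY using pi_atom_in[OF g z(1)] z by (simp add: timesI)
  qed (simp_all add: Y_def mk)
  have "is_product VM Atm ?t Y"
    using EY EYV V.c_product[of Atm ?t Y] univ_V HS_Atm YV HS_Ord[OF O(2)] mk(1) by (auto simp: Y_def)
  then have "equipotent VM Atm Y"
    using form3 V_infinite_A two HS_Atm HS_Ord[OF O(2)] YV unfolding form3_def univ_V by blast
  then obtain f where f: "f \<in> HS" "func f (E Atm) (E Y)" "bij_betw (app f) (E Atm) (E Y)"
    unfolding equipotent_def univ_V using V_bij HS_Atm YV by blast
  note iff = func_iff[OF f(2) E_subset_U E_subset_U]
  obtain p where p: "p \<in> UM" "iset p" "E p \<subseteq> E Atm" "\<not> cnt (E p)" "\<And>a b. a \<in> E p \<Longrightarrow> b \<in> E p \<Longrightarrow> pi (transposition a b) f = f"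
    using support_block[OF f(1)] by blast
  obtain a where a: "a \<in> E p" using avoid[OF p(1,4) zero_U zero_U] by blast
  have aA: "a \<in> E Atm" and aU: "a \<in> UM" using a p(3) E_U by auto
  have ex: "\<exists>b\<in>E Atm. opair b (opair a i) \<in> E f" if i: "i \<in> E ?t" for i
  proof -
    have "opair a i \<in> app f ` E Atm" using f(3) aA i unfolding bij_betw_def EY by (simp add: timesI)
    then obtain b where "b \<in> E Atm" "opair a i = app f b" by blast
    then show ?thesis using func_app[OF f(2)] by metis
  qed
  have zt: "zero \<in> E ?t" "?i \<in> E ?t" by (simp_all add: Et)
  obtain b0 b1 where b01: "b0 \<in> E Atm" "opair b0 (opair a zero) \<in> E f" "b1 \<in> E Atm" "opair b1 (opair a ?i) \<in> E f"
    using ex[OF zt(1)] ex[OF zt(2)] by blast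
  have zi: "zero \<noteq> ?i" using E_succ[of zero] E_zero by auto
  have "b0 \<noteq> b1"
  proof
    assume "b0 = b1"
    then have "opair a zero = opair a ?i" using b01 iff[of b0] E_U by simp
    then show False using zi aU by (simp add: opair_inj)
  qed
  \<comment> \<open>\<open>(a,0)\<close> and \<open>(a,1)\<close> have distinct preimages, so one of
    them differs from \<open>a\<close>. From here the two cases are those for permutations, the
    ordinal \<open>i\<close> staying fixed.\<close>
  then obtain b i where b: "b \<in> E Atm" "i \<in> E ?t" "opair b (opair a i) \<in> E f" "b \<noteq> a" using b01 zt by metis
  have oi: "Ord i" using Ord_elem[OF O(2) b(2)] .
  have U: "b \<in> UM" "i \<in> UM" using b oi E_U Ord_U by auto
  have mv: "pi g (opair a i) = opair (pi g a) i" if "perm g" for g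
    using pi_opair[OF that W_atom[OF aA] Ord_W[OF oi]] pi_Ord[OF that oi] by simp
  obtain c where c: "c \<in> E p" "c \<noteq> a" "c \<noteq> b" using avoid[OF p(1,4) aU U(1)] by blast
  have cA: "c \<in> E Atm" and cU: "c \<in> UM" using c p(3) E_U by auto
  show False
  proof (cases "b \<in> E p")
    case True
    have "opair (pi (transposition b c) b) (pi (transposition b c) (opair a i)) \<in> E f"
      by (rule move_pair[OF f(1) transposition(1)[OF b(1) cA] p(5)[OF True c(1)] b(3) U(1) opair_U])
    then have "opair c (opair a i) \<in> E f"
      using mv[OF transposition(1)[OF b(1) cA]] transposition(2)[OF b(1) cA] transposition(4)[OF b(1) cA aA] b c by simp
    then have "app f c = app f b" using b(3) iff[OF cU] iff[OF U(1)] by simp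
    then show False using f(3) b(1) cA c by (auto simp: bij_betw_def inj_on_def)
  next
    case False
    have "opair (pi (transposition a c) b) (pi (transposition a c) (opair a i)) \<in> E f"
      by (rule move_pair[OF f(1) transposition(1)[OF aA cA] p(5)[OF a c(1)] b(3) U(1) opair_U])
    then have "opair b (opair c i) \<in> E f"
      using mv[OF transposition(1)[OF aA cA]] transposition(2)[OF aA cA] transposition(4)[OF aA cA b(1)] b c by simp
    then have "opair a i = opair c i" using b(3) iff[OF U(1)] by simp
    then show False using aU cU U c by (simp add: opair_inj)
  qed
qed

text \<open>Swapping two atoms of the block fixes the order and turns \<open>a \<le> b\<close> into
  \<open>b \<le> a\<close>, against antisymmetry.\<close>

lemma no_linear_order: "\<not> (\<exists>r\<in>HS. is_linear_order VM Atm r)"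
proof
  assume "\<exists>r\<in>HS. is_linear_order VM Atm r"
  then obtain r where r: "r \<in> HS" "is_linear_order VM Atm r" by blast
  have rel: "rel VM r a b \<longleftrightarrow> opair a b \<in> E r" if "a \<in> E Atm" "b \<in> E Atm" for a b
    using V.c_rel[of r a b] univ_V r(1) HS_atom that by simp
  have as: "a = b" if "a \<in> E Atm" "b \<in> E Atm" "opair a b \<in> E r" "opair b a \<in> E r" for a b
    using r(2) that HS_atom rel unfolding is_linear_order_def univ_V by blast
  have tot: "opair a b \<in> E r \<or> opair b a \<in> E r" if "a \<in> E Atm" "b \<in> E Atm" for a b
  proof -
    have "a \<in> HS" "b \<in> HS" "mem VM a Atm" "mem VM b Atm" using that HS_atom V.mem_N univ_V by simp_all
    then have "rel VM r a b \<or> rel VM r b a" using r(2) unfolding is_linear_order_def univ_V by blast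
    then show ?thesis using rel that by simp
  qed
  obtain p where p: "p \<in> UM" "iset p" "E p \<subseteq> E Atm" "\<not> cnt (E p)" "\<And>a b. a \<in> E p \<Longrightarrow> b \<in> E p \<Longrightarrow> pi (transposition a b) r = r"
    using support_block[OF r(1)] by blast
  obtain a where a: "a \<in> E p" using avoid[OF p(1,4) zero_U zero_U] by blast
  have aA: "a \<in> E Atm" and aU: "a \<in> UM" using a p(3) E_U by auto
  obtain b where b: "b \<in> E p" "b \<noteq> a" using avoid[OF p(1,4) aU aU] by blast
  have bA: "b \<in> E Atm" and bU: "b \<in> UM" using b p(3) E_U by auto
  have g: "perm (transposition a b)" "pi (transposition a b) r = r" "pi (transposition a b) a = b" "pi (transposition a b) b = a"
    using transposition[OF aA bA] p(5)[OF a b(1)] by auto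
  have "opair a b \<in> E r \<Longrightarrow> opair b a \<in> E r" "opair b a \<in> E r \<Longrightarrow> opair a b \<in> E r"
    using move_pair[OF r(1) g(1,2), of a b] move_pair[OF r(1) g(1,2), of b a] aU bU g(3,4) by auto
  then have "opair a b \<in> E r" "opair b a \<in> E r" using tot[OF aA bA] by auto
  then show False using as[OF aA bA] b by simp
qed

section \<open>Comparison with \<open>\<omega>\<^sub>1\<close> and dependent choice\<close>

lemma no_inj_omega1_A: assumes f: "f \<in> HS" "func f COrd (E Atm)" "inj_on (app f) COrd" shows False
proof -
  have COU: "COrd \<subseteq> UM" using small_COrd small_U by auto
  note iff = func_iff[OF f(2) COU E_subset_U]
  obtain P where P: "cpartition P" "\<And>p a b. p \<in> E P \<Longrightarrow> a \<in> E p \<Longrightarrow> b \<in> E p \<Longrightarrow> pi (transposition a b) f = f"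
    using support[OF f(1)] by metis
  have in_A: "app f x \<in> E Atm" if "x \<in> COrd" for x using func_in[OF f(2) COU E_subset_U that] .
  \<comment> \<open>An ordinal is sent to the block of its value. If \<open>x\<close> and
    \<open>y\<close> go to the same block, swapping their values fixes \<open>f\<close> and the
    ordinal \<open>x\<close>, so both are values at \<open>x\<close> and coincide.\<close>
  define t where "t x = theU (\<lambda>p. p \<in> E P \<and> app f x \<in> E p)" for x
  have t: "t x \<in> E P" "app f x \<in> E (t x)" if x: "x \<in> COrd" for x
  proof -
    obtain p where p: "p \<in> E P" "app f x \<in> E p" using cpartition_cover[OF P(1) in_A[OF x]] by blast
    have "t x = p" unfolding t_def by (rule theU_I) (use p cpartition_disj[OF P(1)] E_U in blast)+
    then show "t x \<in> E P" "app f x \<in> E (t x)" using p by auto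
  qed
  have "cnt COrd"
  proof (rule cnt_inj[OF small_COrd, of t "E P"])
    show "T (\<lambda>e. t (e 0))" unfolding t_def by (intro def_intros cpartition_U[OF P(1)] HS_U[OF f(1)])
    show "cnt (E P)" using P(1) by (simp add: cpartition_def)
    show "inj_on t COrd"
    proof (rule inj_onI)
      fix x y assume xy: "x \<in> COrd" "y \<in> COrd" "t x = t y"
      let ?a = "app f x" let ?b = "app f y"
      have ox: "Ord x" "x \<in> UM" using xy by (auto simp: COrd_def)
      note g = transposition[OF in_A[OF xy(1)] in_A[OF xy(2)]]
      have "pi (transposition ?a ?b) f = f" using P(2)[OF t(1)[OF xy(1)] t(2)[OF xy(1)]] t(2)[OF xy(2)] xy(3) by simp
      then have "opair (pi (transposition ?a ?b) x) (pi (transposition ?a ?b) ?a) \<in> E f"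
        using move_pair[OF f(1) g(1) _ func_app[OF f(2) xy(1)] ox(2) app_U] by blast
      then have "opair x ?b \<in> E f" using g(2) pi_Ord[OF g(1) ox(1)] by simp
      then have "?a = ?b" using iff[OF ox(2), of ?b] by simp
      then show "x = y" using f(3) xy by (auto simp: inj_on_def)
    qed
  qed (rule t)
  then show False using uncountable_COrd by simp
qed

text \<open>Ordinal values stay fixed, so swapping two atoms of one block shows that they have the
  same value.\<close>

lemma no_inj_A_omega1: assumes f: "f \<in> HS" "func f (E Atm) COrd" "inj_on (app f) (E Atm)" shows False
proof -
  have COU: "COrd \<subseteq> UM" using small_COrd small_U by auto
  note iff = func_iff[OF f(2) E_subset_U COU]
  obtain p where p: "p \<in> UM" "iset p" "E p \<subseteq> E Atm" "\<not> cnt (E p)" "\<And>a b. a \<in> E p \<Longrightarrow> b \<in> E p \<Longrightarrow> pi (transposition a b) f = f"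
    using support_block[OF f(1)] by blast
  obtain a where a: "a \<in> E p" using avoid[OF p(1,4) zero_U zero_U] by blast
  have aA: "a \<in> E Atm" and aU: "a \<in> UM" using a p(3) E_U by auto
  obtain b where b: "b \<in> E p" "b \<noteq> a" using avoid[OF p(1,4) aU aU] by blast
  have bA: "b \<in> E Atm" and bU: "b \<in> UM" using b p(3) E_U by auto
  have oa: "Ord (app f a)" using func_in[OF f(2) E_subset_U COU aA] by (simp add: COrd_def)
  have "opair (pi (transposition a b) a) (pi (transposition a b) (app f a)) \<in> E f"
    by (rule move_pair[OF f(1) transposition(1)[OF aA bA] p(5)[OF a b(1)] func_app[OF f(2) aA] aU app_U])
  then have "opair b (app f a) \<in> E f" using transposition(2)[OF aA bA] pi_Ord[OF transposition(1)[OF aA bA] oa] by simp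
  then have "app f a = app f b" using iff[OF bU, of "app f a"] by simp
  then show False using f(3) aA bA b by (auto simp: inj_on_def)
qed

lemma omega1_HS: "omega1 \<in> HS" using HS_Ord[OF Ord_omega1] .

text \<open>The \<open>\<omega>\<close> of the model is that of \<open>M\<close>; only the supply of
  injections could differ, so these are required in \<open>HS\<close>.\<close>

lemma V_countable: assumes "x \<in> HS"
  shows "countable_set VM x \<longleftrightarrow> (\<exists>f\<in>HS. func f (E x) Om \<and> inj_on (app f) (E x))"
proof -
  have OmV: "n \<in> HS" if "n \<in> Om" for n using HS_Ord Om_Ord that by blast
  have omV: "om \<in> HS" using HS_Ord[OF Ord_om] .
  have o: "is_omega VM w \<longleftrightarrow> w = om" if w: "w \<in> HS" for w
  proof -
    have "is_omega VM w \<longleftrightarrow> iset w \<and> (\<forall>x\<in>univ VM. mem VM x w \<longleftrightarrow> x \<in> Om)"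
      using w V.c_set[of w] V.c_nat univ_V by (simp add: is_omega_def Natl_Om)
    also have "(\<forall>x\<in>univ VM. mem VM x w \<longleftrightarrow> x \<in> Om) \<longleftrightarrow> E w = {x. x \<in> Om}"
      using w OmV univ_V by (intro V.set_iff_N) auto
    also have "iset w \<and> E w = {x. x \<in> Om} \<longleftrightarrow> w = om"
      using set_eqI[of w om] om_iset E_om by auto
    finally show ?thesis .
  qed
  have "countable_set VM x \<longleftrightarrow> card_le VM x om" unfolding countable_set_def univ_V using o omV by blast
  also have "\<dots> \<longleftrightarrow> (\<exists>f\<in>HS. func f (E x) Om \<and> inj_on (app f) (E x))"
    using assms omV V.c_inj univ_V by (simp add: card_le_def E_om)
  finally show ?thesis .
qed

text \<open>An injection of a countable ordinal into \<open>\<omega>\<close> consists of pairs of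
  ordinals, so every permutation fixes it and it belongs to the model. Uncountability passes down
  from \<open>M\<close>.\<close>

lemma V_omega1: "is_omega1 VM omega1"
  unfolding is_omega1_def
proof (intro conjI ballI impI)
  show "is_ordinal VM omega1" using V.c_ord univ_V omega1_HS Ord_omega1 by simp
  show "\<not> countable_set VM omega1"
    using V_countable[OF omega1_HS] uncountable_COrd HS_U small_COrd unfolding E_omega1 cnt_def by blast
  fix x assume x: "x \<in> univ VM" "mem VM x omega1"
  then have xC: "x \<in> COrd" using V.mem_N univ_V E_omega1 by simp
  then obtain f where f: "f \<in> UM" "func f (E x) Om" "inj_on (app f) (E x)" using cntE[of "E x"] unfolding COrd_def by blast
  have ox: "Ord x" using xC by (simp add: COrd_def)
  have el: "\<exists>a b. Ord a \<and> Ord b \<and> z = opair a b" if "z \<in> E f" for z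
    using that f(2) Ord_elem[OF ox] Om_Ord unfolding func_def times_def by blast
  have "f \<in> HS"
  proof (rule HS_ginv[OF f(1)])
    show "E f \<subseteq> HS" using el HS_opair HS_Ord by blast
    show "iset f" using f(2) by (simp add: func_def)
    fix g z assume g: "perm g" and z: "z \<in> E f"
    obtain a b where "Ord a" "Ord b" "z = opair a b" using el[OF z] by blast
    then show "pi g z \<in> E f" using z pi_opair[OF g Ord_W Ord_W, of a b] pi_Ord[OF g] by simp
  qed
  then show "countable_set VM x" using V_countable x(1) f univ_V by blast
qed

lemma not_W: "\<not> W_aleph1 VM"
proof
  assume "W_aleph1 VM"
  then have "card_le VM Atm omega1 \<or> card_le VM omega1 Atm"
    using V_omega1 omega1_HS HS_Atm V_infinite_A unfolding W_aleph1_def univ_V infinite_set_def by blast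
  then show False
    using no_inj_A_omega1 no_inj_omega1_A V.c_inj omega1_HS HS_Atm univ_V unfolding card_le_def univ_V by (auto simp: E_omega1)
qed

text \<open>The range is a support: a permutation fixing it pointwise fixes each pair of the
  sequence. The least index at which a value occurs counts the range.\<close>

lemma countable_func_HS: assumes b: "b \<in> COrd" and s: "s \<in> UM" "func s (E b) (E Atm)" shows "s \<in> HS" "cnt (app s ` E b)"
proof -
  have bU: "b \<in> UM" "Ord b" "cnt (E b)" using b by (auto simp: COrd_def)
  have rng: "app s ` E b \<subseteq> E Atm" using func_in[OF s(2) E_subset_U E_subset_U] by blast
  have sr: "small (app s ` E b)" by (rule small_image) (simp add: bU, intro def_intros s)
  define S where "S a = {x\<in>E b. app s x = a}" for a
  have sS: "small (S a)" if "a \<in> UM" for a unfolding S_def by (rule small_sep) (simp add: bU, intro def_intros that s)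
  have L: "least_elt (S a) \<in> S a" if "a \<in> app s ` E b" for a
  proof (rule least_elt(1)[OF sS])
    show "a \<in> UM" using that by auto
    show "S a \<noteq> {}" using that by (auto simp: S_def)
    show "Ord x" if "x \<in> S a" for x using that Ord_elem[OF bU(2)] by (auto simp: S_def)
  qed
  show c: "cnt (app s ` E b)"
  proof (rule cnt_inj[OF sr, of "\<lambda>a. least_elt (S a)" "E b"])
    show "T (\<lambda>e. least_elt (S (e 0)))" unfolding least_elt_def S_def mem_Collect_eq by (intro def_intros bU s)
    show "least_elt (S a) \<in> E b" if "a \<in> app s ` E b" for a using L[OF that] by (simp add: S_def)
    show "inj_on (\<lambda>a. least_elt (S a)) (app s ` E b)"
    proof (rule inj_onI)
      fix a a' assume "a \<in> app s ` E b" "a' \<in> app s ` E b" "least_elt (S a) = least_elt (S a')"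
      then show "a = a'" using L[of a] L[of a'] by (auto simp: S_def)
    qed
  qed (rule bU)
  have el: "\<exists>x\<in>E b. z = opair x (app s x)" if "z \<in> E s" for z
    using that func_E[OF s(2) E_subset_U E_subset_U] by blast
  show "s \<in> HS"
  proof (rule HS_inv[OF c rng s(1)])
    show "E s \<subseteq> HS" using el HS_opair HS_Ord Ord_elem[OF bU(2)] HS_atom rng by blast
    show "iset s" using s(2) by (simp add: func_def)
    fix g z assume g: "perm g" "\<And>a. a \<in> app s ` E b \<Longrightarrow> pi g a = a" and z: "z \<in> E s"
    obtain x where x: "x \<in> E b" "z = opair x (app s x)" using el[OF z] by blast
    have "pi g z = opair (pi g x) (pi g (app s x))"
      unfolding x(2) using x(1) rng by (intro pi_opair[OF g(1) Ord_W[OF Ord_elem[OF bU(2) x(1)]]] W_atom) blast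
    then show "pi g z \<in> E s" using z x g pi_Ord[OF g(1) Ord_elem[OF bU(2) x(1)]] by auto
  qed
qed

lemma not_DC: "\<not> DC_aleph1 VM"
proof
  assume DC: "DC_aleph1 VM"
  have COU: "COrd \<subseteq> UM" using small_COrd small_U by auto
  \<comment> \<open>A set large enough to contain all sequences of atoms of countable length, seen
    as subsets of \<open>COrd \<times> A\<close>.\<close>
  define B where "B = mk {y. iset y \<and> E y \<subseteq> times COrd (E Atm)}"
  have EB: "E B = {y. iset y \<and> E y \<subseteq> times COrd (E Atm)}" unfolding B_def
    by (intro E_mk small_Pow small_times small_COrd) simp
  have BU: "B \<in> UM" by (simp add: B_def)
  let ?Q = "\<lambda>p. \<exists>s\<in>E B. \<exists>y\<in>E Atm. p = opair s y \<and> (\<exists>b\<in>E omega1. func s (E b) (E Atm) \<and> (\<forall>x\<in>E b. app s x \<noteq> y))"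
  define R where "R = mk {p\<in>times (E B) (E Atm). ?Q p}"
  have sR: "small {p\<in>times (E B) (E Atm). ?Q p}"
    by (rule small_sep) (simp_all add: small_times BU, intro def_intros BU Atm_U omega1_U)
  have ER: "p \<in> E R \<longleftrightarrow> ?Q p" for p unfolding R_def E_mk[OF sR] by (auto intro: timesI)
  have sB: "s \<in> E B" if "b \<in> COrd" "func s (E b) (E Atm)" for s b
  proof -
    have "E b \<subseteq> COrd" using Ord_sub[OF Ord_omega1] that(1) unfolding E_omega1 by blast
    then have "times (E b) (E Atm) \<subseteq> times COrd (E Atm)" by (auto simp: times_def)
    then show ?thesis using that(2) unfolding EB func_def by blast
  qed
  have sV: "s \<in> HS" if "b \<in> COrd" "func s (E b) (E Atm)" for s b
    using countable_func_HS(1)[OF that(1) _ that(2)] E_U[OF sB[OF that]] by blast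
  have RV: "R \<in> HS"
  proof (rule HS_ginv)
    show "R \<in> UM" "iset R" by (simp_all add: R_def mk)
    show "E R \<subseteq> HS"
    proof
      fix z assume "z \<in> E R"
      then obtain s y b where z: "y \<in> E Atm" "z = opair s y" "b \<in> E omega1" "func s (E b) (E Atm)"
        unfolding ER by blast
      have "s \<in> HS" using z sV E_omega1 by blast
      then show "z \<in> HS" unfolding z(2) using HS_atom[OF z(1)] by (rule HS_opair)
    qed
    fix g z assume g: "perm g" and "z \<in> E R"
    then obtain s y b where z: "s \<in> E B" "y \<in> E Atm" "z = opair s y" "b \<in> E omega1" "func s (E b) (E Atm)" "\<forall>x\<in>E b. app s x \<noteq> y"
      using ER by blast
    have bC: "b \<in> COrd" using z E_omega1 by simp
    have ob: "Ord x" if "x \<in> E b" for x using that bC Ord_elem by (auto simp: COrd_def)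
    have sW: "s \<in> W" "iset s" using sV[OF bC z(5)] HS_W z(5) by (auto simp: func_def)
    have pz: "pi g z = opair (pi g s) (pi g y)" unfolding z(3) by (rule pi_opair[OF g sW(1) W_atom[OF z(2)]])
    have sA: "app s x \<in> E Atm" if "x \<in> E b" for x using func_in[OF z(5) E_subset_U E_subset_U that] .
    have "E (pi g s) = (\<lambda>x. opair x (pi g (app s x))) ` E b"
      unfolding pi_set(2)[OF g sW] func_E[OF z(5) E_subset_U E_subset_U] image_image
      by (rule image_cong[OF refl]) (simp add: pi_opair[OF g Ord_W[OF ob] W_atom[OF sA]] pi_Ord[OF g ob])
    note fs = funcI[OF pi_set(1)[OF g sW] this, of "E Atm"]
    have f: "func (pi g s) (E b) (E Atm)" and a: "\<And>x. x \<in> E b \<Longrightarrow> app (pi g s) x = pi g (app s x)"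
      using fs pi_atom_in[OF g sA] E_subset_U by blast+
    have "app (pi g s) x \<noteq> pi g y" if "x \<in> E b" for x
      using a[OF that] pi_inj[OF g W_atom[OF sA[OF that]] W_atom[OF z(2)]] z(6) that by auto
    then show "pi g z \<in> E R" unfolding ER pz
      using sB[OF bC f] pi_atom_in[OF g z(2)] z(4) f by blast
  qed
  have relR: "rel VM R s y \<longleftrightarrow> opair s y \<in> E R" if "s \<in> HS" "y \<in> HS" for s y
    using V.c_rel univ_V RV that by simp
  have 1: "nonempty VM Atm" using V.c_nonempty univ_V HS_Atm A_cnt cnt_empty by auto
  have 2: "is_relation VM R"
  proof -
    have "iset R" by (simp add: R_def mk)
    moreover have "\<exists>x\<in>UM. \<exists>y\<in>UM. p = opair x y" if "p \<in> E R" for p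
      using that E_U unfolding ER by blast
    ultimately show ?thesis using V.c_relation univ_V RV by simp
  qed
  have 3: "\<exists>y\<in>HS. mem VM y Atm \<and> rel VM R s y" if b: "b \<in> HS" "s \<in> HS" "mem VM b omega1 \<and> is_fun VM s b Atm" for b s
  proof -
    have bC: "b \<in> COrd" using V.mem_N[of b omega1] univ_V b E_omega1 by simp
    have s: "func s (E b) (E Atm)" using V.c_fun univ_V b HS_Atm by simp
    \<comment> \<open>The range of a countable sequence is countable and cannot exhaust the atoms,
      so a next value exists.\<close>
    have "\<not> E Atm \<subseteq> app s ` E b"
      using countable_func_HS(2)[OF bC HS_U[OF b(2)] s] A_cnt cnt_subset[of "E Atm"] by auto
    then obtain y where y: "y \<in> E Atm" "y \<notin> app s ` E b" by blast
    then have "opair s y \<in> E R" unfolding ER using sB[OF bC s] s bC unfolding E_omega1 by blast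
    then show ?thesis using relR b y HS_atom V.mem_N univ_V by (intro bexI[of _ y]) simp_all
  qed
  have "\<exists>f\<in>HS. is_fun VM f omega1 Atm \<and> (\<forall>b\<in>HS. \<forall>s\<in>HS. \<forall>y\<in>HS. mem VM b omega1 \<and> is_restr VM f b s \<and> rel VM f b y \<longrightarrow> rel VM R s y)"
    using DC[unfolded DC_aleph1_def univ_V, rule_format, OF omega1_HS V_omega1 HS_Atm RV] 1 2 3 by simp
  then obtain f where f: "f \<in> HS" "is_fun VM f omega1 Atm"
    "\<And>b s y. b \<in> HS \<Longrightarrow> s \<in> HS \<Longrightarrow> y \<in> HS \<Longrightarrow> mem VM b omega1 \<Longrightarrow> is_restr VM f b s \<Longrightarrow> rel VM f b y \<Longrightarrow> rel VM R s y"
    by blast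
  have ff: "func f COrd (E Atm)" using V.c_fun univ_V f(1,2) omega1_HS HS_Atm E_omega1 by simp
  have fA: "app f x \<in> E Atm" if "x \<in> COrd" for x using func_in[OF ff COU E_subset_U that] .
  \<comment> \<open>The restriction of \<open>f\<close> to \<open>b\<close> is a sequence of the
    model and stands in the relation to \<open>f(b)\<close>; hence \<open>f(b)\<close> differs from
    all earlier values, and \<open>f\<close> is injective.\<close>
  have new: "app f x \<noteq> app f b" if b: "b \<in> COrd" "x \<in> E b" for b x
  proof -
    have bV: "b \<in> HS" "b \<in> UM" "Ord b" using b(1) HS_Ord by (auto simp: COrd_def)
    have sub: "E b \<subseteq> COrd" using Ord_sub[OF Ord_omega1] b(1) unfolding E_omega1 by blast
    define s where "s = graph (app f) (E b)"
    have sm: "small (E b)" using bV by simp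
    have T: "T (\<lambda>e. app f (e 0))" by (intro def_intros HS_U[OF f(1)])
    note gr = graph[OF sm T, folded s_def]
    have sfn: "func s (E b) (E Atm)" using gr(3)[of "E Atm"] fA sub E_subset_U by blast
    have sVV: "s \<in> HS" using sV[OF b(1) sfn] .
    have "is_restr VM f b s"
    proof -
      have "E s = {p\<in>E f. \<exists>x\<in>E b. \<exists>y\<in>UM. p = opair x y}"
      proof (intro equalityI subsetI)
        fix p assume "p \<in> E s"
        then obtain x where "x \<in> E b" "p = opair x (app f x)" using gr(1) by blast
        then show "p \<in> {p\<in>E f. \<exists>x\<in>E b. \<exists>y\<in>UM. p = opair x y}" using func_app[OF ff] sub app_U by blast
      next
        fix p assume "p \<in> {p\<in>E f. \<exists>x\<in>E b. \<exists>y\<in>UM. p = opair x y}"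
        then obtain x y where "opair x y \<in> E f" "x \<in> E b" "y \<in> UM" "p = opair x y" by blast
        then show "p \<in> E s" using func_iff[OF ff COU E_subset_U, of x y] E_U gr(1) by blast
      qed
      then show ?thesis using V.c_restr univ_V f(1) bV(1) sVV gr(2) by simp
    qed
    moreover have "rel VM f b (app f b)"
      using V.c_rel univ_V f(1) bV(1) HS_atom[OF fA[OF b(1)]] func_app[OF ff b(1)] by simp
    moreover have "mem VM b omega1" using V.mem_N univ_V bV(1) b(1) E_omega1 by simp
    ultimately have "rel VM R s (app f b)" using f(3)[OF bV(1) sVV HS_atom[OF fA[OF b(1)]]] by blast
    then have "opair s (app f b) \<in> E R" using relR sVV HS_atom[OF fA[OF b(1)]] by simp
    then obtain s' y b' where q: "s' \<in> E B" "y \<in> E Atm" "opair s (app f b) = opair s' y" "b' \<in> E omega1" "func s' (E b') (E Atm)" "\<forall>x\<in>E b'. app s' x \<noteq> y"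
      unfolding ER by blast
    have e: "s' = s" "y = app f b" using q opair_inj[of s "app f b" s' y] E_U HS_U[OF sVV] by auto
    have "opair x (app s x) \<in> E s" using func_app[OF sfn b(2)] .
    then have "x \<in> E b'" using func_iff[OF q(5)[unfolded e] E_subset_U E_subset_U, of x "app s x"] E_U[OF b(2)] by simp
    then show ?thesis using q(6) e gr(4)[OF b(2)] by auto
  qed
  have "inj_on (app f) COrd"
  proof (rule inj_onI)
    fix x y assume xy: "x \<in> COrd" "y \<in> COrd" "app f x = app f y"
    then show "x = y" using Ord_tri[of x y] new[of x y] new[of y x] by (auto simp: COrd_def)
  qed
  then show False using no_inj_omega1_A[OF f(1) ff] by blast
qed

text \<open>The family consists of all \<open>n\<close>-element sets of atoms. One of them lies
  inside an uncountable block of a support of the choice function; swapping the chosen atom with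
  another element preserves the set but not the choice.\<close>

lemma not_AC_n: assumes n: "n \<in> HS" "is_nat VM n" and t: "t \<in> HS" "is_two VM t" "mem VM t n \<or> t = n" shows "\<not> AC_n VM n"
proof
  assume ACn: "AC_n VM n"
  have nO: "n \<in> Om" using n V.c_nat univ_V Natl_Om by simp
  have on: "Ord n" and nU: "n \<in> UM" using Om_Ord[OF nO] Om_U[OF nO] .
  let ?i = "succ zero"
  have tt: "t = succ ?i"
  proof -
    obtain z u where "z \<in> HS" "u \<in> HS" "is_zero VM z" "is_succ VM z u" "is_succ VM u t"
      using t(2) unfolding is_two_def univ_V by blast
    then show ?thesis using V.c_zero V.c_succ univ_V t(1) by simp
  qed
  have zi: "zero \<noteq> ?i" using E_succ[of zero] E_zero by auto
  \<comment> \<open>The hypothesis on \<open>t\<close> says \<open>n \<ge> 2\<close>; so 0 and 1 are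
    elements of \<open>n\<close>, which later yields two distinct elements of the chosen
    set.\<close>
  have "E t \<subseteq> E n" using t(3) V.mem_N[of t n] univ_V t(1) Ord_sub[OF on] by auto
  then have in_n: "zero \<in> E n" "?i \<in> E n" unfolding tt by (simp_all add: E_succ)
  define B where "B = mk {y. iset y \<and> E y \<subseteq> E Atm}"
  have EB: "E B = {y. iset y \<and> E y \<subseteq> E Atm}" unfolding B_def by (intro E_mk small_Pow) simp
  \<comment> \<open>Surjectivity is spelled out with quantifiers, as the definability rules cover
    \<open>inj_on\<close> but not \<open>bij_betw\<close>.\<close>
  define X where "X = mk {x\<in>E B. \<exists>h\<in>UM. func h (E x) (E n) \<and> inj_on (app h) (E x) \<and> (\<forall>y\<in>E n. \<exists>z\<in>E x. app h z = y)}"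
  have sX: "small {x\<in>E B. \<exists>h\<in>UM. func h (E x) (E n) \<and> inj_on (app h) (E x) \<and> (\<forall>y\<in>E n. \<exists>z\<in>E x. app h z = y)}"
    by (rule small_sep) (simp add: B_def, intro def_intros nU)
  note EX0 = E_mk[OF sX, folded X_def]
  have EX: "x \<in> E X \<longleftrightarrow> iset x \<and> E x \<subseteq> E Atm \<and> (\<exists>h\<in>UM. func h (E x) (E n) \<and> bij_betw (app h) (E x) (E n))" for x
  proof -
    have bij: "inj_on (app h) (E x) \<and> (\<forall>y\<in>E n. \<exists>z\<in>E x. app h z = y) \<longleftrightarrow> bij_betw (app h) (E x) (E n)"
      if h: "func h (E x) (E n)" for h
    proof -
      have sub: "app h ` E x \<subseteq> E n" using func_in[OF h E_subset_U E_subset_U] by blast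
      have 1: "(\<forall>y\<in>E n. \<exists>z\<in>E x. app h z = y) \<longleftrightarrow> E n \<subseteq> app h ` E x" by (auto simp: image_def)
      have 2: "app h ` E x = E n \<longleftrightarrow> E n \<subseteq> app h ` E x" using sub by (metis subset_antisym order_refl)
      show ?thesis unfolding bij_betw_def 1 2 by (rule refl)
    qed
    have "(\<exists>h\<in>UM. func h (E x) (E n) \<and> inj_on (app h) (E x) \<and> (\<forall>y\<in>E n. \<exists>z\<in>E x. app h z = y)) \<longleftrightarrow>
      (\<exists>h\<in>UM. func h (E x) (E n) \<and> bij_betw (app h) (E x) (E n))"
      by (intro bex_cong refl conj_cong bij)
    then show ?thesis unfolding EX0 mem_Collect_eq EB by (simp only: conj_assoc)
  qed
  have cx: "cnt (E x)" if x: "x \<in> E X" for x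
  proof -
    obtain h where h: "h \<in> UM" "func h (E x) (E n)" "bij_betw (app h) (E x) (E n)" using x EX by blast
    show ?thesis
    proof (rule cntI[of _ "app h"])
      show "T (\<lambda>e. app h (e 0))" by (intro def_intros h)
      show "app h y \<in> Om" if "y \<in> E x" for y using func_in[OF h(2) E_subset_U E_subset_U that] Om_elem[OF nO] by blast
    qed (use h E_U[OF x] in \<open>auto simp: bij_betw_def\<close>)
  qed
  have xV: "x \<in> HS" if x: "x \<in> E X" for x
  proof (rule HS_inv[OF cx[OF x]])
    show "E x \<subseteq> E Atm" "iset x" "x \<in> UM" using x EX E_U by auto
    then show "E x \<subseteq> HS" using HS_atom by blast
  qed auto
  have xeq: "equipotent VM x n" if x: "x \<in> E X" for x
  proof -
    obtain h where h: "h \<in> UM" "func h (E x) (E n)" "bij_betw (app h) (E x) (E n)" using x EX by blast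
    have xA: "E x \<subseteq> E Atm" using x EX by blast
    have el: "\<exists>a\<in>E x. z = opair a (app h a) \<and> Ord (app h a)" if "z \<in> E h" for z
      using that func_E[OF h(2) E_subset_U E_subset_U] func_in[OF h(2) E_subset_U E_subset_U] Ord_elem[OF on] by blast
    have "h \<in> HS"
    proof (rule HS_inv[OF cx[OF x] xA h(1)])
      show "E h \<subseteq> HS" using el HS_opair HS_atom xA HS_Ord by blast
      show "iset h" using h(2) by (simp add: func_def)
      fix g z assume g: "perm g" "\<And>a. a \<in> E x \<Longrightarrow> pi g a = a" and z: "z \<in> E h"
      obtain a where a: "a \<in> E x" "z = opair a (app h a)" "Ord (app h a)" using el[OF z] by blast
      have "pi g z = opair (pi g a) (pi g (app h a))" unfolding a(2)
        using a(1) xA W_atom by (intro pi_opair[OF g(1) _ Ord_W[OF a(3)]]) blast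
      then show "pi g z \<in> E h" using z a g(2)[OF a(1)] pi_Ord[OF g(1) a(3)] by simp
    qed
    then show ?thesis unfolding equipotent_def univ_V using V_bij[OF _ xV[OF x] n(1)] h by blast
  qed
  have XV: "X \<in> HS"
  proof (rule HS_ginv)
    show "X \<in> UM" "iset X" by (simp_all add: X_def mk)
    show "E X \<subseteq> HS" using xV by blast
    fix g x assume g: "perm g" and x: "x \<in> E X"
    have xs: "iset x" "E x \<subseteq> E Atm" "x \<in> W" using x EX xV HS_W by blast+
    obtain h where h: "h \<in> UM" "func h (E x) (E n)" "bij_betw (app h) (E x) (E n)" using x EX by blast
    \<comment> \<open>Composition with the inverse of \<open>g\<close> carries the bijection with
      \<open>n\<close> over to \<open>pi g x\<close>.\<close>
    obtain k where k: "perm k" "\<And>a. a \<in> E Atm \<Longrightarrow> app k (app g a) = a" using perm_inv[OF g] by metis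
    have Eg: "E (pi g x) = pi g ` E x" and ig: "iset (pi g x)" by (fact pi_set[OF g xs(3,1)])+
    have ka: "app k (pi g a) = a" if "a \<in> E x" for a using k(2)[of a] pi_atom[OF g, of a] xs(2) that by auto
    have T: "T (\<lambda>e. app h (app k (e 0)))" by (intro def_intros h perm_U[OF k(1)])
    have sm: "small (E (pi g x))" by simp
    have b: "bij_betw (\<lambda>y. app h (app k y)) (E (pi g x)) (E n)"
    proof -
      have "inj_on (app k) (pi g ` E x)" "app k ` pi g ` E x = E x" using ka by (auto simp: inj_on_def image_image)
      then have "bij_betw (app k) (E (pi g x)) (E x)" unfolding Eg bij_betw_def by blast
      from bij_betw_trans[OF this h(3)] show ?thesis by (simp add: comp_def)
    qed
    let ?h = "graph (\<lambda>y. app h (app k y)) (E (pi g x))"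
    have "func ?h (E (pi g x)) (E n)"
      by (rule graph(3)[OF sm T]) (use b E_subset_U in \<open>auto simp: bij_betw_def\<close>)
    moreover have "bij_betw (app ?h) (E (pi g x)) (E n)"
      using b graph(4)[OF sm T] by (subst bij_betw_cong[of _ _ "\<lambda>y. app h (app k y)"]) auto
    moreover have "E (pi g x) \<subseteq> E Atm" unfolding Eg using xs(2) pi_atom_in[OF g] by blast
    ultimately show "pi g x \<in> E X" unfolding EX using ig graph_U by blast
  qed
  have "is_set VM X" using V.c_set univ_V XV by (simp add: X_def mk)
  moreover have "is_set VM x \<and> equipotent VM x n" if "x \<in> HS" "mem VM x X" for x
  proof -
    have "x \<in> E X" using that V.mem_N univ_V by simp
    then show ?thesis using xeq EX V.c_set univ_V that by simp
  qed
  ultimately obtain f where f: "f \<in> HS" "is_choice VM f X" using ACn XV unfolding AC_n_def univ_V by blast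
  obtain Y where Y: "Y \<in> HS" "func f (E X) (E Y)" using f V.c_fun XV univ_V unfolding is_choice_def by auto
  obtain p where p: "p \<in> UM" "iset p" "E p \<subseteq> E Atm" "\<not> cnt (E p)" "\<And>a b. a \<in> E p \<Longrightarrow> b \<in> E p \<Longrightarrow> pi (transposition a b) f = f"
    using support_block[OF f(1)] by blast
  \<comment> \<open>The image of an internal injection of \<open>n\<close> into the block is the
    \<open>n\<close>-element set to which the transposition argument applies.\<close>
  obtain h where h: "h \<in> UM" "func h (E n) (E p)" "inj_on (app h) (E n)" using uncountable_inj[OF p(1,4) nO] by blast
  define x where "x = mk (app h ` E n)"
  have sx: "small (app h ` E n)" by (rule small_image) (simp add: nU, intro def_intros h)
  have Ex: "E x = app h ` E n" unfolding x_def by (rule E_mk[OF sx])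
  have xs: "iset x" "x \<in> UM" by (simp_all add: x_def mk)
  have xp: "E x \<subseteq> E p" unfolding Ex using func_in[OF h(2) E_subset_U E_subset_U] by blast
  have xX: "x \<in> E X"
  proof -
    define u where "u y = theU (\<lambda>k. k \<in> E n \<and> app h k = y)" for y
    have u: "u (app h k) = k" if "k \<in> E n" for k unfolding u_def
      by (rule theU_I) (use that h(3) E_U in \<open>auto simp: inj_on_def\<close>)
    have T: "T (\<lambda>e. u (e 0))" unfolding u_def by (intro def_intros h nU)
    have b: "bij_betw u (E x) (E n)"
      by (rule bij_betw_byWitness[where f' = "app h"]) (use u in \<open>auto simp: Ex\<close>)
    have sm: "small (E x)" using xs by simp
    have "func (graph u (E x)) (E x) (E n)"
      by (rule graph(3)[OF sm T]) (use b E_subset_U in \<open>auto simp: bij_betw_def\<close>)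
    moreover have "bij_betw (app (graph u (E x))) (E x) (E n)"
      using b graph(4)[OF sm T] by (subst bij_betw_cong[of _ _ u]) auto
    ultimately show ?thesis unfolding EX using xs(1) xp p(3) graph_U by blast
  qed
  have xW: "x \<in> W" using xV[OF xX] HS_W by blast
  define a where "a = app f x"
  have xa: "opair x a \<in> E f" unfolding a_def by (rule func_app[OF Y(2) xX])
  have aV: "a \<in> HS" using V.opair_N[of x a] HS_elem[OF f(1) xa] xs(2) univ_V by (simp add: a_def)
  have ax: "a \<in> E x"
  proof -
    have "rel VM f x a" using V.c_rel univ_V f(1) xV[OF xX] aV xa by simp
    then have "mem VM a x" using f(2) xV[OF xX] aV unfolding is_choice_def univ_V by blast
    then show ?thesis using V.mem_N univ_V aV by simp
  qed
  have "app h zero \<noteq> app h ?i" using h(3) in_n zi by (auto simp: inj_on_def)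
  then obtain b where b: "b \<in> E x" "b \<noteq> a" using in_n unfolding Ex by blast
  have A: "a \<in> E Atm" "b \<in> E Atm" using ax b xp p(3) by auto
  have "pi (transposition a b) x = x" using transposition_set[OF xW xs(1)] ax b xp p(3) by blast
  moreover have "opair (pi (transposition a b) x) (pi (transposition a b) a) \<in> E f"
    by (rule move_pair[OF f(1) transposition(1)[OF A] p(5) xa xs(2)]) (use ax b xp HS_U[OF aV] in auto)
  ultimately have "opair x b \<in> E f" using transposition(2)[OF A] by simp
  then have "b = a" using func_iff[OF Y(2) E_subset_U E_subset_U xs(2), of b] E_U[OF A(2)] by (simp add: a_def)
  then show False using b by simp
qed

section \<open>The partition filter and countable supports\<close>

lemma subgroup_comp: assumes "is_subgroup M G H"
  shows "g \<in> UM \<Longrightarrow> h \<in> UM \<Longrightarrow> k \<in> UM \<Longrightarrow> mem M g H \<Longrightarrow> mem M h H \<Longrightarrow> is_comp M g h k \<Longrightarrow> mem M k H"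
proof -
  have "\<forall>g\<in>UM. \<forall>h\<in>UM. \<forall>k\<in>UM. mem M g H \<and> mem M h H \<and> is_comp M g h k \<longrightarrow> mem M k H"
    using assms unfolding is_subgroup_def by (elim conjE)
  then show "g \<in> UM \<Longrightarrow> h \<in> UM \<Longrightarrow> k \<in> UM \<Longrightarrow> mem M g H \<Longrightarrow> mem M h H \<Longrightarrow> is_comp M g h k \<Longrightarrow> mem M k H"
    by meson
qed
lemma subgroup_inverse: assumes "is_subgroup M G H"
  shows "g \<in> UM \<Longrightarrow> k \<in> UM \<Longrightarrow> mem M g H \<Longrightarrow> is_inverse M g k \<Longrightarrow> mem M k H"
proof -
  have "\<forall>g\<in>UM. \<forall>k\<in>UM. mem M g H \<and> is_inverse M g k \<longrightarrow> mem M k H"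
    using assms unfolding is_subgroup_def by (elim conjE)
  then show "g \<in> UM \<Longrightarrow> k \<in> UM \<Longrightarrow> mem M g H \<Longrightarrow> is_inverse M g k \<Longrightarrow> mem M k H"
    by meson
qed

text \<open>Minimality of the support filter compares it with filters only, so its inclusion in
  \<open>F\<close> requires this fact. Closure under intersection comes from common
  refinements.\<close>

lemma F_is_filter: "is_filter M G F"
  unfolding is_filter_def
proof (intro conjI ballI impI)
  show "is_set M F" using F_filter by (simp add: is_countable_partition_filter_def)
  have iG: "iset G" using G_full by (simp add: is_full_sym_group_def)
  obtain P0 where "cpartition P0" using cpartition_countable_set[OF cnt_empty empty_subsetI] by metis
  moreover have "is_subgroup M G G" by (rule subgroup_fixing[of G "{}"]) (use G_U iG G_iff in auto)
  ultimately have "G \<in> E F" unfolding F_iff using G_U G_iff by (auto simp: fixes_blocks_def)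
  then show "mem M G F" by (simp add: E_def)
next
  fix H assume "H \<in> UM" "mem M H F"
  then show "is_subgroup M G H" using F_iff self.mem_N by blast
next
  fix H K assume U: "H \<in> UM" "K \<in> UM" and a: "mem M H F \<and> is_subgroup M G K \<and> sub M H K"
  have "E H \<subseteq> E K" using a U by (simp add: self.c_sub)
  moreover obtain P where "cpartition P" "\<forall>g. fixes_blocks P g \<longrightarrow> g \<in> E H" using a U F_iff self.mem_N by blast
  ultimately have "K \<in> E F" unfolding F_iff using U a by blast
  then show "mem M K F" by (simp add: E_def)
next
  fix H K L assume U: "H \<in> UM" "K \<in> UM" "L \<in> UM"
    and a: "mem M H F \<and> mem M K F \<and> is_set M L \<and> (\<forall>g\<in>UM. mem M g L \<longleftrightarrow> mem M g H \<and> mem M g K)"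
  have HK: "H \<in> E F" "K \<in> E F" using a U self.mem_N by blast+
  obtain P where P: "cpartition P" "\<forall>g. fixes_blocks P g \<longrightarrow> g \<in> E H" using HK F_iff by blast
  obtain Q where Q: "cpartition Q" "\<forall>g. fixes_blocks Q g \<longrightarrow> g \<in> E K" using HK F_iff by blast
  obtain R where R: "cpartition R" "\<And>g. fixes_blocks R g \<Longrightarrow> fixes_blocks P g \<and> fixes_blocks Q g" using cpartition_refine[OF P(1) Q(1)] by blast
  have eL: "g \<in> E L \<longleftrightarrow> g \<in> E H \<and> g \<in> E K" for g using a by (auto simp: E_def)
  have sH: "is_subgroup M G H" "is_subgroup M G K" using HK F_iff by blast+
  have L: "g \<in> UM \<Longrightarrow> mem M g L \<longleftrightarrow> mem M g H \<and> mem M g K" for g using a by blast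
  have "is_subgroup M G L" unfolding is_subgroup_def
  proof (intro conjI ballI impI)
    show "is_set M L" using a by blast
    show "sub M L G" using sH(1) L unfolding is_subgroup_def sub_def by blast
    obtain i where i: "i \<in> UM" "is_identity M Atm i" "mem M i H" using sH(1) unfolding is_subgroup_def by blast
    obtain j where j: "j \<in> UM" "is_identity M Atm j" "mem M j K" using sH(2) unfolding is_subgroup_def by blast
    \<comment> \<open>Each subgroup provides an identity relation of its own; extensionality of
      relations makes them one element.\<close>
    have "i = j" by (rule rel_ext) (use i j in \<open>auto simp: is_identity_def\<close>)
    then show "\<exists>i\<in>UM. is_identity M Atm i \<and> mem M i L" using i j L by blast
  next
    fix g h k assume gk: "g \<in> UM" "h \<in> UM" "k \<in> UM" "mem M g L \<and> mem M h L \<and> is_comp M g h k"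
    then have "mem M k H" "mem M k K" using L[OF gk(1)] L[OF gk(2)] subgroup_comp[OF sH(1)] subgroup_comp[OF sH(2)] by metis+
    then show "mem M k L" using L[OF gk(3)] by blast
  next
    fix g k assume gk: "g \<in> UM" "k \<in> UM" "mem M g L \<and> is_inverse M g k"
    then have "mem M k H" "mem M k K" using L[OF gk(1)] subgroup_inverse[OF sH(1)] subgroup_inverse[OF sH(2)] by metis+
    then show "mem M k L" using L[OF gk(2)] by blast
  qed
  then have "L \<in> E F" unfolding F_iff using U R P(2) Q(2) eL by blast
  then show "mem M L F" by (simp add: E_def)
qed

text \<open>Fixing the blocks of the partition into singletons of \<open>S\<close> and the rest
  fixes \<open>S\<close> pointwise, so the base of the support filter lies in \<open>F\<close>, and
  then so does the filter. Fewer subgroups in the filter means fewer symmetric sets.\<close>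

lemma support_model_sub:
  assumes "F' \<in> UM" "is_countable_support_filter M G F'" shows "univ (perm_model M G F') \<subseteq> univ VM"
proof -
  let ?B = "\<lambda>H. \<exists>S\<in>UM. is_set M S \<and> sub M S Atm \<and> countable_set M S \<and> is_fix M G S H"
  have "mem M H F" if H: "H \<in> UM" "?B H" for H
  proof -
    obtain S where S: "S \<in> UM" "is_set M S" "sub M S Atm" "countable_set M S" "is_fix M G S H" using H by blast
    have c: "cnt (E S)" "E S \<subseteq> E Atm" using S c_countable self.c_sub by auto
    have SW: "E S \<subseteq> W" using c W_atom by blast
    have eq: "H = fixset S" using c_fix[OF S(1) SW H(1)] S(5) by simp
    obtain P where "cpartition P" "\<And>g a. fixes_blocks P g \<Longrightarrow> a \<in> E S \<Longrightarrow> pi g a = a" using cpartition_countable_set[OF c] by blast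
    then have "H \<in> E F" unfolding eq fixset_in_F[OF S(1) SW] by blast
    then show ?thesis by (simp add: E_def)
  qed
  then have "sub M F' F" using assms(2) F_U F_is_filter
    unfolding is_countable_support_filter_def is_generated_filter_def by blast
  then have sub: "E F' \<subseteq> E F" using assms(1) by (simp add: self.c_sub)
  have "symmetric M G F x" if "symmetric M G F' x" for x
    using that sub unfolding symmetric_def by (auto simp: E_def)
  then show ?thesis unfolding perm_model_def using c_hereditarily_symmetric by auto
qed

end

theorem theorem4p8:
  fixes M V :: "'m zfa_struct" and G F :: 'm
  assumes "zfa_model M" and "axiom_of_choice M"
    and "\<not> countable_set M (atoms M)"
    and "G \<in> univ M" and "is_full_sym_group M G"
    and "F \<in> univ M" and "is_countable_partition_filter M G F"
    and "V = perm_model M G F"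
  shows "((\<exists>w\<in>univ M. is_omega1 M w \<and> equipotent M (atoms M) w) \<longrightarrow>
            (\<forall>F'\<in>univ M. is_countable_support_filter M G F' \<longrightarrow>
               univ (perm_model M G F') \<subseteq> univ V)) \<and>
         (\<not> form3 V \<and> \<not> ISAE V \<and> \<not> EPWFP V) \<and>
         (\<forall>n\<in>univ V. \<forall>t\<in>univ V. is_nat V n \<and> is_two V t \<and> (t \<epsilon>\<^bsub>V\<^esub> n \<or> t = n) \<longrightarrow> \<not> AC_n V n) \<and>
         (\<not> (\<exists>r\<in>univ V. is_linear_order V (atoms V) r)) \<and>
         (\<not> W_aleph1 V \<and> \<not> DC_aleph1 V)"
proof -
  interpret pmodel M G F by unfold_locales (use assms in auto)
  have "atoms V = Atm" by (simp add: assms(8) perm_model_def)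
  then show ?thesis
    using support_model_sub not_form3 not_ISAE not_EPWFP not_AC_n no_linear_order not_W not_DC
    by (auto simp: assms(8) univ_V)
qed

end
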